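(* Let $X=(X_t)_{t\ge 0}$ be a Lévy process without positive jumps, such that $\mathbb{E}X_1>0$, and let $\sigma=\sup\{t\ge 0: X_t\le 0\}$ (which is finite a.s.). Then the random times $\overrightarrow{F}$, $\overleftarrow{F}$, $\overrightarrow{G}$, $\overleftarrow{G}$, $N^-$, $N^+$ associated with $X$ and $\sigma$ all have the same distribution.
   Context: $X$ is a real-valued Lévy process (càdlàg, $X_0=0$). Write $\overline{X}_t=\sup\{X_s: s\in[0,t]\}$ and $\underline{X}_t=\inf\{X_s: s\in[0,t]\}$ for the running supremum and running infimum. The random times are $$N^-=\int_0^\sigma \mathbf{1}_{\{X_s\le 0\}}\,ds,\qquad N^+=\int_0^\sigma \mathbf{1}_{\{X_s\ge 0\}}\,ds,$$ $$\overrightarrow{F}=\sup\{t\in[0,\sigma): X_t=\underline{X}_t\},\qquad \overrightarrow{G}=\sup\{t\in[0,\sigma): X_t=\overline{X}_t\},$$ $$\overleftarrow{F}=\sigma-\overrightarrow{F},\qquad \overleftarrow{G}=\sigma-\overrightarrow{G}.$$ When $\sigma=0$, all these times are set equal to $0$. *)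

theory Defs
  imports "HOL-Probability.Probability"
begin

text \<open>Paths are functions \<open>real \<Rightarrow> real\<close> of which only the restriction to
  \<open>{0..}\<close> is relevant.\<close>

definition cadlag :: "(real \<Rightarrow> real) \<Rightarrow> bool" where
  "cadlag f \<longleftrightarrow>
     (\<forall>t\<ge>0. (f \<longlongrightarrow> f t) (at_right t)) \<and>
     (\<forall>t>0. \<exists>l. (f \<longlongrightarrow> l) (at_left t))"

definition left_lim :: "(real \<Rightarrow> real) \<Rightarrow> real \<Rightarrow> real" where
  "left_lim f t = Lim (at_left t) f"

definition jump :: "(real \<Rightarrow> real) \<Rightarrow> real \<Rightarrow> real" where
  "jump f t = f t - left_lim f t"

text \<open>The path properties and \<open>X 0 = 0\<close> are only required almost surely.\<close>

locale levy_process = prob_space M for M :: "'a measure" +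
  fixes X :: "real \<Rightarrow> 'a \<Rightarrow> real"
  assumes random_variable_X: "t \<ge> 0 \<Longrightarrow> random_variable borel (X t)"
    and start_zero: "AE \<omega> in M. X 0 \<omega> = 0"
    and cadlag_paths: "AE \<omega> in M. cadlag (\<lambda>t. X t \<omega>)"
    and independent_increments:
      "\<And>(n::nat) (t :: nat \<Rightarrow> real). t 0 \<ge> 0 \<Longrightarrow> (\<And>i. i < n \<Longrightarrow> t i \<le> t (Suc i)) \<Longrightarrow>
         indep_vars (\<lambda>_. borel) (\<lambda>i \<omega>. X (t (Suc i)) \<omega> - X (t i) \<omega>) {..<n}"
    and stationary_increments:
      "\<And>s h. s \<ge> 0 \<Longrightarrow> h \<ge> 0 \<Longrightarrow>
         distr M borel (\<lambda>\<omega>. X (s + h) \<omega> - X s \<omega>) = distr M borel (\<lambda>\<omega>. X h \<omega> - X 0 \<omega>)"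

definition no_positive_jumps :: "'a measure \<Rightarrow> (real \<Rightarrow> 'a \<Rightarrow> real) \<Rightarrow> bool" where
  "no_positive_jumps M X \<longleftrightarrow> (AE \<omega> in M. \<forall>t>0. jump (\<lambda>s. X s \<omega>) t \<le> 0)"

definition running_sup :: "(real \<Rightarrow> 'a \<Rightarrow> real) \<Rightarrow> real \<Rightarrow> 'a \<Rightarrow> real" where
  "running_sup X t \<omega> = (SUP s\<in>{0..t}. X s \<omega>)"

definition running_inf :: "(real \<Rightarrow> 'a \<Rightarrow> real) \<Rightarrow> real \<Rightarrow> 'a \<Rightarrow> real" where
  "running_inf X t \<omega> = (INF s\<in>{0..t}. X s \<omega>)"

text \<open>The supremum is taken in \<open>real\<close>, so the value is meaningful only where the set is
  bounded above, i.e. where the last passage time is finite.\<close>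

definition last_nonpos :: "(real \<Rightarrow> 'a \<Rightarrow> real) \<Rightarrow> 'a \<Rightarrow> real" where
  "last_nonpos X \<omega> = Sup {t. t \<ge> 0 \<and> X t \<omega> \<le> 0}"

text \<open>In the following definitions \<open>\<sigma>\<close> is an arbitrary random time.\<close>

definition N_minus :: "(real \<Rightarrow> 'a \<Rightarrow> real) \<Rightarrow> ('a \<Rightarrow> real) \<Rightarrow> 'a \<Rightarrow> real" where
  "N_minus X \<sigma> \<omega> = (LINT s:{0..\<sigma> \<omega>}|lborel. indicat_real {s. X s \<omega> \<le> 0} s)"

definition N_plus :: "(real \<Rightarrow> 'a \<Rightarrow> real) \<Rightarrow> ('a \<Rightarrow> real) \<Rightarrow> 'a \<Rightarrow> real" where
  "N_plus X \<sigma> \<omega> = (LINT s:{0..\<sigma> \<omega>}|lborel. indicat_real {s. X s \<omega> \<ge> 0} s)"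

definition F_right :: "(real \<Rightarrow> 'a \<Rightarrow> real) \<Rightarrow> ('a \<Rightarrow> real) \<Rightarrow> 'a \<Rightarrow> real" where
  "F_right X \<sigma> \<omega> =
     (if \<sigma> \<omega> = 0 then 0 else Sup {t \<in> {0..<\<sigma> \<omega>}. X t \<omega> = running_inf X t \<omega>})"

definition G_right :: "(real \<Rightarrow> 'a \<Rightarrow> real) \<Rightarrow> ('a \<Rightarrow> real) \<Rightarrow> 'a \<Rightarrow> real" where
  "G_right X \<sigma> \<omega> =
     (if \<sigma> \<omega> = 0 then 0 else Sup {t \<in> {0..<\<sigma> \<omega>}. X t \<omega> = running_sup X t \<omega>})"

definition F_left :: "(real \<Rightarrow> 'a \<Rightarrow> real) \<Rightarrow> ('a \<Rightarrow> real) \<Rightarrow> 'a \<Rightarrow> real" where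
  "F_left X \<sigma> \<omega> = \<sigma> \<omega> - F_right X \<sigma> \<omega>"

definition G_left :: "(real \<Rightarrow> 'a \<Rightarrow> real) \<Rightarrow> ('a \<Rightarrow> real) \<Rightarrow> 'a \<Rightarrow> real" where
  "G_left X \<sigma> \<omega> = \<sigma> \<omega> - G_right X \<sigma> \<omega>"

text \<open>The random times are determined only up to null sets, and the probability space is not
  assumed complete, so measurability and laws are taken with respect to the completion of \<open>M\<close>. Measurability is part of the definition because \<open>distr\<close> is only
  meaningful for measurable functions.\<close>

definition same_distribution :: "'a measure \<Rightarrow> ('a \<Rightarrow> real) set \<Rightarrow> bool" where
  "same_distribution M \<T> \<longleftrightarrow>
     (\<forall>S\<in>\<T>. S \<in> borel_measurable (completion M)) \<and>
     (\<forall>S\<in>\<T>. \<forall>T\<in>\<T>. distr (completion M) borel S = distr (completion M) borel T)"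

end

theory Submission
  imports Defs "HOL-Combinatorics.Multiset_Permutations" "HOL-Real_Asymp.Real_Asymp"
begin

text \<open>
  Sample the process on a grid of width \<open>h\<close>. This gives a random walk with independent, identically
  distributed steps. For a small level \<open>y > 0\<close> let \<open>\<kappa>\<close> be the last index at which the walk is at most
  \<open>y\<close>. The event \<open>\<kappa> = k\<close> constrains the first \<open>k\<close> steps only through their sum, so conditionally on it
  these steps are exchangeable (\<open>exchangeable_before_last\<close>). The six random times are limits of
  functionals of the walk up to \<open>\<kappa>\<close>, and exchangeability relates the laws of these functionals.

  Sparre Andersen's identity (\<open>sparre_andersen\<close>): the number of positive partial sums has the law of the
  first place of the maximum. For the steps and for their negatives this yields that \<open>N_plus\<close> has the law
  of \<open>G_right\<close>, and \<open>N_minus\<close> that of \<open>F_right\<close>. If the steps are reversed in addition, the place of the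
  maximum becomes the distance of the minimum from the end, so that \<open>N_plus\<close> has the law of \<open>F_left\<close>,
  and \<open>N_minus\<close> that of \<open>G_left\<close>.

  It remains to compare \<open>N_plus\<close> with \<open>N_minus\<close>, and here it matters that the process, having no positive
  jumps, ends in \<open>0\<close> at time \<open>\<sigma>\<close>. A small linear tilt turns the walk up to \<open>\<kappa>\<close> into a bridge. If a bridge is
  shifted cyclically, the number of its positive partial sums becomes the rank of the new starting
  point among all points; averaged over all shifts it is uniformly distributed, up to ties, and so is the number
  of negative partial sums (\<open>cyclic_comparison\<close>).

  The place of the maximum does not depend continuously on the path, and the maximum may be approached at
  several places. For this reason a drift \<open>\<epsilon>\<close> is added to the walk. An upward drift moves the maximiser to the
  last record or behind it, a downward drift to the last record or before it, while the time spent
  above \<open>0\<close> is hardly affected. So the expectations of increasing functions of \<open>G_right\<close> are squeezed between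
  equal bounds (\<open>law_of_discrete_limit\<close>). The limits are taken in the order \<open>h \<rightarrow> 0\<close>, \<open>y \<rightarrow> 0\<close>, \<open>\<epsilon> \<rightarrow> 0\<close>.

  Two properties of the process are needed for this. First, it eventually stays above \<open>1\<close>
  (\<open>eventually_above_1\<close>), in particular \<open>\<sigma>\<close> is finite: a maximal ergodic inequality shows that the process tends to
  infinity along the integers, and an inequality of Ottaviani's type fills the gaps between them. Second, it
  spends no time at \<open>0\<close> (\<open>zero_level_null\<close>): by the strong Markov property and the absence of positive
  jumps, all levels in an interval would be occupied as much as \<open>0\<close>, and there are too many of them.

  The required path properties hold almost surely only; the process is first replaced by
  a version for which they hold everywhere (\<open>levy_modification\<close>).
\<close>

section \<open>Partial sums under rearrangement of the steps\<close>

definition maximiser :: "(nat \<Rightarrow> real) \<Rightarrow> nat \<Rightarrow> nat \<Rightarrow> bool" where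
  "maximiser g K J \<longleftrightarrow> J \<le> K \<and> (\<forall>j\<le>K. g j \<le> g J)"

abbreviation psum :: "real list \<Rightarrow> nat \<Rightarrow> real" where
  "psum xs j \<equiv> sum_list (take j xs)"

text \<open>The number of positive partial sums is the discrete counterpart of the time spent above \<open>0\<close>.\<close>

definition num_pos :: "real list \<Rightarrow> nat" where
  "num_pos xs = card {j\<in>{1..length xs}. 0 < psum xs j}"

definition num_nonneg :: "real list \<Rightarrow> nat" where
  "num_nonneg xs = card {j\<in>{1..length xs}. 0 \<le> psum xs j}"

definition first_argmax :: "real list \<Rightarrow> nat" where
  "first_argmax xs = (LEAST j. maximiser (psum xs) (length xs) j)"

lemma ex_maximiser: "\<exists>J. maximiser g K J"
proof -
  have "finite {..K}" "{..K} \<noteq> {}" by auto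
  from arg_min_if_finite[OF this, of "\<lambda>j. - g j"] show ?thesis
    unfolding maximiser_def by (intro exI[of _ "arg_min_on (\<lambda>j. - g j) {..K}"])
      (metis atMost_iff linorder_not_le neg_less_iff_less)
qed

lemma first_argmax: "maximiser (psum xs) (length xs) (first_argmax xs)"
  unfolding first_argmax_def using ex_maximiser by (rule LeastI_ex)

lemma first_argmaxI:
  assumes "J \<le> length xs" "\<And>j. j \<le> length xs \<Longrightarrow> psum xs j \<le> psum xs J"
    "\<And>j. j < J \<Longrightarrow> psum xs j < psum xs J"
  shows "first_argmax xs = J"
  unfolding first_argmax_def
proof (rule Least_equality)
  show "maximiser (psum xs) (length xs) J" using assms by (auto simp: maximiser_def)
  fix j assume "maximiser (psum xs) (length xs) j"
  then show "J \<le> j" using assms by (metis maximiser_def linorder_not_le)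
qed

lemma first_argmaxD:
  shows "first_argmax xs \<le> length xs"
    "\<And>j. j \<le> length xs \<Longrightarrow> psum xs j \<le> psum xs (first_argmax xs)"
    "\<And>j. j < first_argmax xs \<Longrightarrow> psum xs j < psum xs (first_argmax xs)"
proof -
  show *: "first_argmax xs \<le> length xs"
    "\<And>j. j \<le> length xs \<Longrightarrow> psum xs j \<le> psum xs (first_argmax xs)"
    using first_argmax[of xs] by (auto simp: maximiser_def)
  fix j assume j: "j < first_argmax xs"
  then have "\<not> maximiser (psum xs) (length xs) j"
    unfolding first_argmax_def by (rule not_less_Least)
  then obtain i where "i \<le> length xs" "psum xs j < psum xs i"
    using j *(1) by (auto simp: maximiser_def not_le)
  then show "psum xs j < psum xs (first_argmax xs)" using *(2)[of i] by simp
qed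

text \<open>A new last step that brings the total to a nonpositive value cannot create a maximum, because
  the empty sum \<open>0\<close> is already one of the candidates.\<close>

lemma first_argmax_snoc:
  assumes "sum_list xs + x \<le> 0"
  shows "first_argmax (xs @ [x]) = first_argmax xs"
proof (rule first_argmaxI)
  note F = first_argmaxD[where xs=xs]
  show "first_argmax xs \<le> length (xs @ [x])" using F by simp
  show "psum (xs @ [x]) j \<le> psum (xs @ [x]) (first_argmax xs)" if "j \<le> length (xs @ [x])" for j
  proof (cases "j \<le> length xs")
    case False
    then have "j = Suc (length xs)" using that by simp
    then have "psum (xs @ [x]) j \<le> 0" using assms by simp
    also have "0 \<le> psum xs (first_argmax xs)" using F(2)[of 0] by simp
    finally show ?thesis using F(1) by simp
  qed (use F in auto)
  show "psum (xs @ [x]) j < psum (xs @ [x]) (first_argmax xs)" if "j < first_argmax xs" for j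
    using F(1) F(3)[OF that] that by simp
qed

text \<open>A new first step only translates the old candidates. The value \<open>0\<close> at the new origin loses
  against the endpoint, which is positive, so the first maximiser moves by exactly one place.\<close>

lemma first_argmax_Cons:
  assumes "0 < x + sum_list xs"
  shows "first_argmax (x # xs) = Suc (first_argmax xs)"
proof (rule first_argmaxI)
  note F = first_argmaxD[where xs=xs]
  show "Suc (first_argmax xs) \<le> length (x # xs)" using F by simp
  have pos: "0 < x + psum xs (first_argmax xs)" using assms F(2)[OF order_refl] by simp
  show "psum (x # xs) j \<le> psum (x # xs) (Suc (first_argmax xs))" if "j \<le> length (x # xs)" for j
    using pos F(2) that by (cases j) auto
  show "psum (x # xs) j < psum (x # xs) (Suc (first_argmax xs))" if "j < Suc (first_argmax xs)" for j
    using pos F(3) that by (cases j) auto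
qed

lemma num_pos_snoc:
  "num_pos (xs @ [x]) = num_pos xs + (if 0 < sum_list xs + x then 1 else 0)"
proof -
  have "{j\<in>{1..length (xs @ [x])}. 0 < psum (xs @ [x]) j}
      = {j\<in>{1..length xs}. 0 < psum xs j} \<union> (if 0 < sum_list xs + x then {Suc (length xs)} else {})"
    by (auto simp: le_Suc_eq)
  then show ?thesis by (auto simp: num_pos_def card_insert_if)
qed

text \<open>Joseph's rearrangement. The argument lists the indices with the last step first. Reading the walk in
  its original order, the current step is put in front if the partial sum that it completes is
  positive, and at the end otherwise.\<close>

fun rearrange :: "('i \<Rightarrow> real) \<Rightarrow> 'i list \<Rightarrow> 'i list" where
  "rearrange z [] = []"
| "rearrange z (i # l) =
     (if 0 < sum_list (map z (i # l)) then i # rearrange z l else rearrange z l @ [i])"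

lemma mset_rearrange [simp]: "mset (rearrange z l) = mset l"
  by (induction l) auto

lemma sum_list_mset_cong: "mset xs = mset ys \<Longrightarrow> sum_list (map z xs) = sum_list (map (z :: 'i \<Rightarrow> real) ys)"
  by (metis mset_map sum_mset_sum_list)

lemma sum_rearrange [simp]: "sum_list (map z (rearrange z l)) = sum_list (map z l)"
  by (rule sum_list_mset_cong) simp

text \<open>The recursion of the rearrangement adds one to the first maximiser exactly when a positive partial
  sum occurs, by the two preceding facts on appending and prepending a step.\<close>

lemma first_argmax_rearrange: "first_argmax (map z (rearrange z l)) = num_pos (map z (rev l))"
proof (induction l)
  case Nil
  have "first_argmax [] = 0" by (rule first_argmaxI) auto
  then show ?case by (simp add: num_pos_def)
next
  case (Cons i l)
  have [simp]: "sum_list (map z (rev l)) = sum_list (map z l)" by (rule sum_list_mset_cong) simp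
  show ?case
    using Cons by (auto simp: num_pos_snoc first_argmax_Cons first_argmax_snoc add.commute)
qed

text \<open>The sign of the total sum, which is not changed by permuting the steps, tells at which end the last
  step was inserted. So the rearrangement can be undone step by step.\<close>

lemma rearrange_inj: "mset l = mset l' \<Longrightarrow> rearrange z l = rearrange z l' \<Longrightarrow> l = l'"
proof (induction l arbitrary: l')
  case (Cons i l)
  then obtain i' m where l': "l' = i' # m" by (cases l') auto
  have s: "sum_list (map z (i # l)) = sum_list (map z (i' # m))"
    using Cons.prems(1) unfolding l' by (rule sum_list_mset_cong)
  have "i = i' \<and> rearrange z l = rearrange z m"
    using Cons.prems(2) s unfolding l' by (auto split: if_splits)
  then show ?case using Cons l' by auto
qed simp

lemma bij_rearrange:
  fixes z :: "nat \<Rightarrow> real"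
  shows "bij_betw (\<lambda>l. rearrange z (rev l)) (permutations_of_set {..<k}) (permutations_of_set {..<k::nat})"
proof -
  have m: "mset l = mset l'" if "l \<in> permutations_of_set {..<k}" "l' \<in> permutations_of_set {..<k}" for l l'
    using that by (simp add: permutations_of_set_def set_eq_iff_mset_eq_distinct[symmetric])
  have inj: "inj_on (\<lambda>l. rearrange z (rev l)) (permutations_of_set {..<k})"
    by (rule inj_onI) (use m rearrange_inj in \<open>metis mset_rev rev_rev_ident\<close>)
  have sub: "(\<lambda>l. rearrange z (rev l)) ` permutations_of_set {..<k} \<subseteq> permutations_of_set {..<k}"
  proof safe
    fix l assume l: "l \<in> permutations_of_set {..<k}"
    have "mset (rearrange z (rev l)) = mset l" by simp
    then show "rearrange z (rev l) \<in> permutations_of_set {..<k}"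
      using l unfolding permutations_of_set_def by (metis (mono_tags, lifting) mem_Collect_eq mset_eq_setD mset_eq_imp_distinct_iff)
  qed
  show ?thesis unfolding bij_betw_def using inj endo_inj_surj[OF _ sub inj] by auto
qed

text \<open>Sparre Andersen's identity in its combinatorial form: over all orderings of given steps, the number
  of positive partial sums and the first place of the maximum are equidistributed, because
  the rearrangement is a bijection of the orderings that carries one into the other.\<close>

theorem sparre_andersen:
  fixes F :: "nat \<Rightarrow> 'b :: comm_monoid_add" and z :: "nat \<Rightarrow> real"
  shows "(\<Sum>l\<in>permutations_of_set {..<k}. F (num_pos (map z l)))
       = (\<Sum>l\<in>permutations_of_set {..<k}. F (first_argmax (map z l)))"
  using sum.reindex_bij_betw[OF bij_rearrange[of z k], of "\<lambda>l. F (first_argmax (map z l))"]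
  by (simp add: first_argmax_rearrange)

lemma sum_list_uminus_real: "sum_list (map uminus xs) = - sum_list (xs :: real list)"
  by (induction xs) auto

lemma sum_perms_rev:
  "(\<Sum>l\<in>permutations_of_set {..<k}. G (rev l)) = (\<Sum>l\<in>permutations_of_set {..<k::nat}. G l)"
proof (rule sum.reindex_bij_betw[of rev])
  have "rev ` permutations_of_set {..<k} = permutations_of_set {..<k}"
  proof safe
    fix l assume "l \<in> permutations_of_set {..<k}"
    then show "l \<in> rev ` permutations_of_set {..<k}"
      by (intro image_eqI[of _ _ "rev l"]) (auto simp: permutations_of_set_def)
  qed (auto simp: permutations_of_set_def)
  then show "bij_betw rev (permutations_of_set {..<k}) (permutations_of_set {..<k})"
    by (simp add: bij_betw_def)
qed

lemma sum_perms_rotate: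
  "(\<Sum>l\<in>permutations_of_set {..<k}. G (rotate r l)) = (\<Sum>l\<in>permutations_of_set {..<k::nat}. G l)"
proof (rule sum.reindex_bij_betw[of "rotate r"])
  have inj: "inj_on (rotate r) (permutations_of_set {..<k})"
    using inj_fn[OF inj_rotate1, of r] unfolding rotate_def by (rule inj_on_subset) simp
  have sub: "rotate r ` permutations_of_set {..<k} \<subseteq> permutations_of_set {..<k}"
  proof (rule image_subsetI)
    fix l assume "l \<in> permutations_of_set {..<k}"
    from permutations_of_setD[OF this] show "rotate r l \<in> permutations_of_set {..<k}"
      by (intro permutations_of_setI) simp_all
  qed
  have "rotate r ` permutations_of_set {..<k} = permutations_of_set {..<k}"
    by (rule endo_inj_surj[OF _ sub inj]) simp
  then show "bij_betw (rotate r) (permutations_of_set {..<k}) (permutations_of_set {..<k})"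
    unfolding bij_betw_def using inj by blast
qed

text \<open>The partial sums of the reversed steps are the total minus the partial sums of the complementary
  index. Hence a maximum from the left is a minimum seen from the right end.\<close>

lemma maximiser_rev:
  assumes "maximiser (psum (rev xs)) (length xs) J"
  shows "maximiser (\<lambda>j. - psum xs j) (length xs) (length xs - J)"
proof -
  have eq: "psum (rev xs) j = sum_list xs - psum xs (length xs - j)" if "j \<le> length xs" for j
  proof -
    have "psum (rev xs) j = sum_list (drop (length xs - j) xs)" by (simp add: take_rev)
    moreover have "sum_list xs = psum xs (length xs - j) + sum_list (drop (length xs - j) xs)"
      by (metis append_take_drop_id sum_list_append)
    ultimately show ?thesis by simp
  qed
  have J: "J \<le> length xs" "\<And>j. j \<le> length xs \<Longrightarrow> psum (rev xs) j \<le> psum (rev xs) J"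
    using assms by (auto simp: maximiser_def)
  show ?thesis unfolding maximiser_def
  proof safe
    fix j assume "j \<le> length xs"
    then show "- psum xs j \<le> - psum xs (length xs - J)"
      using J(2)[of "length xs - j"] eq[of J] eq[of "length xs - j"] J(1) by simp
  qed simp
qed

text \<open>For steps of total \<open>0\<close> the partial sums live on the cyclic group of the indices, and a cyclic
  shift of the steps moves the origin of the walk to another of its points.\<close>

lemma psum_rotate:
  assumes s: "sum_list xs = 0" and r: "r < length xs" and j: "j \<le> length xs"
  shows "psum (rotate r xs) j = psum xs ((r + j) mod length xs) - psum xs r"
proof (cases "r + j < length xs")
  case True
  have "take j (rotate r xs) = take j (drop r xs)"
    using True r by (simp add: rotate_drop_take)
  moreover have "psum xs (r + j) = psum xs r + sum_list (take j (drop r xs))"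
    by (simp add: take_add)
  ultimately show ?thesis using True by simp
next
  case False
  have d: "sum_list (drop r xs) = - psum xs r"
    using s by (metis append_take_drop_id sum_list_append add_eq_0_iff)
  define m where "m = r + j - length xs"
  have m: "m \<le> r" "j = length xs - r + m" using False j r by (auto simp: m_def)
  have "take j (rotate r xs) = drop r xs @ take m xs"
    using r m by (simp add: rotate_drop_take)
  then have e: "psum (rotate r xs) j = psum xs m - psum xs r" using d by simp
  have "(r + j) mod length xs = m"
    using m r by (simp add: mod_if)
  then show ?thesis using e by simp
qed

lemma bij_shift:
  assumes "r < k"
  shows "bij_betw (\<lambda>j. (r + j) mod k) {1..k} {..<k::nat}"
proof (rule bij_betw_byWitness[where f'="\<lambda>i. if i \<le> r then i + k - r else i - r"])
  show "\<forall>a\<in>{1..k}. (if (r + a) mod k \<le> r then (r + a) mod k + k - r else (r + a) mod k - r) = a"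
  proof
    fix a assume "a \<in> {1..k}"
    then show "(if (r + a) mod k \<le> r then (r + a) mod k + k - r else (r + a) mod k - r) = a"
      using assms by (cases "r + a < k") (auto simp: mod_if)
  qed
  show "\<forall>i\<in>{..<k}. (r + (if i \<le> r then i + k - r else i - r)) mod k = i"
    using assms by auto
  show "(\<lambda>j. (r + j) mod k) ` {1..k} \<subseteq> {..<k}" using assms by auto
  show "(\<lambda>i. if i \<le> r then i + k - r else i - r) ` {..<k} \<subseteq> {1..k}" using assms by auto
qed

lemma num_rotate:
  assumes "sum_list xs = 0" "r < length xs"
  shows "card {j\<in>{1..length xs}. P (psum (rotate r xs) j)} = card {i\<in>{..<length xs}. P (psum xs i - psum xs r)}"
proof (rule bij_betw_same_card)
  let ?k = "length xs"
  have b: "bij_betw (\<lambda>j. (r + j) mod ?k) {1..?k} {..<?k}" by (rule bij_shift[OF assms(2)])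
  show "bij_betw (\<lambda>j. (r + j) mod ?k) {j\<in>{1..?k}. P (psum (rotate r xs) j)} {i\<in>{..<?k}. P (psum xs i - psum xs r)}"
  proof (rule bij_betw_subset[OF b])
    show "{j\<in>{1..?k}. P (psum (rotate r xs) j)} \<subseteq> {1..?k}" by auto
    show "(\<lambda>j. (r + j) mod ?k) ` {j\<in>{1..?k}. P (psum (rotate r xs) j)} = {i\<in>{..<?k}. P (psum xs i - psum xs r)}"
    proof (intro subset_antisym subsetI)
      fix i assume i: "i \<in> {i\<in>{..<?k}. P (psum xs i - psum xs r)}"
      then obtain j where j: "j \<in> {1..?k}" "i = (r + j) mod ?k"
        using bij_betw_imp_surj_on[OF b] by (metis (no_types, lifting) image_iff mem_Collect_eq)
      then have "psum (rotate r xs) j = psum xs i - psum xs r"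
        using psum_rotate[OF assms, of j] by simp
      then have "j \<in> {j\<in>{1..?k}. P (psum (rotate r xs) j)}" using i j(1) by simp
      then show "i \<in> (\<lambda>j. (r + j) mod ?k) ` {j\<in>{1..?k}. P (psum (rotate r xs) j)}"
        using j(2) by (rule rev_image_eqI)
    next
      fix i assume "i \<in> (\<lambda>j. (r + j) mod ?k) ` {j\<in>{1..?k}. P (psum (rotate r xs) j)}"
      then obtain j where "j \<in> {j\<in>{1..?k}. P (psum (rotate r xs) j)}" "i = (r + j) mod ?k"
        by (rule imageE)
      then have j: "j \<in> {1..?k}" "P (psum (rotate r xs) j)" "i = (r + j) mod ?k" by simp_all
      then have "psum (rotate r xs) j = psum xs i - psum xs r"
        using psum_rotate[OF assms, of j] by simp
      moreover have "i < ?k" unfolding j(3) using assms(2) by (intro mod_less_divisor) linarith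
      ultimately show "i \<in> {i\<in>{..<?k}. P (psum xs i - psum xs r)}" using j(2) by simp
    qed
  qed
qed

text \<open>Ranking points by height, with ties broken by the index, is a bijection; each rank lies between the
  number of strictly higher and the number of at least equally high points.\<close>

lemma rank_bij:
  fixes T :: "nat \<Rightarrow> real"
  shows "\<exists>\<rho>. bij_betw \<rho> {..<k} {..<k} \<and>
    (\<forall>r<k. card {i\<in>{..<k}. T r < T i} \<le> \<rho> r \<and> \<rho> r \<le> card {i\<in>{..<k}. T r \<le> T i})"
proof -
  define B where "B r = {i\<in>{..<k}. T r < T i \<or> (T r = T i \<and> i < r)}" for r
  define \<rho> where "\<rho> r = card (B r)" for r
  have fin: "finite (B r)" for r by (simp add: B_def)
  have lt: "\<rho> r < \<rho> s" if "r < k" "s < k" "T s < T r \<or> (T s = T r \<and> r < s)" for r s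
    unfolding \<rho>_def
  proof (rule psubset_card_mono[OF fin])
    have "r \<in> B s" "r \<notin> B r" using that by (auto simp: B_def)
    moreover have "B r \<subseteq> B s" using that by (auto simp: B_def)
    ultimately show "B r \<subset> B s" by auto
  qed
  have inj: "inj_on \<rho> {..<k}"
  proof (rule inj_onI)
    fix r s assume rs: "r \<in> {..<k}" "s \<in> {..<k}" "\<rho> r = \<rho> s"
    show "r = s"
    proof (rule ccontr)
      assume "r \<noteq> s"
      then consider "T s < T r \<or> (T s = T r \<and> r < s)" | "T r < T s \<or> (T r = T s \<and> s < r)" by linarith
      then show False using lt[of r s] lt[of s r] rs by cases auto
    qed
  qed
  have "\<rho> r < k" if "r < k" for r
  proof -
    have "B r \<subset> {..<k}" using that by (auto simp: B_def)
    then have "card (B r) < card {..<k}" by (rule psubset_card_mono[rotated]) simp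
    then show ?thesis by (simp add: \<rho>_def)
  qed
  then have sub: "\<rho> ` {..<k} \<subseteq> {..<k}" by auto
  have "bij_betw \<rho> {..<k} {..<k}"
    unfolding bij_betw_def using inj endo_inj_surj[OF _ sub inj] by auto
  moreover have "card {i\<in>{..<k}. T r < T i} \<le> \<rho> r \<and> \<rho> r \<le> card {i\<in>{..<k}. T r \<le> T i}" for r
    unfolding \<rho>_def by (intro conjI card_mono) (auto simp: B_def)
  ultimately show ?thesis by blast
qed

text \<open>After the shift by \<open>r\<close> the number of positive partial sums is the number of points of the bridge above
  the \<open>r\<close>-th one, so over all \<open>r\<close> it takes each of the values \<open>0, 1, \<dots>\<close> once, up to ties. The same holds
  for points below. Counting ties on the larger side turns this into an inequality without
  exceptions.\<close>

theorem cyclic_comparison: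
  fixes F :: "nat \<Rightarrow> 'b :: ordered_comm_monoid_add"
  assumes s: "sum_list xs = 0" and F: "\<And>i j. i \<le> j \<Longrightarrow> F i \<le> F j"
  shows "(\<Sum>r<length xs. F (num_pos (rotate r xs))) \<le> (\<Sum>r<length xs. F (num_nonneg (map uminus (rotate r xs))))"
proof -
  let ?k = "length xs" and ?T = "psum xs"
  obtain \<rho> where \<rho>: "bij_betw \<rho> {..<?k} {..<?k}"
    "\<And>r. r < ?k \<Longrightarrow> card {i\<in>{..<?k}. ?T r < ?T i} \<le> \<rho> r" using rank_bij[of ?k ?T] by auto
  obtain \<rho>' where \<rho>': "bij_betw \<rho>' {..<?k} {..<?k}"
    "\<And>r. r < ?k \<Longrightarrow> \<rho>' r \<le> card {i\<in>{..<?k}. - ?T r \<le> - ?T i}"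
    using rank_bij[of ?k "\<lambda>i. - ?T i"] by auto
  have np: "num_pos (rotate r xs) = card {i\<in>{..<?k}. ?T r < ?T i}" if "r < ?k" for r
    using num_rotate[OF s that, of "\<lambda>x. 0 < x"] by (simp add: num_pos_def)
  have nn: "num_nonneg (map uminus (rotate r xs)) = card {i\<in>{..<?k}. - ?T r \<le> - ?T i}" if "r < ?k" for r
    using num_rotate[OF s that, of "\<lambda>x. 0 \<le> - x"]
    by (simp add: num_nonneg_def take_map sum_list_uminus_real)
  have "(\<Sum>r<?k. F (num_pos (rotate r xs))) \<le> (\<Sum>r<?k. F (\<rho> r))"
    using \<rho>(2) np by (intro sum_mono F) simp
  also have "\<dots> = (\<Sum>r<?k. F r)" by (rule sum.reindex_bij_betw[OF \<rho>(1)])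
  also have "\<dots> = (\<Sum>r<?k. F (\<rho>' r))" by (rule sum.reindex_bij_betw[OF \<rho>'(1), symmetric])
  also have "\<dots> \<le> (\<Sum>r<?k. F (num_nonneg (map uminus (rotate r xs))))"
    using \<rho>'(2) nn by (intro sum_mono F) simp
  finally show ?thesis .
qed

text \<open>The linear tilt makes the walk a bridge and commutes with permutations of the steps, so it does not
  destroy their exchangeability.\<close>

definition tilt :: "real list \<Rightarrow> real list" where
  "tilt xs = map (\<lambda>v. v - sum_list xs / real (length xs)) xs"

lemma sum_list_tilt [simp]: "sum_list (tilt xs) = 0"
  by (cases "xs = []") (simp_all add: tilt_def sum_list_subtractf sum_list_triv)

lemma length_tilt [simp]: "length (tilt xs) = length xs"
  by (simp add: tilt_def)

lemma tilt_rotate: "tilt (rotate r xs) = rotate r (tilt xs)"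
proof -
  have "sum_list (rotate r xs) = sum_list xs"
    unfolding rotate_drop_take by (metis add.commute append_take_drop_id sum_list_append)
  then show ?thesis by (simp add: tilt_def rotate_map)
qed

text \<open>Summing over all orderings already averages over cyclic shifts, so the comparison for the shifts of
  one bridge carries over.\<close>

lemma cyclic_sum:
  fixes F :: "nat \<Rightarrow> ennreal" and x :: "nat \<Rightarrow> real"
  assumes F: "\<And>i j. i \<le> j \<Longrightarrow> F i \<le> F j"
  shows "(\<Sum>l\<in>permutations_of_set {..<k}. F (num_pos (tilt (map x l))))
       \<le> (\<Sum>l\<in>permutations_of_set {..<k}. F (num_nonneg (map uminus (tilt (map x l)))))"
proof (cases "k = 0")
  case True
  then show ?thesis by (simp add: tilt_def num_pos_def num_nonneg_def)
next
  case False
  let ?P = "permutations_of_set {..<k}"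
  have len: "length l = k" if "l \<in> ?P" for l
    using that length_finite_permutations_of_set[of l "{..<k}"] by simp
  have *: "of_nat k * (\<Sum>l\<in>?P. H (tilt (map x l))) = (\<Sum>l\<in>?P. \<Sum>r<length (tilt (map x l)). H (rotate r (tilt (map x l))))"
    for H :: "real list \<Rightarrow> ennreal"
  proof -
    have "of_nat k * (\<Sum>l\<in>?P. H (tilt (map x l))) = (\<Sum>r<k. \<Sum>l\<in>?P. H (tilt (map x (rotate r l))))"
      using sum_perms_rotate[of "\<lambda>l. H (tilt (map x l))" _ k] by simp
    also have "\<dots> = (\<Sum>l\<in>?P. \<Sum>r<k. H (tilt (map x (rotate r l))))" by (rule sum.swap)
    also have "\<dots> = (\<Sum>l\<in>?P. \<Sum>r<length (tilt (map x l)). H (rotate r (tilt (map x l))))"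
      by (intro sum.cong refl) (simp_all add: len rotate_map[symmetric] tilt_rotate)
    finally show ?thesis .
  qed
  have "of_nat k * (\<Sum>l\<in>?P. F (num_pos (tilt (map x l))))
      \<le> of_nat k * (\<Sum>l\<in>?P. F (num_nonneg (map uminus (tilt (map x l)))))"
    unfolding *[of "\<lambda>xs. F (num_pos xs)"] *[of "\<lambda>xs. F (num_nonneg (map uminus xs))"]
    by (intro sum_mono cyclic_comparison F) auto
  then show ?thesis
    using False by (subst (asm) ennreal_mult_le_mult_iff) auto
qed

section \<open>Comparison of laws along iterated limits\<close>

text \<open>The three indices stand for a drift, a level and a grid width, all of them \<open>1 / (m + 1)\<close>. They are
  sent to their limits in this order of nesting: the grid is refined first, then the level is lowered
  to \<open>0\<close>, and the drift is removed last.\<close>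

abbreviation ev3 :: "(nat \<Rightarrow> nat \<Rightarrow> nat \<Rightarrow> bool) \<Rightarrow> bool" where
  "ev3 P \<equiv> \<forall>\<^sub>F i in sequentially. \<forall>\<^sub>F k in sequentially. \<forall>\<^sub>F n in sequentially. P i k n"

lemma ev3_mono:
  assumes "ev3 P" "\<And>i k n. P i k n \<Longrightarrow> Q i k n"
  shows "ev3 Q"
  using assms(1)
proof eventually_elim
  case (elim i)
  then show ?case
  proof eventually_elim
    case (elim k)
    then show ?case by eventually_elim (rule assms(2))
  qed
qed

lemma ev3_conj:
  assumes "ev3 P" "ev3 Q"
  shows "ev3 (\<lambda>i k n. P i k n \<and> Q i k n)"
  using assms
proof eventually_elim
  case (elim i)
  then show ?case
  proof eventually_elim
    case (elim k)
    then show ?case by eventually_elim auto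
  qed
qed

lemma ev3_ex: "ev3 P \<Longrightarrow> \<exists>i k n. P i k n"
  by (auto dest!: eventually_happens)

definition lim3 :: "(nat \<Rightarrow> nat \<Rightarrow> nat \<Rightarrow> ennreal) \<Rightarrow> ennreal" where
  "lim3 u = liminf (\<lambda>i. liminf (\<lambda>k. liminf (\<lambda>n. u i k n)))"

lemma lim3_bounded: "ev3 (\<lambda>i k n. c \<le> u i k n) \<Longrightarrow> c \<le> lim3 u"
  unfolding lim3_def
  by (intro Liminf_bounded, elim eventually_mono, intro Liminf_bounded, elim eventually_mono, intro Liminf_bounded)

lemma less_lim3: "c < lim3 u \<Longrightarrow> ev3 (\<lambda>i k n. c < u i k n)"
  unfolding lim3_def
  by (drule less_LiminfD, elim eventually_mono, drule less_LiminfD, elim eventually_mono, drule less_LiminfD)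

lemma lim3_measurable [measurable]:
  assumes [measurable]: "\<And>i k n. u i k n \<in> borel_measurable M"
  shows "(\<lambda>x. lim3 (\<lambda>i k n. u i k n x)) \<in> borel_measurable M"
  unfolding lim3_def by measurable

lemma fatou3:
  assumes [measurable]: "\<And>i k n. u i k n \<in> borel_measurable M"
  shows "(\<integral>\<^sup>+x. lim3 (\<lambda>i k n. u i k n x) \<partial>M) \<le> lim3 (\<lambda>i k n. \<integral>\<^sup>+x. u i k n x \<partial>M)"
proof -
  have "(\<integral>\<^sup>+x. lim3 (\<lambda>i k n. u i k n x) \<partial>M)
      \<le> liminf (\<lambda>i. \<integral>\<^sup>+x. liminf (\<lambda>k. liminf (\<lambda>n. u i k n x)) \<partial>M)"
    unfolding lim3_def by (rule nn_integral_liminf) measurable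
  also have "\<dots> \<le> liminf (\<lambda>i. liminf (\<lambda>k. \<integral>\<^sup>+x. liminf (\<lambda>n. u i k n x) \<partial>M))"
    by (intro Liminf_mono always_eventually allI nn_integral_liminf) measurable
  also have "\<dots> \<le> liminf (\<lambda>i. liminf (\<lambda>k. liminf (\<lambda>n. \<integral>\<^sup>+x. u i k n x \<partial>M)))"
    by (intro Liminf_mono always_eventually allI nn_integral_liminf) measurable
  finally show ?thesis by (simp add: lim3_def)
qed

text \<open>Monotone test functions suffice to determine a law, and for them one-sided pathwise bounds
  already give inequalities between expectations.\<close>

definition test_fun :: "(real \<Rightarrow> real) \<Rightarrow> bool" where
  "test_fun \<phi> \<longleftrightarrow> mono \<phi> \<and> continuous_on UNIV \<phi> \<and> (\<forall>x. 0 \<le> \<phi> x \<and> \<phi> x \<le> 1)"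

lemma test_funD:
  assumes "test_fun \<phi>"
  shows "mono \<phi>" "continuous_on UNIV \<phi>" "0 \<le> \<phi> x" "\<phi> x \<le> 1" "\<phi> \<in> borel_measurable borel"
    "x \<le> y \<Longrightarrow> \<phi> x \<le> \<phi> y"
  using assms by (auto simp: test_fun_def intro: borel_measurable_continuous_onI dest: monoD)

lemma test_fun_reflect:
  assumes "test_fun \<phi>"
  shows "test_fun (\<lambda>x. 1 - \<phi> (- x))"
  unfolding test_fun_def
proof (intro conjI allI)
  show "mono (\<lambda>x. 1 - \<phi> (- x))" using test_funD(6)[OF assms] by (auto intro!: monoI)
  show "continuous_on UNIV (\<lambda>x. 1 - \<phi> (- x))"
    by (intro continuous_intros continuous_on_compose2[OF test_funD(2)[OF assms]]) auto
qed (use test_funD(3,4)[OF assms] in auto)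

lemma ev3_test_fun:
  assumes \<phi>: "test_fun \<phi>" and ev: "\<And>a. a < g \<Longrightarrow> ev3 (\<lambda>i k n. a < A i k n)"
  shows "ennreal (\<phi> g) \<le> lim3 (\<lambda>i k n. ennreal (\<phi> (A i k n)))"
proof (rule dense_le)
  fix c assume c: "c < ennreal (\<phi> g)"
  have "isCont \<phi> g" using test_funD(2)[OF \<phi>] by (simp add: continuous_on_eq_continuous_at)
  then have "((\<lambda>x. ennreal (\<phi> x)) \<longlongrightarrow> ennreal (\<phi> g)) (at_left g)"
    by (intro tendsto_ennrealI) (simp add: isCont_def filterlim_at_split)
  from order_tendstoD(1)[OF this c] have "\<forall>\<^sub>F x in at_left g. c < ennreal (\<phi> x) \<and> x < g"
    by (auto simp: eventually_at_filter elim: eventually_mono)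
  then obtain a where a: "c < ennreal (\<phi> a)" "a < g"
    using eventually_happens[of _ "at_left g"] by (auto simp: trivial_limit_at_left_real)
  have "ev3 (\<lambda>i k n. c \<le> ennreal (\<phi> (A i k n)))"
  proof (rule ev3_mono[OF ev[OF a(2)]])
    fix i k n assume "a < A i k n"
    then have "\<phi> a \<le> \<phi> (A i k n)" using test_funD(6)[OF \<phi>] by simp
    then show "c \<le> ennreal (\<phi> (A i k n))" using a(1) by (meson ennreal_leI less_imp_le order_trans)
  qed
  then show "c \<le> lim3 (\<lambda>i k n. ennreal (\<phi> (A i k n)))" by (rule lim3_bounded)
qed

context prob_space
begin

lemma test_fun_integral:
  assumes \<phi>: "test_fun \<phi>" and [measurable]: "Y \<in> borel_measurable M"
  shows "(\<integral>\<^sup>+\<omega>. ennreal (\<phi> (Y \<omega>)) \<partial>M) = ennreal (expectation (\<lambda>\<omega>. \<phi> (Y \<omega>)))"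
    and "integrable M (\<lambda>\<omega>. \<phi> (Y \<omega>))"
    and "0 \<le> expectation (\<lambda>\<omega>. \<phi> (Y \<omega>))"
proof -
  note [measurable] = test_funD(5)[OF \<phi>]
  show *: "integrable M (\<lambda>\<omega>. \<phi> (Y \<omega>))"
    by (rule integrable_const_bound[of _ 1]) (use test_funD(3,4)[OF \<phi>] in \<open>auto\<close>)
  show "(\<integral>\<^sup>+\<omega>. ennreal (\<phi> (Y \<omega>)) \<partial>M) = ennreal (expectation (\<lambda>\<omega>. \<phi> (Y \<omega>)))"
    by (rule nn_integral_eq_integral[OF *]) (use test_funD(3)[OF \<phi>] in auto)
  show "0 \<le> expectation (\<lambda>\<omega>. \<phi> (Y \<omega>))"
    by (rule integral_nonneg_AE) (use test_funD(3)[OF \<phi>] in auto)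
qed

text \<open>Fatou's lemma, applied to \<open>\<phi> (A i k n)\<close> from below and to \<open>1 - \<phi> (B i k n)\<close>, turns an inequality
  between laws for each \<open>i, k, n\<close> into one for the limits. Only a lower bound for \<open>A\<close> and an upper
  bound for \<open>B\<close> enter, so neither has to converge. Since \<open>G\<close> is not assumed to be measurable, the
  conclusion is stated for a measurable majorant of \<open>\<phi> (G \<omega>)\<close>.\<close>

lemma iterated_limit_comparison:
  fixes A B :: "nat \<Rightarrow> nat \<Rightarrow> nat \<Rightarrow> 'a \<Rightarrow> real"
  assumes A[measurable]: "\<And>i k n. A i k n \<in> borel_measurable M"
    and B[measurable]: "\<And>i k n. B i k n \<in> borel_measurable M"
    and N[measurable]: "N \<in> borel_measurable M"
    and le: "\<And>i k n. (\<integral>\<^sup>+\<omega>. ennreal (\<phi> (A i k n \<omega>)) \<partial>M) \<le> (\<integral>\<^sup>+\<omega>. ennreal (\<phi> (B i k n \<omega>)) \<partial>M)"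
    and lower: "\<And>\<omega> a. \<omega> \<in> space M \<Longrightarrow> a < G \<omega> \<Longrightarrow> ev3 (\<lambda>i k n. a < A i k n \<omega>)"
    and upper: "\<And>\<omega> a. \<omega> \<in> space M \<Longrightarrow> N \<omega> < a \<Longrightarrow> ev3 (\<lambda>i k n. B i k n \<omega> < a)"
    and \<phi>: "test_fun \<phi>"
  shows "\<exists>U\<in>borel_measurable M. (\<forall>\<omega>\<in>space M. ennreal (\<phi> (G \<omega>)) \<le> U \<omega>) \<and>
      (\<integral>\<^sup>+\<omega>. U \<omega> \<partial>M) \<le> (\<integral>\<^sup>+\<omega>. ennreal (\<phi> (N \<omega>)) \<partial>M)"
proof -
  note [measurable] = test_funD(5)[OF \<phi>]
  define U where "U \<omega> = lim3 (\<lambda>i k n. ennreal (\<phi> (A i k n \<omega>)))" for \<omega>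
  have [measurable]: "U \<in> borel_measurable M" unfolding U_def by measurable
  have 1: "ennreal (\<phi> (G \<omega>)) \<le> U \<omega>" if "\<omega> \<in> space M" for \<omega>
    unfolding U_def by (rule ev3_test_fun[OF \<phi>]) (use lower that in blast)
  have 2: "(\<integral>\<^sup>+\<omega>. U \<omega> \<partial>M) \<le> lim3 (\<lambda>i k n. ennreal (expectation (\<lambda>\<omega>. \<phi> (A i k n \<omega>))))"
    unfolding U_def test_fun_integral(1)[OF \<phi> A, symmetric] by (rule fatou3) measurable
  define \<psi> where "\<psi> x = 1 - \<phi> (- x)" for x
  have \<psi>: "test_fun \<psi>" unfolding \<psi>_def by (rule test_fun_reflect[OF \<phi>])
  note [measurable] = test_funD(5)[OF \<psi>]
  have \<psi>\<phi>: "expectation (\<lambda>\<omega>. \<psi> (- Y \<omega>)) = 1 - expectation (\<lambda>\<omega>. \<phi> (Y \<omega>))"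
    if "Y \<in> borel_measurable M" for Y
    using test_fun_integral(2)[OF \<phi> that] by (simp add: \<psi>_def prob_space)
  have "ennreal (\<psi> (- N \<omega>)) \<le> lim3 (\<lambda>i k n. ennreal (\<psi> (- B i k n \<omega>)))" if w: "\<omega> \<in> space M" for \<omega>
  proof (rule ev3_test_fun[OF \<psi>])
    fix a assume "a < - N \<omega>"
    then have "ev3 (\<lambda>i k n. B i k n \<omega> < - a)" by (intro upper[OF w]) simp
    then show "ev3 (\<lambda>i k n. a < - B i k n \<omega>)" by (rule ev3_mono) simp
  qed
  then have "(\<integral>\<^sup>+\<omega>. ennreal (\<psi> (- N \<omega>)) \<partial>M) \<le> (\<integral>\<^sup>+\<omega>. lim3 (\<lambda>i k n. ennreal (\<psi> (- B i k n \<omega>))) \<partial>M)"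
    by (intro nn_integral_mono) auto
  also have "\<dots> \<le> lim3 (\<lambda>i k n. \<integral>\<^sup>+\<omega>. ennreal (\<psi> (- B i k n \<omega>)) \<partial>M)"
    by (rule fatou3) measurable
  finally have 3: "ennreal (expectation (\<lambda>\<omega>. \<psi> (- N \<omega>))) \<le> lim3 (\<lambda>i k n. ennreal (expectation (\<lambda>\<omega>. \<psi> (- B i k n \<omega>))))"
    by (subst (asm) (1 2) test_fun_integral(1)[OF \<psi>]) auto
  have 4: "(\<integral>\<^sup>+\<omega>. U \<omega> \<partial>M) \<le> ennreal (expectation (\<lambda>\<omega>. \<phi> (N \<omega>)))"
  proof (rule ccontr)
    assume "\<not> ?thesis"
    then have "ennreal (expectation (\<lambda>\<omega>. \<phi> (N \<omega>))) < (\<integral>\<^sup>+\<omega>. U \<omega> \<partial>M)" by simp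
    then obtain c' where c': "ennreal (expectation (\<lambda>\<omega>. \<phi> (N \<omega>))) < c'" "c' < (\<integral>\<^sup>+\<omega>. U \<omega> \<partial>M)"
      using dense by blast
    have "c' < \<top>" using c'(2) by (meson less_le_trans top_greatest)
    then obtain c where cc: "c' = ennreal c" "0 \<le> c" by (cases c') auto
    have c: "expectation (\<lambda>\<omega>. \<phi> (N \<omega>)) < c" "ennreal c < (\<integral>\<^sup>+\<omega>. U \<omega> \<partial>M)"
      using c' cc test_fun_integral(3)[OF \<phi> N] by (auto simp: ennreal_less_iff)
    have e1: "ev3 (\<lambda>i k n. ennreal c < ennreal (expectation (\<lambda>\<omega>. \<phi> (A i k n \<omega>))))"
      by (rule less_lim3) (use c(2) 2 in order)
    have posA: "0 \<le> expectation (\<lambda>\<omega>. \<phi> (A i k n \<omega>))" for i k n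
      by (rule test_fun_integral(3)[OF \<phi>]) simp
    have "ev3 (\<lambda>i k n. ennreal (expectation (\<lambda>\<omega>. \<psi> (- N \<omega>)) - (c - expectation (\<lambda>\<omega>. \<phi> (N \<omega>)))) < ennreal (expectation (\<lambda>\<omega>. \<psi> (- B i k n \<omega>))))
      \<or> expectation (\<lambda>\<omega>. \<psi> (- N \<omega>)) - (c - expectation (\<lambda>\<omega>. \<phi> (N \<omega>))) < 0"
    proof (cases "expectation (\<lambda>\<omega>. \<psi> (- N \<omega>)) - (c - expectation (\<lambda>\<omega>. \<phi> (N \<omega>))) < 0")
      case False
      have "ennreal (expectation (\<lambda>\<omega>. \<psi> (- N \<omega>)) - (c - expectation (\<lambda>\<omega>. \<phi> (N \<omega>)))) < ennreal (expectation (\<lambda>\<omega>. \<psi> (- N \<omega>)))"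
        using False c(1) by (intro ennreal_lessI) auto
      then show ?thesis using 3 by (intro disjI1 less_lim3) order
    qed simp
    then show False
    proof
      assume "ev3 (\<lambda>i k n. ennreal (expectation (\<lambda>\<omega>. \<psi> (- N \<omega>)) - (c - expectation (\<lambda>\<omega>. \<phi> (N \<omega>)))) < ennreal (expectation (\<lambda>\<omega>. \<psi> (- B i k n \<omega>))))"
      from ev3_ex[OF ev3_conj[OF e1 this]] obtain i k n where
        *: "ennreal c < ennreal (expectation (\<lambda>\<omega>. \<phi> (A i k n \<omega>)))"
        "ennreal (expectation (\<lambda>\<omega>. \<psi> (- N \<omega>)) - (c - expectation (\<lambda>\<omega>. \<phi> (N \<omega>)))) < ennreal (expectation (\<lambda>\<omega>. \<psi> (- B i k n \<omega>)))"
        by blast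
      have "c < expectation (\<lambda>\<omega>. \<phi> (A i k n \<omega>))" using *(1) cc(2) by (simp add: ennreal_less_iff)
      also have "\<dots> \<le> expectation (\<lambda>\<omega>. \<phi> (B i k n \<omega>))"
        using le[of i k n] test_fun_integral(3)[OF \<phi> B]
        unfolding test_fun_integral(1)[OF \<phi> A] test_fun_integral(1)[OF \<phi> B] by (simp add: ennreal_le_iff)
      finally have cB: "c < expectation (\<lambda>\<omega>. \<phi> (B i k n \<omega>))" .
      have "\<not> ennreal (expectation (\<lambda>\<omega>. \<psi> (- B i k n \<omega>))) \<le> ennreal (expectation (\<lambda>\<omega>. \<psi> (- N \<omega>)) - (c - expectation (\<lambda>\<omega>. \<phi> (N \<omega>))))"
        using *(2) by simp
      then have "\<not> expectation (\<lambda>\<omega>. \<psi> (- B i k n \<omega>)) \<le> expectation (\<lambda>\<omega>. \<psi> (- N \<omega>)) - (c - expectation (\<lambda>\<omega>. \<phi> (N \<omega>)))"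
        using ennreal_leI by blast
      then show False using cB by (simp add: \<psi>\<phi>)
    next
      assume "expectation (\<lambda>\<omega>. \<psi> (- N \<omega>)) - (c - expectation (\<lambda>\<omega>. \<phi> (N \<omega>))) < 0"
      then have "1 < c" by (simp add: \<psi>\<phi>)
      from ev3_ex[OF e1] obtain i k n where "ennreal c < ennreal (expectation (\<lambda>\<omega>. \<phi> (A i k n \<omega>)))" by blast
      then have "c < expectation (\<lambda>\<omega>. \<phi> (A i k n \<omega>))" using cc(2) by (simp add: ennreal_less_iff)
      also have "\<dots> \<le> 1"
        using test_fun_integral(2)[OF \<phi> A] test_funD(4)[OF \<phi>] by (intro integral_le_const) auto
      finally show False using \<open>1 < c\<close> by simp
    qed
  qed
  then show ?thesis
    using 1 by (intro bexI[of _ U]) (auto simp: test_fun_integral(1)[OF \<phi> N])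
qed

end

lemma test_fun_ramp: "test_fun (\<lambda>x. min 1 (max 0 (real m * (x - c))))"
  unfolding test_fun_def
proof (intro conjI allI)
  show "mono (\<lambda>x. min 1 (max 0 (real m * (x - c))))"
    by (intro monoI min.mono max.mono order_refl mult_left_mono) auto
qed (auto intro!: continuous_intros)

lemma test_fun_arctan: "test_fun (\<lambda>x. arctan x / pi + 1 / 2)"
  unfolding test_fun_def
proof (intro conjI allI)
  show "mono (\<lambda>x. arctan x / pi + 1 / 2)" by (auto intro!: monoI divide_right_mono simp: arctan_le_iff)
  show "continuous_on UNIV (\<lambda>x. arctan x / pi + 1 / 2)" by (auto intro!: continuous_intros)
  fix x :: real
  have "- (1/2) < arctan x / pi" "arctan x / pi < 1/2"
    using arctan_lbound[of x] arctan_ubound[of x] by (auto simp: field_simps)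
  then show "0 \<le> arctan x / pi + 1 / 2" "arctan x / pi + 1 / 2 \<le> 1" by linarith+
qed

text \<open>Ramp functions approximate the indicators of half lines, hence the distribution functions agree.\<close>

lemma (in prob_space) test_fun_determines_distr:
  assumes [measurable]: "Y \<in> borel_measurable M" "Z \<in> borel_measurable M"
    and eq: "\<And>\<phi>. test_fun \<phi> \<Longrightarrow> (\<integral>\<^sup>+\<omega>. ennreal (\<phi> (Y \<omega>)) \<partial>M) = (\<integral>\<^sup>+\<omega>. ennreal (\<phi> (Z \<omega>)) \<partial>M)"
  shows "distr M borel Y = distr M borel Z"
proof (rule cdf_unique')
  interpret Y: prob_space "distr M borel Y" by (rule prob_space_distr) simp
  interpret Z: prob_space "distr M borel Z" by (rule prob_space_distr) simp
  show "finite_borel_measure (distr M borel Y)" "finite_borel_measure (distr M borel Z)"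
    by unfold_locales auto
  have lim: "(\<lambda>m. expectation (\<lambda>\<omega>. min 1 (max 0 (real m * (W \<omega> - c))))) \<longlonglongrightarrow> 1 - cdf (distr M borel W) c"
    if W[measurable]: "W \<in> borel_measurable M" for W c
  proof -
    have "(\<lambda>m. expectation (\<lambda>\<omega>. min 1 (max 0 (real m * (W \<omega> - c))))) \<longlonglongrightarrow> expectation (indicator {\<omega>\<in>space M. c < W \<omega>})"
    proof (rule integral_dominated_convergence[where w="\<lambda>_. 1"])
      show "AE \<omega> in M. (\<lambda>m. min 1 (max 0 (real m * (W \<omega> - c)))) \<longlonglongrightarrow> indicator {\<omega>\<in>space M. c < W \<omega>} \<omega>"
      proof (rule AE_I2)
        fix \<omega> assume w: "\<omega> \<in> space M"
        show "(\<lambda>m. min 1 (max 0 (real m * (W \<omega> - c)))) \<longlonglongrightarrow> indicator {\<omega>\<in>space M. c < W \<omega>} \<omega>"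
        proof (cases "c < W \<omega>")
          case True
          obtain m0 where m0: "1 / (W \<omega> - c) < real m0" using reals_Archimedean2 by blast
          have "\<forall>\<^sub>F m in sequentially. min 1 (max 0 (real m * (W \<omega> - c))) = 1"
            using eventually_ge_at_top[of m0]
          proof eventually_elim
            case (elim m)
            have "1 < real m0 * (W \<omega> - c)" using m0 True by (simp add: field_simps)
            also have "\<dots> \<le> real m * (W \<omega> - c)" using elim True by (intro mult_right_mono) auto
            finally show ?case by simp
          qed
          then show ?thesis using True w by (simp add: tendsto_eventually)
        next
          case False
          have "min 1 (max 0 (real m * (W \<omega> - c))) = 0" for m
            using False by (simp add: mult_nonneg_nonpos max_absorb1)
          then show ?thesis using False by simp
        qed
      qed
    qed auto
    also have "expectation (indicator {\<omega>\<in>space M. c < W \<omega>}) = prob {\<omega>\<in>space M. c < W \<omega>}"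
      by (simp add: Int_absorb2)
    also have "\<dots> = 1 - prob {\<omega>\<in>space M. W \<omega> \<le> c}"
    proof -
      have "prob (space M - {\<omega>\<in>space M. W \<omega> \<le> c}) = 1 - prob {\<omega>\<in>space M. W \<omega> \<le> c}"
        by (rule prob_compl) simp
      moreover have "space M - {\<omega>\<in>space M. W \<omega> \<le> c} = {\<omega>\<in>space M. c < W \<omega>}" by auto
      ultimately show ?thesis by simp
    qed
    also have "prob {\<omega>\<in>space M. W \<omega> \<le> c} = cdf (distr M borel W) c"
      unfolding cdf_def by (subst measure_distr) (auto intro!: arg_cong[where f=prob])
    finally show ?thesis .
  qed
  show "cdf (distr M borel Y) = cdf (distr M borel Z)"
  proof
    fix c
    have "expectation (\<lambda>\<omega>. min 1 (max 0 (real m * (Y \<omega> - c)))) = expectation (\<lambda>\<omega>. min 1 (max 0 (real m * (Z \<omega> - c))))" for m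
      using eq[OF test_fun_ramp[of m c]] test_fun_integral(3)[OF test_fun_ramp[of m c]]
      by (simp add: test_fun_integral(1)[OF test_fun_ramp[of m c]])
    then have "1 - cdf (distr M borel Y) c = 1 - cdf (distr M borel Z) c"
      using LIMSEQ_unique[OF lim[of Y c] ] lim[of Z c] by simp
    then show "cdf (distr M borel Y) c = cdf (distr M borel Z) c" by simp
  qed
qed

lemma AE_eq_borel_completion:
  fixes G G' :: "'a \<Rightarrow> real"
  assumes G': "G' \<in> borel_measurable (completion M)" and AE: "AE \<omega> in M. G \<omega> = G' \<omega>"
  shows "G \<in> borel_measurable (completion M)"
    and "distr (completion M) borel G = distr (completion M) borel G'"
proof -
  show G: "G \<in> borel_measurable (completion M)"
  proof (rule measurableI)
    fix A :: "real set" assume A: "A \<in> sets borel"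
    have "AE \<omega> in M. \<not> (G \<omega> \<in> A \<and> G' \<omega> \<notin> A)" "AE \<omega> in M. \<not> (G \<omega> \<notin> A \<and> G' \<omega> \<in> A)"
      using AE by (auto elim: eventually_mono)
    from this[THEN sets_completion_AE]
    have [measurable]: "Measurable.pred (completion M) (\<lambda>\<omega>. G \<omega> \<in> A \<and> G' \<omega> \<notin> A)"
      "Measurable.pred (completion M) (\<lambda>\<omega>. G \<omega> \<notin> A \<and> G' \<omega> \<in> A)" .
    have [measurable]: "Measurable.pred (completion M) (\<lambda>\<omega>. G' \<omega> \<in> A)"
      using G' A by measurable
    have "{\<omega>\<in>space (completion M). (G' \<omega> \<in> A \<or> (G \<omega> \<in> A \<and> G' \<omega> \<notin> A)) \<and> \<not> (G \<omega> \<notin> A \<and> G' \<omega> \<in> A)}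
        \<in> sets (completion M)" by measurable
    also have "{\<omega>\<in>space (completion M). (G' \<omega> \<in> A \<or> (G \<omega> \<in> A \<and> G' \<omega> \<notin> A)) \<and> \<not> (G \<omega> \<notin> A \<and> G' \<omega> \<in> A)}
        = G -` A \<inter> space (completion M)" by auto
    finally show "G -` A \<inter> space (completion M) \<in> sets (completion M)" .
  qed simp
  show "distr (completion M) borel G = distr (completion M) borel G'"
    using AE_completion[OF AE] G G' by (intro distr_cong_AE) auto
qed

text \<open>A majorant and a minorant of \<open>\<phi> (G \<omega>)\<close> with the same integral agree almost everywhere. This yields
  both the measurability of \<open>G\<close>, with the arc tangent as the test function, and its law.\<close>

lemma (in prob_space) squeeze_distr:
  fixes G N :: "'a \<Rightarrow> real"
  assumes N[measurable]: "N \<in> borel_measurable M"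
    and up: "\<And>\<phi>. test_fun \<phi> \<Longrightarrow> \<exists>U\<in>borel_measurable M. (\<forall>\<omega>\<in>space M. ennreal (\<phi> (G \<omega>)) \<le> U \<omega>) \<and>
      (\<integral>\<^sup>+\<omega>. U \<omega> \<partial>M) \<le> (\<integral>\<^sup>+\<omega>. ennreal (\<phi> (N \<omega>)) \<partial>M)"
    and down: "\<And>\<phi>. test_fun \<phi> \<Longrightarrow> \<exists>V\<in>borel_measurable M. (\<forall>\<omega>\<in>space M. ennreal (\<phi> (- G \<omega>)) \<le> V \<omega>) \<and>
      (\<integral>\<^sup>+\<omega>. V \<omega> \<partial>M) \<le> (\<integral>\<^sup>+\<omega>. ennreal (\<phi> (- N \<omega>)) \<partial>M)"
  shows "G \<in> borel_measurable (completion M)" "distr (completion M) borel G = distr M borel N"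
proof -
  have key: "\<exists>U\<in>borel_measurable M. (AE \<omega> in M. ennreal (\<phi> (G \<omega>)) = U \<omega>) \<and>
      (\<integral>\<^sup>+\<omega>. U \<omega> \<partial>M) = (\<integral>\<^sup>+\<omega>. ennreal (\<phi> (N \<omega>)) \<partial>M)" if \<phi>: "test_fun \<phi>" for \<phi>
  proof -
    note [measurable] = test_funD(5)[OF \<phi>]
    define \<psi> where "\<psi> x = 1 - \<phi> (- x)" for x
    have \<psi>: "test_fun \<psi>" unfolding \<psi>_def by (rule test_fun_reflect[OF \<phi>])
    note [measurable] = test_funD(5)[OF \<psi>]
    obtain U where U[measurable]: "U \<in> borel_measurable M" and U1: "\<And>\<omega>. \<omega> \<in> space M \<Longrightarrow> ennreal (\<phi> (G \<omega>)) \<le> U \<omega>"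
      and U2: "(\<integral>\<^sup>+\<omega>. U \<omega> \<partial>M) \<le> (\<integral>\<^sup>+\<omega>. ennreal (\<phi> (N \<omega>)) \<partial>M)" using up[OF \<phi>] by blast
    obtain V where V[measurable]: "V \<in> borel_measurable M" and V1: "\<And>\<omega>. \<omega> \<in> space M \<Longrightarrow> ennreal (\<psi> (- G \<omega>)) \<le> V \<omega>"
      and V2: "(\<integral>\<^sup>+\<omega>. V \<omega> \<partial>M) \<le> (\<integral>\<^sup>+\<omega>. ennreal (\<psi> (- N \<omega>)) \<partial>M)" using down[OF \<psi>] by blast
    have sum1: "ennreal (\<phi> x) + ennreal (\<psi> (- x)) = 1" for x
      using test_funD(3,4)[OF \<phi>, of x] by (simp add: \<psi>_def flip: ennreal_plus)
    have ge1: "1 \<le> U \<omega> + V \<omega>" if "\<omega> \<in> space M" for \<omega>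
      using add_mono[OF U1[OF that] V1[OF that]] by (simp add: sum1)
    have "(\<integral>\<^sup>+\<omega>. U \<omega> + V \<omega> \<partial>M) = (\<integral>\<^sup>+\<omega>. U \<omega> \<partial>M) + (\<integral>\<^sup>+\<omega>. V \<omega> \<partial>M)"
      by (rule nn_integral_add) auto
    also have "\<dots> \<le> (\<integral>\<^sup>+\<omega>. ennreal (\<phi> (N \<omega>)) \<partial>M) + (\<integral>\<^sup>+\<omega>. ennreal (\<psi> (- N \<omega>)) \<partial>M)"
      by (rule add_mono[OF U2 V2])
    also have "\<dots> = (\<integral>\<^sup>+\<omega>. ennreal (\<phi> (N \<omega>)) + ennreal (\<psi> (- N \<omega>)) \<partial>M)"
      by (rule nn_integral_add[symmetric]) auto
    also have "\<dots> = 1" by (simp add: sum1 emeasure_space_1)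
    finally have UV: "(\<integral>\<^sup>+\<omega>. U \<omega> + V \<omega> \<partial>M) \<le> 1" .
    have "AE \<omega> in M. U \<omega> + V \<omega> \<le> 1"
    proof (rule ccontr)
      assume "\<not> ?thesis"
      then have "(\<integral>\<^sup>+\<omega>. 1 \<partial>M) < (\<integral>\<^sup>+\<omega>. U \<omega> + V \<omega> \<partial>M)"
        using ge1 by (intro nn_integral_less) (auto simp: emeasure_space_1)
      then show False using UV by (simp add: emeasure_space_1)
    qed
    then have one: "AE \<omega> in M. U \<omega> + V \<omega> = 1"
      by (rule AE_mp) (use ge1 in \<open>auto intro: antisym\<close>)
    have real_eq: "x = u" if "x \<le> u" "y \<le> v" "x + y = 1" "u + v = 1" for x y u v :: ennreal
    proof -
      have "u + v < \<top>" using that(4) by simp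
      then have "u < \<top>" "v < \<top>" by (simp_all add: less_top)
      moreover then have "x < \<top>" "y < \<top>" using that(1,2) by (auto intro: le_less_trans)
      ultimately show ?thesis using that
        by (cases x; cases y; cases u; cases v)
          (auto simp flip: ennreal_plus ennreal_1 simp: ennreal_le_iff)
    qed
    have "AE \<omega> in M. ennreal (\<phi> (G \<omega>)) = U \<omega>"
      using one
    proof (rule AE_mp, intro AE_I2 impI)
      fix \<omega> assume "\<omega> \<in> space M" "U \<omega> + V \<omega> = 1"
      then show "ennreal (\<phi> (G \<omega>)) = U \<omega>"
        by (intro real_eq[OF U1 V1 sum1]) auto
    qed
    moreover have "(\<integral>\<^sup>+\<omega>. U \<omega> \<partial>M) = (\<integral>\<^sup>+\<omega>. ennreal (\<phi> (N \<omega>)) \<partial>M)"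
    proof (rule real_eq[OF U2 V2])
      have "(\<integral>\<^sup>+\<omega>. U \<omega> \<partial>M) + (\<integral>\<^sup>+\<omega>. V \<omega> \<partial>M) = (\<integral>\<^sup>+\<omega>. U \<omega> + V \<omega> \<partial>M)"
        by (rule nn_integral_add[symmetric]) auto
      also have "\<dots> = (\<integral>\<^sup>+\<omega>. 1 \<partial>M)" by (rule nn_integral_cong_AE[OF one])
      finally show "(\<integral>\<^sup>+\<omega>. U \<omega> \<partial>M) + (\<integral>\<^sup>+\<omega>. V \<omega> \<partial>M) = 1" by (simp add: emeasure_space_1)
      have "(\<integral>\<^sup>+\<omega>. ennreal (\<phi> (N \<omega>)) \<partial>M) + (\<integral>\<^sup>+\<omega>. ennreal (\<psi> (- N \<omega>)) \<partial>M)
          = (\<integral>\<^sup>+\<omega>. ennreal (\<phi> (N \<omega>)) + ennreal (\<psi> (- N \<omega>)) \<partial>M)"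
        by (rule nn_integral_add[symmetric]) auto
      then show "(\<integral>\<^sup>+\<omega>. ennreal (\<phi> (N \<omega>)) \<partial>M) + (\<integral>\<^sup>+\<omega>. ennreal (\<psi> (- N \<omega>)) \<partial>M) = 1"
        by (simp add: sum1 emeasure_space_1)
    qed
    ultimately show ?thesis using U by blast
  qed
  \<comment> \<open>G can be recovered from its image under an injective test function\<close>
  obtain U0 where U0[measurable]: "U0 \<in> borel_measurable M"
    and eq0: "AE \<omega> in M. ennreal (arctan (G \<omega>) / pi + 1 / 2) = U0 \<omega>"
    using key[OF test_fun_arctan] by blast
  define G' where "G' \<omega> = tan (pi * (enn2real (U0 \<omega>) - 1 / 2))" for \<omega>
  have tan[measurable]: "(tan :: real \<Rightarrow> real) \<in> borel_measurable borel"
    unfolding tan_def[abs_def] by measurable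
  have G'[measurable]: "G' \<in> borel_measurable M" unfolding G'_def by measurable
  have AE: "AE \<omega> in M. G \<omega> = G' \<omega>"
    using eq0
  proof eventually_elim
    case (elim \<omega>)
    have "enn2real (U0 \<omega>) = arctan (G \<omega>) / pi + 1 / 2"
      unfolding elim[symmetric] using test_funD(3)[OF test_fun_arctan, of "G \<omega>"] by simp
    then show ?case by (simp add: G'_def tan_arctan)
  qed
  have "distr M borel G' = distr M borel N"
  proof (rule test_fun_determines_distr[OF G' N])
    fix \<phi> assume \<phi>: "test_fun \<phi>"
    obtain U where U: "AE \<omega> in M. ennreal (\<phi> (G \<omega>)) = U \<omega>"
      "(\<integral>\<^sup>+\<omega>. U \<omega> \<partial>M) = (\<integral>\<^sup>+\<omega>. ennreal (\<phi> (N \<omega>)) \<partial>M)"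
      using key[OF \<phi>] by blast
    have "(\<integral>\<^sup>+\<omega>. ennreal (\<phi> (G' \<omega>)) \<partial>M) = (\<integral>\<^sup>+\<omega>. U \<omega> \<partial>M)"
      using AE U(1) by (intro nn_integral_cong_AE) (elim AE_mp, auto)
    then show "(\<integral>\<^sup>+\<omega>. ennreal (\<phi> (G' \<omega>)) \<partial>M) = (\<integral>\<^sup>+\<omega>. ennreal (\<phi> (N \<omega>)) \<partial>M)" using U(2) by simp
  qed
  then show "G \<in> borel_measurable (completion M)" "distr (completion M) borel G = distr M borel N"
    using AE_eq_borel_completion[OF measurable_completion[OF G'] AE] distr_completion[OF G'] by auto
qed

section \<open>Paths sampled on a grid\<close>

definition mesh :: "nat \<Rightarrow> real" where
  "mesh n = 1 / real (Suc n)"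

abbreviation grid :: "nat \<Rightarrow> nat \<Rightarrow> real" where
  "grid n j \<equiv> real j * mesh n"

lemma mesh_pos [simp]: "0 < mesh n" and mesh_nonneg [simp]: "0 \<le> mesh n"
  and mesh_le_1: "mesh n \<le> 1"
  by (auto simp: mesh_def)

lemma mesh_neq_0 [simp]: "mesh n \<noteq> 0"
  using mesh_pos[of n] by linarith

lemma mesh_tendsto: "mesh \<longlonglongrightarrow> 0"
  unfolding mesh_def using LIMSEQ_inverse_real_of_nat by (simp add: inverse_eq_divide)

lemma eventually_mesh_less: "0 < c \<Longrightarrow> \<forall>\<^sub>F n in sequentially. mesh n < c"
  using order_tendstoD(2)[OF mesh_tendsto] .

text \<open>Grid points are approached strictly from the right, because right-continuity is the only
  continuity that the paths have.\<close>

definition next_idx :: "nat \<Rightarrow> real \<Rightarrow> nat" where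
  "next_idx n t = Suc (nat \<lfloor>t / mesh n\<rfloor>)"

lemma next_idx_bounds:
  assumes "0 \<le> t"
  shows "t < grid n (next_idx n t)" "grid n (next_idx n t) \<le> t + mesh n"
proof -
  have eq: "real (next_idx n t) = of_int \<lfloor>t / mesh n\<rfloor> + 1"
    using assms by (simp add: next_idx_def)
  have "t / mesh n < real (next_idx n t)" "real (next_idx n t) \<le> t / mesh n + 1"
    unfolding eq by linarith+
  then have "t / mesh n * mesh n < grid n (next_idx n t)"
    "grid n (next_idx n t) \<le> (t / mesh n + 1) * mesh n"
    by (intro mult_strict_right_mono mult_right_mono; simp)+
  then show "t < grid n (next_idx n t)" "grid n (next_idx n t) \<le> t + mesh n"
    by (simp_all add: distrib_right)
qed

lemma next_idx_le:
  assumes "0 \<le> t" "t < grid n K"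
  shows "next_idx n t \<le> K"
proof -
  have "t / mesh n < real K" using assms(2) by (simp add: field_simps)
  then have "\<lfloor>t / mesh n\<rfloor> < int K" by linarith
  moreover have "0 \<le> \<lfloor>t / mesh n\<rfloor>" using assms(1) by simp
  ultimately show ?thesis unfolding next_idx_def by linarith
qed

lemma next_idx_filterlim:
  assumes "0 \<le> t"
  shows "filterlim (\<lambda>n. grid n (next_idx n t)) (at_right t) sequentially"
proof -
  have "(\<lambda>n. grid n (next_idx n t)) \<longlonglongrightarrow> t"
  proof (rule tendsto_sandwich[where f="\<lambda>_. t" and h="\<lambda>n. t + mesh n"])
    show "(\<lambda>n. t + mesh n) \<longlonglongrightarrow> t"
      using tendsto_add[OF tendsto_const mesh_tendsto, of t] by simp
    show "(\<lambda>n. t) \<longlonglongrightarrow> t" by simp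
    show "\<forall>\<^sub>F n in sequentially. t \<le> grid n (next_idx n t)"
      using next_idx_bounds(1)[OF assms] by (auto intro!: always_eventually less_imp_le)
    show "\<forall>\<^sub>F n in sequentially. grid n (next_idx n t) \<le> t + mesh n"
      using next_idx_bounds(2)[OF assms] by (auto intro!: always_eventually)
  qed
  then show ?thesis
    using next_idx_bounds[OF assms] by (auto simp: filterlim_at intro!: always_eventually less_imp_neq[symmetric])
qed

definition right_cont :: "(real \<Rightarrow> real) \<Rightarrow> bool" where
  "right_cont e \<longleftrightarrow> (\<forall>t\<ge>0. (e \<longlongrightarrow> e t) (at_right t))"

lemma right_cont_uminus: "right_cont e \<Longrightarrow> right_cont (\<lambda>t. - e t)"
  by (auto simp: right_cont_def intro: tendsto_minus)

lemma right_cont_grid: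
  assumes "right_cont e" "0 \<le> t"
  shows "(\<lambda>n. e (grid n (next_idx n t))) \<longlonglongrightarrow> e t"
  using assms by (intro filterlim_compose[OF _ next_idx_filterlim]) (auto simp: right_cont_def)

lemma right_cont_nbhd:
  assumes "right_cont e" "0 \<le> t" "e t < c"
  obtains b where "t < b" "\<And>s. t \<le> s \<Longrightarrow> s < b \<Longrightarrow> e s < c"
proof -
  have "(e \<longlongrightarrow> e t) (at_right t)" using assms by (simp add: right_cont_def)
  from order_tendstoD(2)[OF this assms(3)] obtain b where "t < b" "\<And>s. t < s \<Longrightarrow> s < b \<Longrightarrow> e s < c"
    unfolding eventually_at_right_field by auto
  then show ?thesis using assms(3) that by (metis order_le_less)
qed

lemma right_cont_nbhd':
  assumes "right_cont e" "0 \<le> t" "c < e t"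
  obtains b where "t < b" "\<And>s. t \<le> s \<Longrightarrow> s < b \<Longrightarrow> c < e s"
  using right_cont_nbhd[OF right_cont_uminus[OF assms(1)] assms(2), of "- c"] assms(3) by auto

text \<open>The last time before \<open>\<sigma>\<close> at which \<open>e\<close> is at its running maximum: \<open>G_right\<close> for \<open>e\<close> a path, and \<open>F_right\<close>
  for \<open>e\<close> the negative of a path.\<close>

definition record_time :: "(real \<Rightarrow> real) \<Rightarrow> real \<Rightarrow> real" where
  "record_time e \<sigma> = (if \<sigma> = 0 then 0 else Sup {t \<in> {0..<\<sigma>}. e t = (SUP s\<in>{0..t}. e s)})"

section \<open>Paths without upward jumps\<close>

text \<open>Absence of upward jumps is used in the form of lower semicontinuity from the left. It survives
  without any mention of left limits, and together with right-continuity it makes the path lower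
  semicontinuous.\<close>

locale spectral_path =
  fixes f :: "real \<Rightarrow> real"
  assumes zero: "f 0 = 0"
    and right_cont: "right_cont f"
    and left_lsc: "\<And>t c. 0 < t \<Longrightarrow> c < f t \<Longrightarrow> \<forall>\<^sub>F s in at_left t. c < f s"
    and bdd: "\<And>t. bdd_above (f ` {0..t})"
begin

lemma left_le:
  assumes "0 < t" "\<exists>\<^sub>F s in at_left t. f s \<le> c"
  shows "f t \<le> c"
proof (rule ccontr)
  assume "\<not> f t \<le> c"
  then have "\<forall>\<^sub>F s in at_left t. c < f s" using left_lsc assms(1) by auto
  then have "\<forall>\<^sub>F s in at_left t. \<not> f s \<le> c" by eventually_elim simp
  with assms(2) show False by (simp add: frequently_def)
qed

text \<open>Lower semicontinuous functions attain their infimum on a compact interval: otherwise the open sets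
  on which the path exceeds one of its own values would cover the interval, and a finite subcover
  would have a smallest value.\<close>

lemma inf_attained:
  assumes "0 \<le> b" "b \<le> c"
  shows "\<exists>u\<in>{b..c}. \<forall>s\<in>{b..c}. f u \<le> f s"
proof (rule ccontr)
  assume "\<not> ?thesis"
  then have *: "\<exists>s\<in>{b..c}. f s < f u" if "u \<in> {b..c}" for u
    using that by force
  have "\<exists>V s. open V \<and> u \<in> V \<and> s \<in> {b..c} \<and> (\<forall>t\<in>V \<inter> {b..c}. f s < f t)" if u: "u \<in> {b..c}" for u
  proof -
    from *[OF u] obtain s where s: "s \<in> {b..c}" "f s < f u" by auto
    have u0: "0 \<le> u" using u assms by auto
    obtain r where r: "u < r" "\<And>t. u \<le> t \<Longrightarrow> t < r \<Longrightarrow> f s < f t"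
      using right_cont_nbhd'[OF right_cont u0 s(2)] by blast
    show ?thesis
    proof (cases "u = 0")
      case True
      then have "b = 0" using u assms by auto
      then show ?thesis using True r s by (intro exI[of _ "{..<r}"] exI[of _ s]) auto
    next
      case False
      then have "0 < u" using u0 by auto
      from left_lsc[OF this s(2)] obtain l where l: "l < u" "\<And>t. l < t \<Longrightarrow> t < u \<Longrightarrow> f s < f t"
        unfolding eventually_at_left_field by auto
      have "f s < f t" if "l < t" "t < r" for t
        using that l r by (cases "t < u") auto
      then show ?thesis using l r s by (intro exI[of _ "{l<..<r}"] exI[of _ s]) auto
    qed
  qed
  then obtain U S where US: "\<And>u. u \<in> {b..c} \<Longrightarrow> open (U u) \<and> u \<in> U u \<and> S u \<in> {b..c} \<and>
      (\<forall>t\<in>U u \<inter> {b..c}. f (S u) < f t)"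
    by metis
  have "compact {b..c}" "{b..c} \<subseteq> (\<Union>u\<in>{b..c}. U u)" "\<And>u. u \<in> {b..c} \<Longrightarrow> open (U u)"
    using US by auto
  then obtain C where C: "C \<subseteq> {b..c}" "finite C" "{b..c} \<subseteq> (\<Union>u\<in>C. U u)"
    using compactE_image[of "{b..c}" "{b..c}" U] by metis
  have "C \<noteq> {}" using C(3) assms by auto
  obtain v where v: "v \<in> C" "\<And>w. w \<in> C \<Longrightarrow> f (S v) \<le> f (S w)"
    using arg_min_if_finite[OF C(2) \<open>C \<noteq> {}\<close>, of "\<lambda>w. f (S w)"] by (metis linorder_not_le)
  have "S v \<in> {b..c}" using US v C by blast
  then obtain w where "w \<in> C" "S v \<in> U w" using C(3) by auto
  then have "f (S w) < f (S v)" using US C \<open>S v \<in> {b..c}\<close> by blast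
  with v \<open>w \<in> C\<close> show False by fastforce
qed

end

locale transient_path = spectral_path +
  assumes transient: "\<exists>K. \<forall>t\<ge>K. 1 < f t"
begin

definition \<sigma> :: real where
  "\<sigma> = Sup {t. t \<ge> 0 \<and> f t \<le> 0}"

lemma bdd_nonpos: "bdd_above {t. t \<ge> 0 \<and> f t \<le> 0}"
proof -
  obtain K where "\<And>t. t \<ge> K \<Longrightarrow> 1 < f t" using transient by auto
  then show ?thesis by (intro bdd_aboveI[of _ K]) (smt (verit) mem_Collect_eq)
qed

lemma zero_nonpos: "0 \<in> {t. t \<ge> 0 \<and> f t \<le> 0}"
  using zero by simp

lemma \<sigma>_nonneg: "0 \<le> \<sigma>"
  unfolding \<sigma>_def by (rule cSup_upper[OF zero_nonpos bdd_nonpos])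

lemma pos_after: "\<sigma> < t \<Longrightarrow> 0 < f t"
  using cSup_upper[OF _ bdd_nonpos, of t] \<sigma>_nonneg unfolding \<sigma>_def[symmetric] by fastforce

text \<open>Right-continuity excludes a negative value at the last time in the nonpositive half line, and the
  absence of upward jumps excludes a positive one.\<close>

lemma at_\<sigma>: "f \<sigma> = 0"
proof (rule antisym)
  show "0 \<le> f \<sigma>"
  proof (rule ccontr)
    assume "\<not> ?thesis"
    then obtain b where "\<sigma> < b" "\<And>s. \<sigma> \<le> s \<Longrightarrow> s < b \<Longrightarrow> f s < 0"
      using right_cont_nbhd[OF right_cont \<sigma>_nonneg, of 0] by (metis linorder_not_le)
    then have "f ((\<sigma> + b) / 2) < 0" by simp
    moreover have "0 < f ((\<sigma> + b) / 2)" using \<open>\<sigma> < b\<close> by (intro pos_after) simp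
    ultimately show False by simp
  qed
  show "f \<sigma> \<le> 0"
  proof (rule ccontr)
    assume pos: "\<not> f \<sigma> \<le> 0"
    then have "\<sigma> \<noteq> 0" using zero by auto
    then have "0 < \<sigma>" using \<sigma>_nonneg by simp
    from left_lsc[OF this, of 0] pos obtain l where l: "l < \<sigma>" "\<And>t. l < t \<Longrightarrow> t < \<sigma> \<Longrightarrow> 0 < f t"
      unfolding eventually_at_left_field by auto
    obtain t where t: "t \<ge> 0" "f t \<le> 0" "l < t"
      using less_cSupD[OF _ l(1)[unfolded \<sigma>_def]] zero_nonpos by blast
    have "t \<le> \<sigma>" using t pos_after[of t] by fastforce
    then show False using t l pos by (cases "t = \<sigma>") (auto dest: l(2))
  qed
qed

text \<open>The path attains its minimum over a compact interval after \<open>\<sigma>\<close>, and this minimum is positive.\<close>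

lemma away_from_zero:
  assumes "\<sigma> < b"
  obtains c where "0 < c" "c \<le> 1" "\<And>t. b \<le> t \<Longrightarrow> c < f t"
proof -
  obtain K where K: "\<And>t. t \<ge> K \<Longrightarrow> 1 < f t" using transient by auto
  have b0: "0 \<le> b" using assms \<sigma>_nonneg by simp
  obtain u where u: "u \<in> {b..max b K}" "\<And>s. s \<in> {b..max b K} \<Longrightarrow> f u \<le> f s"
    using inf_attained[OF b0, of "max b K"] by auto
  have "0 < f u" using pos_after assms u by auto
  show ?thesis
  proof (rule that[of "min (f u / 2) 1"])
    fix t assume "b \<le> t"
    show "min (f u / 2) 1 < f t"
    proof (cases "t \<le> K")
      case True
      then have "f u \<le> f t" using u(2)[of t] \<open>b \<le> t\<close> by auto
      then show ?thesis using \<open>0 < f u\<close> by auto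
    next
      case False
      then show ?thesis using K[of t] by auto
    qed
  qed (use \<open>0 < f u\<close> in auto)
qed

text \<open>For a level \<open>y > 0\<close> the sampled path must be at most \<open>y\<close> somewhere to the right of \<open>\<sigma>\<close>. For
  \<open>y = 0\<close> this may fail: the path could touch \<open>0\<close> from above at time \<open>\<sigma>\<close>, unseen by the grid.\<close>

definition last_idx :: "nat \<Rightarrow> real \<Rightarrow> nat" where
  "last_idx n y = (LEAST k. \<forall>j>k. y < f (grid n j))"

lemma last_idx:
  assumes "y \<le> 1"
  shows last_idx_after: "\<And>j. last_idx n y < j \<Longrightarrow> y < f (grid n j)"
    and last_idx_at: "0 \<le> y \<Longrightarrow> f (grid n (last_idx n y)) \<le> y"
proof -
  obtain K where K: "\<And>t. t \<ge> K \<Longrightarrow> 1 < f t" using transient by auto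
  obtain k where k: "K / mesh n < real k" using reals_Archimedean2 by blast
  have ex: "\<forall>j>k. y < f (grid n j)"
  proof safe
    fix j assume "k < j"
    then have "K / mesh n < real j" using k by linarith
    then have "K \<le> grid n j" by (simp add: field_simps)
    then show "y < f (grid n j)" using K assms by fastforce
  qed
  show *: "\<And>j. last_idx n y < j \<Longrightarrow> y < f (grid n j)"
    unfolding last_idx_def using LeastI[of "\<lambda>k. \<forall>j>k. y < f (grid n j)", OF ex] by blast
  assume "0 \<le> y"
  show "f (grid n (last_idx n y)) \<le> y"
  proof (cases "last_idx n y")
    case 0 then show ?thesis using zero \<open>0 \<le> y\<close> by simp
  next
    case (Suc m)
    have "\<not> (\<forall>j>m. y < f (grid n j))"
      using not_less_Least[of m "\<lambda>k. \<forall>j>k. y < f (grid n j)"] Suc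
      unfolding last_idx_def[symmetric] by simp
    then obtain j where j: "j > m" "f (grid n j) \<le> y" by auto
    have "\<not> Suc m < j" using *[of j] j Suc by auto
    then have "j = Suc m" using j by simp
    then show ?thesis using j Suc by simp
  qed
qed

lemma last_idx_gt_\<sigma>:
  assumes "0 < y" "y \<le> 1"
  shows "\<forall>\<^sub>F n in sequentially. \<sigma> < grid n (last_idx n y)"
proof -
  have "(\<lambda>n. f (grid n (next_idx n \<sigma>))) \<longlonglongrightarrow> 0"
    using right_cont_grid[OF right_cont \<sigma>_nonneg] by (simp add: at_\<sigma>)
  from order_tendstoD(2)[OF this assms(1)] show ?thesis
  proof eventually_elim
    case (elim n)
    have "next_idx n \<sigma> \<le> last_idx n y"
      using last_idx_after[OF assms(2), where n=n and j="next_idx n \<sigma>"] elim by fastforce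
    then have "grid n (next_idx n \<sigma>) \<le> grid n (last_idx n y)"
      by (simp add: mult_right_mono)
    then show ?case using next_idx_bounds(1)[OF \<sigma>_nonneg, of n] by linarith
  qed
qed

lemma last_idx_less:
  assumes "\<sigma> < b"
  shows "\<forall>\<^sub>F k in sequentially. \<forall>n. grid n (last_idx n (mesh k)) < b"
proof -
  obtain c where c: "0 < c" "c \<le> 1" "\<And>t. b \<le> t \<Longrightarrow> c < f t" using away_from_zero[OF assms] by metis
  from eventually_mesh_less[OF c(1)] show ?thesis
  proof eventually_elim
    case (elim k)
    show ?case
    proof
      fix n
      have "f (grid n (last_idx n (mesh k))) \<le> mesh k"
        by (rule last_idx_at) (auto simp: mesh_le_1)
      then show "grid n (last_idx n (mesh k)) < b" using c(3) elim by (metis linorder_not_le order.strict_trans order_less_le_trans)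
    qed
  qed
qed

text \<open>A record at time \<open>t\<close> is at least as high as everything before it. With an increasing drift it beats all
  points that lie before \<open>t\<close> by a fixed distance, and this is seen on a fine grid.\<close>

lemma argmax_after_record:
  assumes e: "right_cont e" and a: "a < record_time e \<sigma>" and be: "\<And>t. bdd_above (e ` {0..t})"
  shows "\<forall>\<^sub>F n in sequentially. \<forall>J. maximiser (\<lambda>j. e (grid n j) + mesh i * grid n j)
           (last_idx n (mesh k)) J \<longrightarrow> a < grid n J"
proof (cases "a < 0")
  case True
  have "a < grid n J" for J n using True by (smt (verit) mesh_nonneg mult_nonneg_nonneg of_nat_0_le_iff)
  then show ?thesis by simp
next
  case False
  then have s0: "\<sigma> \<noteq> 0" using a by (auto simp: record_time_def)
  then have sp: "0 < \<sigma>" using \<sigma>_nonneg by simp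
  let ?R = "{t \<in> {0..<\<sigma>}. e t = (SUP s\<in>{0..t}. e s)}"
  have "0 \<in> ?R" using sp by auto
  then obtain t where t: "t \<in> ?R" "a < t"
    using less_cSupD[of ?R a] a s0 unfolding record_time_def by (metis (mono_tags, lifting) empty_iff)
  then have t0: "0 \<le> t" "t < \<sigma>" and rec: "\<And>s. 0 \<le> s \<Longrightarrow> s \<le> t \<Longrightarrow> e s \<le> e t"
    using cSUP_upper[OF _ be[of t]] by auto
  have "(\<lambda>n. e (grid n (next_idx n t))) \<longlonglongrightarrow> e t" by (rule right_cont_grid[OF e t0(1)])
  moreover have "e t - mesh i * (t - a) < e t" using t by simp
  ultimately have ev1: "\<forall>\<^sub>F n in sequentially. e t - mesh i * (t - a) < e (grid n (next_idx n t))"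
    using order_tendstoD(1) by blast
  have ev2: "\<forall>\<^sub>F n in sequentially. \<sigma> < grid n (last_idx n (mesh k))"
    by (rule last_idx_gt_\<sigma>) (auto simp: mesh_le_1)
  from ev1 ev2 show ?thesis
  proof eventually_elim
    case (elim n)
    show ?case
    proof safe
      fix J assume J: "maximiser (\<lambda>j. e (grid n j) + mesh i * grid n j) (last_idx n (mesh k)) J"
      show "a < grid n J"
      proof (rule ccontr)
        assume "\<not> a < grid n J"
        then have Ja: "grid n J \<le> a" by simp
        have "next_idx n t \<le> last_idx n (mesh k)"
          using t0 elim(2) by (intro next_idx_le) auto
        then have "e (grid n (next_idx n t)) + mesh i * (grid n (next_idx n t))
            \<le> e (grid n J) + mesh i * grid n J"
          using J by (auto simp: maximiser_def)
        moreover have "e (grid n J) \<le> e t" using Ja t by (intro rec) auto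
        moreover have "mesh i * grid n J \<le> mesh i * a" using Ja by (intro mult_left_mono) auto
        moreover have "mesh i * t \<le> mesh i * (grid n (next_idx n t))"
          using next_idx_bounds(1)[OF t0(1), of n] by (intro mult_left_mono) auto
        moreover have "mesh i * (t - a) = mesh i * t - mesh i * a" by (simp add: algebra_simps)
        ultimately show False using elim(1) by linarith
      qed
    qed
  qed
qed

text \<open>After the last record the path stays below its earlier supremum, so with a decreasing drift the
  points far behind the last record cannot win. The points between \<open>\<sigma>\<close> and the end of the sampled
  path could exceed the supremum, but only by little once the level \<open>mesh k\<close> is small; this forces the
  level to be lowered before the drift.\<close>

lemma argmax_before_record:
  assumes e: "right_cont e" and a: "record_time e \<sigma> < a"
    and be: "bdd_above (e ` {0..\<sigma>})" and e0: "e 0 = 0" and e\<sigma>: "e \<sigma> = 0"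
    and T0: "0 \<le> record_time e \<sigma>"
    and R: "\<And>b s. record_time e \<sigma> < b \<Longrightarrow> b < \<sigma> \<Longrightarrow> 0 \<le> s \<Longrightarrow> s < \<sigma> \<Longrightarrow> e s \<le> (SUP r\<in>{0..b}. e r)"
  shows "\<forall>\<^sub>F k in sequentially. \<forall>\<^sub>F n in sequentially. \<forall>J.
           maximiser (\<lambda>j. e (grid n j) - mesh i * grid n j) (last_idx n (mesh k)) J
             \<longrightarrow> grid n J \<le> a"
proof (cases "\<sigma> < a")
  case True
  from last_idx_less[OF True] show ?thesis
  proof eventually_elim
    case (elim k)
    have "grid n J \<le> a" if "J \<le> last_idx n (mesh k)" for n J
      using that elim[rule_format, of n] by (smt (verit) mesh_nonneg mult_right_mono of_nat_mono)
    then show ?case by (auto simp: maximiser_def)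
  qed
next
  case False
  obtain b where b: "record_time e \<sigma> < b" "b < a" using a dense by blast
  then have b\<sigma>: "b < \<sigma>" and b0: "0 \<le> b" using False T0 by auto
  \<comment> \<open>the drift favours b over a by 4 * \<delta>\<close>
  define \<delta> where "\<delta> = mesh i * (a - b) / 4"
  have \<delta>: "0 < \<delta>" using b by (simp add: \<delta>_def)
  define S where "S = (SUP r\<in>{0..b}. e r)"
  have bb: "bdd_above (e ` {0..b})" by (rule bdd_above_mono[OF be]) (use b\<sigma> in auto)
  have S: "e s \<le> S" if "0 \<le> s" "s \<le> \<sigma>" for s
  proof (cases "s = \<sigma>")
    case True
    have "e 0 \<le> S" unfolding S_def using b0 by (intro cSUP_upper bb) auto
    then show ?thesis using True e0 e\<sigma> by simp
  next
    case False
    then show ?thesis using R[OF b(1) b\<sigma>, of s] that by (simp add: S_def)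
  qed
  have "\<exists>r\<in>{0..b}. S - \<delta> < e r"
    using less_cSUP_iff[OF _ bb, of "S - \<delta>"] b0 \<delta> by (auto simp: S_def)
  then obtain r where r: "0 \<le> r" "r \<le> b" "S - \<delta> < e r" by auto
  obtain b' where b': "\<sigma> < b'" "\<And>s. \<sigma> \<le> s \<Longrightarrow> s < b' \<Longrightarrow> e s < e \<sigma> + \<delta>"
    using right_cont_nbhd[OF e \<sigma>_nonneg, of "e \<sigma> + \<delta>"] \<delta> by auto
  have S': "e s \<le> S + \<delta>" if "0 \<le> s" "s < b'" for s
    using S[of s] S[of \<sigma>] b'(2)[of s] that \<delta> \<sigma>_nonneg by (cases "s \<le> \<sigma>") auto
  from last_idx_less[OF b'(1)] show ?thesis
  proof eventually_elim
    case (elim k)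
    have "(\<lambda>n. e (grid n (next_idx n r)) - mesh i * (grid n (next_idx n r))) \<longlonglongrightarrow> e r - mesh i * r"
      using next_idx_filterlim[OF r(1)]
      by (intro tendsto_diff tendsto_mult[OF tendsto_const] right_cont_grid[OF e r(1)])
        (simp add: filterlim_at)
    then have ev1: "\<forall>\<^sub>F n in sequentially. e r - mesh i * r - \<delta> <
        e (grid n (next_idx n r)) - mesh i * (grid n (next_idx n r))"
      using \<delta> by (intro order_tendstoD(1)) auto
    have ev2: "\<forall>\<^sub>F n in sequentially. \<sigma> < grid n (last_idx n (mesh k))"
      by (rule last_idx_gt_\<sigma>) (auto simp: mesh_le_1)
    from ev1 ev2 show ?case
    proof eventually_elim
      case (elim n)
      show ?case
      proof safe
        fix J assume J: "maximiser (\<lambda>j. e (grid n j) - mesh i * grid n j) (last_idx n (mesh k)) J"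
        show "grid n J \<le> a"
        proof (rule ccontr)
          assume "\<not> grid n J \<le> a"
          then have Ja: "a < grid n J" by simp
          have "next_idx n r \<le> last_idx n (mesh k)"
            using r b\<sigma> elim(2) by (intro next_idx_le) auto
          then have "e (grid n (next_idx n r)) - mesh i * (grid n (next_idx n r))
              \<le> e (grid n J) - mesh i * grid n J"
            using J by (auto simp: maximiser_def)
          moreover have "e (grid n J) \<le> S + \<delta>"
          proof (rule S')
            have "grid n J \<le> grid n (last_idx n (mesh k))"
              using J by (auto simp: maximiser_def intro: mult_right_mono)
            then show "grid n J < b'"
              using \<open>\<forall>n. grid n (last_idx n (mesh k)) < b'\<close>[rule_format, of n] by linarith
          qed simp
          moreover have "mesh i * a \<le> mesh i * grid n J" using Ja by (intro mult_left_mono) auto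
          moreover have "mesh i * r \<le> mesh i * b" using r by (intro mult_left_mono) auto
          moreover have "mesh i * a - mesh i * b = 4 * \<delta>" by (simp add: \<delta>_def algebra_simps)
          ultimately show False using elim(1) r(3) \<delta> by linarith
        qed
      qed
    qed
  qed
qed

end

section \<open>Counting grid points and occupation times\<close>

text \<open>The step function \<open>s \<mapsto> grid n (next_idx n s)\<close> takes each grid value on an interval of length
  \<open>mesh n\<close>.\<close>

lemma card_grid_integral:
  fixes P :: "real \<Rightarrow> bool"
  assumes "0 \<le> c" "c \<le> grid n K"
  shows "(\<integral>\<^sup>+ s. indicator {s \<in> {0..<c}. P (grid n (next_idx n s))} s \<partial>lborel)
    \<le> ennreal (mesh n * real (card {j\<in>{1..K}. P (grid n j)}))"
proof -
  let ?J = "{j\<in>{1..K}. P (grid n j)}"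
  have "indicator {s \<in> {0..<c}. P (grid n (next_idx n s))} s
      \<le> (\<Sum>j\<in>?J. indicator {(real j - 1) * mesh n..real j * mesh n} s :: ennreal)" (is "?L \<le> ?R") for s
  proof (cases "s \<in> {0..<c} \<and> P (grid n (next_idx n s))")
    case True
    then have s: "0 \<le> s" "s < c" by auto
    have "next_idx n s \<in> ?J"
      using True next_idx_le[OF s(1), where K=K and n=n] s assms by (auto simp: next_idx_def)
    have "s \<in> {(real (next_idx n s) - 1) * mesh n..real (next_idx n s) * mesh n}"
      using next_idx_bounds[OF s(1), of n] by (auto simp: algebra_simps)
    then have "?L \<le> indicator {(real (next_idx n s) - 1) * mesh n..real (next_idx n s) * mesh n} s"
      using True by simp
    also have "\<dots> \<le> ?R"
      using \<open>next_idx n s \<in> ?J\<close> by (intro member_le_sum) auto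
    finally show ?thesis .
  qed simp
  then have "(\<integral>\<^sup>+ s. indicator {s \<in> {0..<c}. P (grid n (next_idx n s))} s \<partial>lborel)
      \<le> (\<integral>\<^sup>+ s. (\<Sum>j\<in>?J. indicator {(real j - 1) * mesh n..real j * mesh n} s) \<partial>lborel)"
    by (intro nn_integral_mono) auto
  also have "\<dots> = (\<Sum>j\<in>?J. emeasure lborel {(real j - 1) * mesh n..real j * mesh n})"
    by (subst nn_integral_sum) auto
  also have "\<dots> = (\<Sum>j\<in>?J. ennreal (mesh n))"
    by (intro sum.cong refl) (simp add: algebra_simps)
  also have "\<dots> = ennreal (mesh n * real (card ?J))"
    by (simp add: ennreal_mult' ennreal_of_nat_eq_real_of_nat mult.commute)
  finally show ?thesis .
qed

lemma right_cont_measurable: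
  assumes e: "right_cont e"
  shows "(\<lambda>s. e (max 0 s)) \<in> borel_measurable borel"
proof (rule borel_measurable_LIMSEQ_real)
  show "(\<lambda>n. e (grid n (next_idx n (max 0 s)))) \<longlonglongrightarrow> e (max 0 s)" for s
    by (rule right_cont_grid[OF e]) simp
  show "(\<lambda>s. e (grid n (next_idx n (max 0 s)))) \<in> borel_measurable borel" for n
    unfolding next_idx_def by measurable
qed

lemma right_cont_sets:
  assumes e: "right_cont e" and A: "A \<in> sets borel"
  shows "{s. 0 \<le> s \<and> s \<le> c \<and> e s \<in> A} \<in> sets borel"
proof -
  have [measurable]: "(\<lambda>s. e (max 0 s)) \<in> borel_measurable borel" by (rule right_cont_measurable[OF e])
  have "{s. 0 \<le> s \<and> s \<le> c \<and> e s \<in> A} = {0..c} \<inter> {s \<in> space borel. e (max 0 s) \<in> A}"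
    by (auto simp: max_def)
  also have "\<dots> \<in> sets borel" using A by measurable
  finally show ?thesis .
qed

definition occ :: "(real \<Rightarrow> real) \<Rightarrow> real \<Rightarrow> real set \<Rightarrow> real" where
  "occ e c A = measure lborel {s. 0 \<le> s \<and> s \<le> c \<and> e s \<in> A}"

lemma occ_emeasure: "ennreal (occ e c A) = emeasure lborel {s. 0 \<le> s \<and> s \<le> c \<and> e s \<in> A}"
proof -
  have "emeasure lborel {s. 0 \<le> s \<and> s \<le> c \<and> e s \<in> A} \<le> emeasure lborel {0..c}"
    by (rule emeasure_mono) auto
  also have "\<dots> < \<infinity>" by (simp add: emeasure_lborel_Icc_eq)
  finally show ?thesis unfolding occ_def by (simp add: emeasure_eq_ennreal_measure)
qed

lemma occ_compl:
  assumes "right_cont e" "A \<in> sets borel" "0 \<le> c"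
  shows "occ e c A + occ e c (- A) = c"
proof -
  have "ennreal (occ e c A + occ e c (- A)) = ennreal (occ e c A) + ennreal (occ e c (- A))"
    by (simp add: occ_def)
  also have "\<dots> = emeasure lborel ({s. 0 \<le> s \<and> s \<le> c \<and> e s \<in> A} \<union> {s. 0 \<le> s \<and> s \<le> c \<and> e s \<in> - A})"
    unfolding occ_emeasure
    using right_cont_sets[OF assms(1,2)] right_cont_sets[OF assms(1), of "- A"] assms(2)
    by (intro plus_emeasure) (auto simp: borel_comp)
  also have "{s. 0 \<le> s \<and> s \<le> c \<and> e s \<in> A} \<union> {s. 0 \<le> s \<and> s \<le> c \<and> e s \<in> - A} = {0..c}" by auto
  finally show ?thesis using assms(3) by (simp add: occ_def del: ennreal_plus)
qed

text \<open>A strict inequality at \<open>s\<close> persists at nearby grid points to the right of \<open>s\<close>, so Fatou's lemma bounds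
  the grid count from below by the occupation time. The margin \<open>\<eta>\<close> absorbs later perturbations.\<close>

lemma count_lower:
  assumes e: "right_cont e" and c: "0 \<le> c" and a: "a < occ e c {0<..}"
  shows "\<exists>\<eta>>0. \<forall>\<^sub>F n in sequentially. \<forall>K. c \<le> grid n K \<longrightarrow>
           a < mesh n * real (card {j\<in>{1..K}. \<eta> < e (grid n j)})"
proof (cases "a < 0")
  case True
  have "a < mesh n * real (card {j\<in>{1..K}. 1 < e (grid n j)})" for n K
    using True by (smt (verit) mesh_nonneg mult_nonneg_nonneg of_nat_0_le_iff)
  then show ?thesis by (intro exI[of _ 1]) auto
next
  case False
  define D where "D i = {s. 0 \<le> s \<and> s \<le> c \<and> e s \<in> {mesh i<..}}" for i
  have D_sets: "D i \<in> sets lborel" for i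
    using right_cont_sets[OF e, of "{mesh i<..}" c] by (simp add: D_def)
  have "incseq D"
  proof (rule incseq_SucI)
    fix i
    have "mesh (Suc i) \<le> mesh i" by (simp add: mesh_def field_simps)
    then show "D i \<subseteq> D (Suc i)" by (auto simp: D_def)
  qed
  moreover have "(\<Union>i. D i) = {s. 0 \<le> s \<and> s \<le> c \<and> e s \<in> {0<..}}"
  proof safe
    fix s assume "0 \<le> s" "s \<le> c" "0 < e s"
    then show "s \<in> (\<Union>i. D i)"
      using eventually_mesh_less[of "e s"] by (auto simp: D_def eventually_sequentially)
  next
    fix s i assume "s \<in> D i"
    then show "0 \<le> s" "s \<le> c" "0 < e s" using less_trans[OF mesh_pos, of i "e s"] by (auto simp: D_def)
  qed
  ultimately have "(\<lambda>i. emeasure lborel (D i)) \<longlonglongrightarrow> ennreal (occ e c {0<..})"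
    unfolding occ_emeasure using D_sets Lim_emeasure_incseq[of D lborel] by auto
  moreover have "ennreal a < ennreal (occ e c {0<..})" using a False by (simp add: ennreal_lessI)
  ultimately have "\<forall>\<^sub>F i in sequentially. ennreal a < emeasure lborel (D i)"
    by (rule order_tendstoD(1))
  then obtain i where i: "ennreal a < emeasure lborel (D i)"
    by (auto simp: eventually_sequentially)
  define E where "E n = {s\<in>{0..<c}. mesh i < e (grid n (next_idx n s))}" for n
  have E_sets[measurable]: "E n \<in> sets borel" for n
  proof -
    have "E n = {0..<c} \<inter> {s \<in> space borel. mesh i < e (grid n (next_idx n s))}" by (auto simp: E_def)
    also have "\<dots> \<in> sets borel" unfolding next_idx_def by measurable
    finally show ?thesis .
  qed
  have "emeasure lborel (D i) = emeasure lborel (D i - {c})"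
    using D_sets by (intro emeasure_Diff_null_set[symmetric]) auto
  also have "\<dots> = (\<integral>\<^sup>+ s. indicator (D i - {c}) s \<partial>lborel)"
    using D_sets by simp
  also have "\<dots> \<le> (\<integral>\<^sup>+ s. liminf (\<lambda>n. indicator (E n) s) \<partial>lborel)"
  proof (rule nn_integral_mono)
    fix s
    show "indicator (D i - {c}) s \<le> liminf (\<lambda>n. indicator (E n) s :: ennreal)"
    proof (cases "s \<in> D i - {c}")
      case True
      then have s: "0 \<le> s" "s < c" "mesh i < e s" by (auto simp: D_def)
      have "\<forall>\<^sub>F n in sequentially. mesh i < e (grid n (next_idx n s))"
        by (rule order_tendstoD(1)[OF right_cont_grid[OF e s(1)] s(3)])
      then have "\<forall>\<^sub>F n in sequentially. indicator (D i - {c}) s \<le> (indicator (E n) s :: ennreal)"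
        by eventually_elim (use s True in \<open>auto simp: E_def\<close>)
      then show ?thesis by (rule Liminf_bounded)
    qed simp
  qed
  also have "\<dots> \<le> liminf (\<lambda>n. \<integral>\<^sup>+ s. indicator (E n) s \<partial>lborel)"
    by (rule nn_integral_liminf) auto
  finally have "ennreal a < liminf (\<lambda>n. \<integral>\<^sup>+ s. indicator (E n) s \<partial>lborel)"
    using i by (rule less_le_trans[rotated])
  then have "\<forall>\<^sub>F n in sequentially. ennreal a < (\<integral>\<^sup>+ s. indicator (E n) s \<partial>lborel)"
    by (rule less_LiminfD)
  then have "\<forall>\<^sub>F n in sequentially. \<forall>K. c \<le> grid n K \<longrightarrow>
           a < mesh n * real (card {j\<in>{1..K}. mesh i < e (grid n j)})"
  proof eventually_elim
    case (elim n)
    show ?case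
    proof safe
      fix K assume "c \<le> grid n K"
      from card_grid_integral[OF c this, of "\<lambda>x. mesh i < e x"] elim
      have "ennreal a < ennreal (mesh n * real (card {j\<in>{1..K}. mesh i < e (grid n j)}))"
        unfolding E_def by (rule less_le_trans[rotated])
      then show "a < mesh n * real (card {j\<in>{1..K}. mesh i < e (grid n j)})"
        using False by (simp add: ennreal_less_iff)
    qed
  qed
  then show ?thesis using mesh_pos[of i] by blast
qed

text \<open>This is the lower bound for the complementary set, where \<open>e\<close> is negative.\<close>

lemma count_upper:
  assumes e: "right_cont e" and c: "0 \<le> c" and a: "occ e c {0..} < a"
  shows "\<exists>\<eta>>0. \<exists>b>c. \<forall>\<^sub>F n in sequentially. \<forall>K. c \<le> grid n K \<and> grid n K < b \<longrightarrow>
           mesh n * real (card {j\<in>{1..K}. - \<eta> \<le> e (grid n j)}) < a"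
proof -
  define \<delta> where "\<delta> = (a - occ e c {0..}) / 2"
  have \<delta>: "0 < \<delta>" using a by (simp add: \<delta>_def)
  have "occ e c {0..} + occ e c (- {0..}) = c" by (rule occ_compl[OF e _ c]) auto
  moreover have "occ e c (- {0..}) = occ (\<lambda>s. - e s) c {0<..}"
    unfolding occ_def by (rule arg_cong[where f="measure lborel"]) auto
  ultimately have "occ (\<lambda>s. - e s) c {0<..} = c - occ e c {0..}" by simp
  then have "c - occ e c {0..} - \<delta> < occ (\<lambda>s. - e s) c {0<..}" using \<delta> by simp
  from count_lower[OF right_cont_uminus[OF e] c this] obtain \<eta> where \<eta>: "\<eta> > 0"
    "\<forall>\<^sub>F n in sequentially. \<forall>K. c \<le> grid n K \<longrightarrow>
       c - occ e c {0..} - \<delta> < mesh n * real (card {j\<in>{1..K}. \<eta> < - e (grid n j)})" by blast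
  have "\<forall>\<^sub>F n in sequentially. \<forall>K. c \<le> grid n K \<and> grid n K < c + \<delta> \<longrightarrow>
           mesh n * real (card {j\<in>{1..K}. - \<eta> \<le> e (grid n j)}) < a"
    using \<eta>(2)
  proof eventually_elim
    case (elim n)
    show ?case
    proof safe
      fix K assume K: "c \<le> grid n K" "grid n K < c + \<delta>"
      let ?A = "{j\<in>{1..K}. \<eta> < - e (grid n j)}" and ?B = "{j\<in>{1..K}. - \<eta> \<le> e (grid n j)}"
      have "card ?A + card ?B = card (?A \<union> ?B)" by (intro card_Un_disjoint[symmetric]) auto
      also have "?A \<union> ?B = {1..K}" by auto
      finally have "real (card ?A) + real (card ?B) = real K" by simp
      then have "mesh n * (real (card ?A) + real (card ?B)) = grid n K" by simp
      moreover have "c - occ e c {0..} - \<delta> < mesh n * real (card ?A)" using elim K by auto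
      ultimately show "mesh n * real (card ?B) < a"
        using K unfolding distrib_left \<delta>_def by argo
    qed
  qed
  then show ?thesis using \<eta> \<delta> by (intro exI[of _ \<eta>] conjI exI[of _ "c + \<delta>"]) auto
qed

context transient_path
begin

lemma record_time_nonneg:
  assumes "\<And>t. bdd_above (e ` {0..t})"
  shows "0 \<le> record_time e \<sigma>" "record_time e \<sigma> \<le> \<sigma>"
proof -
  let ?R = "{t \<in> {0..<\<sigma>}. e t = (SUP s\<in>{0..t}. e s)}"
  have "0 \<le> record_time e \<sigma> \<and> record_time e \<sigma> \<le> \<sigma>"
  proof (cases "\<sigma> = 0")
    case False
    then have "0 \<in> ?R" using \<sigma>_nonneg by auto
    moreover have "bdd_above ?R" by (intro bdd_aboveI[of _ \<sigma>]) auto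
    ultimately have "0 \<le> Sup ?R" by (rule cSup_upper)
    moreover have "Sup ?R \<le> \<sigma>" using \<open>0 \<in> ?R\<close> by (intro cSup_least) auto
    ultimately show ?thesis using False by (simp add: record_time_def)
  qed (simp add: record_time_def)
  then show "0 \<le> record_time e \<sigma>" "record_time e \<sigma> \<le> \<sigma>" by auto
qed

lemma record_le_record_time:
  assumes "0 \<le> t" "t < \<sigma>" "\<And>s. 0 \<le> s \<Longrightarrow> s \<le> t \<Longrightarrow> e s \<le> e t"
  shows "t \<le> record_time e \<sigma>"
proof -
  have "(SUP s\<in>{0..t}. e s) = e t"
    by (rule cSup_eq_maximum) (use assms in auto)
  then have "t \<le> Sup {t \<in> {0..<\<sigma>}. e t = (SUP s\<in>{0..t}. e s)}"
    using assms by (intro cSup_upper bdd_aboveI[of _ \<sigma>]) auto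
  then show ?thesis using assms by (simp add: record_time_def)
qed

text \<open>Without upward jumps a path that exceeds its former supremum first reaches it exactly, and the time of
  this contact is a record.\<close>

lemma no_new_maximum:
  assumes b: "record_time f \<sigma> < b" "b < \<sigma>" and s: "0 \<le> s" "s < \<sigma>"
  shows "f s \<le> (SUP r\<in>{0..b}. f r)"
proof (rule ccontr)
  define S where "S = (SUP r\<in>{0..b}. f r)"
  assume "\<not> f s \<le> (SUP r\<in>{0..b}. f r)"
  then have fs: "S < f s" by (simp add: S_def)
  have b0: "0 \<le> b" using record_time_nonneg(1)[OF bdd] b by linarith
  have upS: "f r \<le> S" if "0 \<le> r" "r \<le> b" for r
    unfolding S_def using that by (intro cSUP_upper bdd) auto
  have sb: "b < s" using upS[of s] fs s by fastforce
  let ?U = "{t. b < t \<and> t \<le> s \<and> S < f t}"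
  define t0 where "t0 = Inf ?U"
  have ne: "s \<in> ?U" using fs sb by auto
  have bdU: "bdd_below ?U" by (intro bdd_belowI[of _ b]) auto
  have t0: "b \<le> t0" "t0 \<le> s"
    unfolding t0_def using ne by (auto intro!: cInf_greatest cInf_lower bdU)
  have below: "f t \<le> S" if "0 \<le> t" "t < t0" for t
  proof (cases "t \<le> b")
    case False
    show ?thesis
    proof (rule ccontr)
      assume "\<not> f t \<le> S"
      then have "t \<in> ?U" using False that t0 by auto
      then have "t0 \<le> t" unfolding t0_def by (rule cInf_lower[OF _ bdU])
      with that show False by simp
    qed
  qed (use that upS in auto)
  have "f t0 \<le> S"
  proof (cases "t0 = b")
    case False
    then have pos: "0 < t0" using t0 b0 by auto
    have "\<forall>\<^sub>F r in at_left t0. f r \<le> S"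
      unfolding eventually_at_left_field using pos below by (intro exI[of _ 0]) auto
    then show ?thesis
      by (intro left_le[OF pos] eventually_frequently) (auto simp: trivial_limit_at_left_real)
  qed (use upS b0 in auto)
  moreover have "S \<le> f t0"
  proof (rule ccontr)
    assume "\<not> S \<le> f t0"
    then obtain c where c: "t0 < c" "\<And>r. t0 \<le> r \<Longrightarrow> r < c \<Longrightarrow> f r < S"
      using right_cont_nbhd[OF right_cont, of t0 S] t0 b0 by auto
    obtain t where "t \<in> ?U" "t < c"
      using cInf_lessD[of ?U c] ne c unfolding t0_def by auto
    moreover then have "t0 \<le> t" unfolding t0_def by (intro cInf_lower bdU)
    ultimately show False using c(2)[of t] by auto
  qed
  ultimately have "f t0 = S" by simp
  have "t0 \<le> record_time f \<sigma>"
  proof (rule record_le_record_time)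
    show "0 \<le> t0" "t0 < \<sigma>" using t0 b0 s by auto
    fix r assume "0 \<le> r" "r \<le> t0"
    then show "f r \<le> f t0" using below[of r] \<open>f t0 = S\<close> by (cases "r = t0") auto
  qed
  then show False using t0 b by simp
qed

lemma bdd_uminus: "bdd_above ((\<lambda>s. - f s) ` {0..t})"
proof (cases "0 \<le> t")
  case True
  then obtain u where "\<forall>s\<in>{0..t}. f u \<le> f s" using inf_attained[of 0 t] by auto
  then show ?thesis by (intro bdd_aboveI2[where M="- f u"]) auto
qed simp

text \<open>The infimum over \<open>{0..s}\<close> is attained by lower semicontinuity, and a place where it is attained is a
  record of the negative path.\<close>

lemma no_new_minimum:
  assumes b: "record_time (\<lambda>s. - f s) \<sigma> < b" "b < \<sigma>" and s: "0 \<le> s" "s < \<sigma>"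
  shows "- f s \<le> (SUP r\<in>{0..b}. - f r)"
proof -
  obtain u where u: "0 \<le> u" "u \<le> s" "\<And>r. 0 \<le> r \<Longrightarrow> r \<le> s \<Longrightarrow> f u \<le> f r"
    using inf_attained[of 0 s] s by auto
  have "u \<le> record_time (\<lambda>s. - f s) \<sigma>"
    using u s by (intro record_le_record_time) auto
  then have "- f u \<le> (SUP r\<in>{0..b}. - f r)" using u b by (intro cSUP_upper bdd_uminus) auto
  then show ?thesis using u(3)[of s] s by auto
qed

end

context transient_path
begin

abbreviation end_idx :: "nat \<Rightarrow> nat \<Rightarrow> nat" where
  "end_idx k n \<equiv> last_idx n (mesh k)"

lemma ev_end_gt: "\<forall>\<^sub>F n in sequentially. \<sigma> < grid n (end_idx k n)"
  by (rule last_idx_gt_\<sigma>) (auto simp: mesh_le_1)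

lemma ev3_end:
  assumes "\<sigma> < b"
  shows "ev3 (\<lambda>i k n. \<sigma> < grid n (end_idx k n) \<and> grid n (end_idx k n) < b)"
proof (rule always_eventually, rule allI)
  fix i
  from last_idx_less[OF assms]
  show "\<forall>\<^sub>F k in sequentially. \<forall>\<^sub>F n in sequentially.
      \<sigma> < grid n (end_idx k n) \<and> grid n (end_idx k n) < b"
  proof eventually_elim
    case (elim k)
    from ev_end_gt[of k] show ?case by eventually_elim (use elim in auto)
  qed
qed

text \<open>Perturbing the sampled values by small amounts does not matter in the limit, thanks to the margin in
  the bounds for the counts.\<close>

lemma count_upper_ev3:
  assumes e: "right_cont e" and a: "occ e \<sigma> {0..} < a"
    and \<delta>: "\<And>\<eta>. 0 < \<eta> \<Longrightarrow> ev3 (\<lambda>i k n. \<forall>j\<in>{1..end_idx k n}. \<bar>\<delta> i k n j\<bar> \<le> \<eta>)"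
  shows "ev3 (\<lambda>i k n. mesh n * real (card {j\<in>{1..end_idx k n}. 0 \<le> e (grid n j) + \<delta> i k n j}) < a)"
proof -
  from count_upper[OF e \<sigma>_nonneg a] obtain \<eta> b where \<eta>: "\<eta> > 0" "b > \<sigma>" and
    ev: "\<forall>\<^sub>F n in sequentially. \<forall>K. \<sigma> \<le> grid n K \<and> grid n K < b \<longrightarrow>
           mesh n * real (card {j\<in>{1..K}. - \<eta> \<le> e (grid n j)}) < a" by blast
  have "ev3 (\<lambda>i k n. \<forall>K. \<sigma> \<le> grid n K \<and> grid n K < b \<longrightarrow>
           mesh n * real (card {j\<in>{1..K}. - \<eta> \<le> e (grid n j)}) < a)"
    using ev by simp
  from ev3_conj[OF this ev3_conj[OF ev3_end[OF \<eta>(2)] \<delta>[OF \<eta>(1)]]] show ?thesis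
  proof (rule ev3_mono, elim conjE)
    fix i k n
    assume *: "\<forall>K. \<sigma> \<le> grid n K \<and> grid n K < b \<longrightarrow>
           mesh n * real (card {j\<in>{1..K}. - \<eta> \<le> e (grid n j)}) < a"
      "\<sigma> < grid n (end_idx k n)" "grid n (end_idx k n) < b"
      "\<forall>j\<in>{1..end_idx k n}. \<bar>\<delta> i k n j\<bar> \<le> \<eta>"
    have "card {j\<in>{1..end_idx k n}. 0 \<le> e (grid n j) + \<delta> i k n j}
        \<le> card {j\<in>{1..end_idx k n}. - \<eta> \<le> e (grid n j)}"
      by (rule card_mono) (use *(4) in fastforce)+
    then have "mesh n * real (card {j\<in>{1..end_idx k n}. 0 \<le> e (grid n j) + \<delta> i k n j})
        \<le> mesh n * real (card {j\<in>{1..end_idx k n}. - \<eta> \<le> e (grid n j)})"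
      by (intro mult_left_mono) auto
    also have "\<dots> < a" using *(1-3) by auto
    finally show "mesh n * real (card {j\<in>{1..end_idx k n}. 0 \<le> e (grid n j) + \<delta> i k n j}) < a" .
  qed
qed

lemma count_lower_ev3:
  assumes e: "right_cont e" and a: "a < occ e \<sigma> {0<..}"
    and \<delta>: "\<And>\<eta>. 0 < \<eta> \<Longrightarrow> ev3 (\<lambda>i k n. \<forall>j\<in>{1..end_idx k n}. \<bar>\<delta> i k n j\<bar> \<le> \<eta>)"
  shows "ev3 (\<lambda>i k n. a < mesh n * real (card {j\<in>{1..end_idx k n}. 0 < e (grid n j) + \<delta> i k n j}))"
proof -
  from count_lower[OF e \<sigma>_nonneg a] obtain \<eta> where \<eta>: "\<eta> > 0" and
    ev: "\<forall>\<^sub>F n in sequentially. \<forall>K. \<sigma> \<le> grid n K \<longrightarrow>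
           a < mesh n * real (card {j\<in>{1..K}. \<eta> < e (grid n j)})" by blast
  have "ev3 (\<lambda>i k n. \<forall>K. \<sigma> \<le> grid n K \<longrightarrow>
           a < mesh n * real (card {j\<in>{1..K}. \<eta> < e (grid n j)}))"
    using ev by simp
  moreover have "\<sigma> < \<sigma> + 1" by simp
  ultimately show ?thesis
  proof (rule ev3_mono[OF ev3_conj[OF _ ev3_conj[OF ev3_end \<delta>[OF \<eta>]]]], elim conjE)
    fix i k n
    assume *: "\<forall>K. \<sigma> \<le> grid n K \<longrightarrow>
           a < mesh n * real (card {j\<in>{1..K}. \<eta> < e (grid n j)})"
      "\<sigma> < grid n (end_idx k n)"
      "\<forall>j\<in>{1..end_idx k n}. \<bar>\<delta> i k n j\<bar> \<le> \<eta>"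
    have "a < mesh n * real (card {j\<in>{1..end_idx k n}. \<eta> < e (grid n j)})"
      using *(1,2) by auto
    also have "card {j\<in>{1..end_idx k n}. \<eta> < e (grid n j)}
        \<le> card {j\<in>{1..end_idx k n}. 0 < e (grid n j) + \<delta> i k n j}"
      by (rule card_mono) (use *(3) in fastforce)+
    then have "mesh n * real (card {j\<in>{1..end_idx k n}. \<eta> < e (grid n j)})
        \<le> mesh n * real (card {j\<in>{1..end_idx k n}. 0 < e (grid n j) + \<delta> i k n j})"
      by (intro mult_left_mono) auto
    finally show "a < mesh n * real (card {j\<in>{1..end_idx k n}. 0 < e (grid n j) + \<delta> i k n j})" .
  qed
qed

lemma drift_small:
  assumes "0 < \<eta>"
  shows "ev3 (\<lambda>i k n. \<forall>j\<in>{1..end_idx k n}. \<bar>mesh i * grid n j\<bar> \<le> \<eta>)"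
proof -
  have "ev3 (\<lambda>i k n. mesh i < \<eta> / (\<sigma> + 1))"
    using eventually_mesh_less[of "\<eta> / (\<sigma> + 1)"] assms \<sigma>_nonneg by simp
  moreover have "\<sigma> < \<sigma> + 1" by simp
  ultimately show ?thesis
  proof (rule ev3_mono[OF ev3_conj[OF _ ev3_end]], elim conjE, intro ballI)
    fix i k n j
    assume *: "mesh i < \<eta> / (\<sigma> + 1)" "grid n (end_idx k n) < \<sigma> + 1" "j \<in> {1..end_idx k n}"
    have "grid n j \<le> grid n (end_idx k n)" using *(3) by (intro mult_right_mono) auto
    then have "grid n j \<le> \<sigma> + 1" using *(2) by linarith
    then have "mesh i * grid n j \<le> mesh i * (\<sigma> + 1)" by (intro mult_left_mono) auto
    also have "\<dots> \<le> \<eta>" using *(1) \<sigma>_nonneg by (simp add: field_simps)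
    finally show "\<bar>mesh i * grid n j\<bar> \<le> \<eta>" by simp
  qed
qed

text \<open>The tilt is at most the absolute value of the end point of the sampled path, and that end point tends
  to \<open>e \<sigma> = 0\<close> from the right.\<close>

lemma tilt_small:
  assumes e: "right_cont e" "e \<sigma> = 0" and \<eta>: "0 < \<eta>"
  shows "ev3 (\<lambda>i k n. \<forall>j\<in>{1..end_idx k n}. \<bar>real j * (e (grid n (end_idx k n)) / real (end_idx k n))\<bar> \<le> \<eta>)"
proof -
  obtain b1 where b1: "\<sigma> < b1" "\<And>s. \<sigma> \<le> s \<Longrightarrow> s < b1 \<Longrightarrow> e s < \<eta>"
    using right_cont_nbhd[OF e(1) \<sigma>_nonneg, of \<eta>] e(2) \<eta> by auto
  obtain b2 where b2: "\<sigma> < b2" "\<And>s. \<sigma> \<le> s \<Longrightarrow> s < b2 \<Longrightarrow> - \<eta> < e s"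
    using right_cont_nbhd'[OF e(1) \<sigma>_nonneg, of "- \<eta>"] e(2) \<eta> by auto
  have "\<sigma> < min b1 b2" using b1 b2 by simp
  from ev3_end[OF this] show ?thesis
  proof (rule ev3_mono, elim conjE, intro ballI)
    fix i k n j
    assume *: "\<sigma> < grid n (end_idx k n)" "grid n (end_idx k n) < min b1 b2" "j \<in> {1..end_idx k n}"
    have "\<bar>e (grid n (end_idx k n))\<bar> \<le> \<eta>"
      using b1(2)[of "grid n (end_idx k n)"] b2(2)[of "grid n (end_idx k n)"] *(1,2) by auto
    moreover have "\<bar>real j * (e (grid n (end_idx k n)) / real (end_idx k n))\<bar>
        = (real j / real (end_idx k n)) * \<bar>e (grid n (end_idx k n))\<bar>"
      by (simp add: abs_mult abs_divide)
    moreover have "(real j / real (end_idx k n)) * \<bar>e (grid n (end_idx k n))\<bar> \<le> 1 * \<bar>e (grid n (end_idx k n))\<bar>"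
      using *(3) by (intro mult_right_mono) (auto simp: divide_le_eq)
    ultimately show "\<bar>real j * (e (grid n (end_idx k n)) / real (end_idx k n))\<bar> \<le> \<eta>" by linarith
  qed
qed

lemma last_idx_eq_iff:
  assumes "0 \<le> y" "y \<le> 1"
  shows "last_idx n y = m \<longleftrightarrow> f (grid n m) \<le> y \<and> (\<forall>j>m. y < f (grid n j))"
proof
  assume "last_idx n y = m"
  then show "f (grid n m) \<le> y \<and> (\<forall>j>m. y < f (grid n j))"
    using last_idx_at[OF assms(2,1)] last_idx_after[OF assms(2)] by blast
next
  assume m: "f (grid n m) \<le> y \<and> (\<forall>j>m. y < f (grid n j))"
  show "last_idx n y = m"
    unfolding last_idx_def
  proof (rule Least_equality)
    fix k assume "\<forall>j>k. y < f (grid n j)"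
    then show "m \<le> k" using m by (metis linorder_not_le)
  qed (use m in blast)
qed

text \<open>With \<open>s = 1\<close> and \<open>s = -1\<close> the maximum and the minimum of the path are treated together.\<close>

definition signed :: "real \<Rightarrow> real \<Rightarrow> real" where
  "signed s t = s * f t"

lemma signed:
  assumes "s = 1 \<or> s = -1"
  shows "right_cont (signed s)" "\<And>t. bdd_above (signed s ` {0..t})" "signed s 0 = 0" "signed s \<sigma> = 0"
    "0 \<le> record_time (signed s) \<sigma>" "record_time (signed s) \<sigma> \<le> \<sigma>"
    "\<And>b t. record_time (signed s) \<sigma> < b \<Longrightarrow> b < \<sigma> \<Longrightarrow> 0 \<le> t \<Longrightarrow> t < \<sigma> \<Longrightarrow> signed s t \<le> (SUP r\<in>{0..b}. signed s r)"
proof -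
  have eq: "signed s = f \<or> signed s = (\<lambda>t. - f t)" using assms by (auto simp: signed_def)
  show "right_cont (signed s)" using eq right_cont right_cont_uminus[OF right_cont] by auto
  show b: "\<And>t. bdd_above (signed s ` {0..t})" using eq bdd bdd_uminus by auto
  show "signed s 0 = 0" "signed s \<sigma> = 0" by (auto simp: signed_def zero at_\<sigma>)
  show "0 \<le> record_time (signed s) \<sigma>" "record_time (signed s) \<sigma> \<le> \<sigma>" by (rule record_time_nonneg[OF b])+
  show "\<And>b t. record_time (signed s) \<sigma> < b \<Longrightarrow> b < \<sigma> \<Longrightarrow> 0 \<le> t \<Longrightarrow> t < \<sigma> \<Longrightarrow> signed s t \<le> (SUP r\<in>{0..b}. signed s r)"
    using eq no_new_maximum no_new_minimum by auto
qed

lemma signed_argmax_after: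
  assumes s: "s = 1 \<or> s = -1" and a: "a < record_time (signed s) \<sigma>"
  shows "ev3 (\<lambda>i k n. \<forall>J. maximiser (\<lambda>j. signed s (grid n j) + mesh i * grid n j) (end_idx k n) J
      \<longrightarrow> a < grid n J)"
  using argmax_after_record[OF signed(1)[OF s] a signed(2)[OF s]] by (simp add: always_eventually)

lemma signed_argmax_before:
  assumes s: "s = 1 \<or> s = -1" and a: "record_time (signed s) \<sigma> < a"
  shows "ev3 (\<lambda>i k n. \<forall>J. maximiser (\<lambda>j. signed s (grid n j) - mesh i * grid n j) (end_idx k n) J
      \<longrightarrow> grid n J \<le> a)"
  by (intro always_eventually allI argmax_before_record)
    (use signed[OF s] a in \<open>auto\<close>)

end

section \<open>Random walks embedded in a Levy process\<close>

lemma borel_measurable_sum_list_map [measurable (raw)]: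
  assumes "\<And>i. i \<in> set l \<Longrightarrow> (\<lambda>x. g i x) \<in> borel_measurable N"
  shows "(\<lambda>x. sum_list (map (\<lambda>i. g i x) l) :: real) \<in> borel_measurable N"
  using assms by (induction l) auto

lemma measurable_psum:
  assumes "\<And>i. i \<in> set l \<Longrightarrow> (\<lambda>x. g i x) \<in> borel_measurable N"
  shows "(\<lambda>x. psum (map (\<lambda>i. g i x) l) j) \<in> borel_measurable N"
  unfolding take_map by (rule borel_measurable_sum_list_map) (use assms in \<open>auto dest: in_set_takeD\<close>)

lemma measurable_first_argmax:
  assumes "\<And>i. i \<in> set l \<Longrightarrow> (\<lambda>x. g i x) \<in> borel_measurable N"
  shows "(\<lambda>x. first_argmax (map (\<lambda>i. g i x) l)) \<in> measurable N (count_space UNIV)"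
proof -
  note [measurable] = measurable_psum[of l g, OF assms]
  show ?thesis unfolding first_argmax_def maximiser_def length_map by measurable
qed

lemma measurable_num_pos:
  assumes "\<And>i. i \<in> set l \<Longrightarrow> (\<lambda>x. g i x) \<in> borel_measurable N"
  shows "(\<lambda>x. num_pos (map (\<lambda>i. g i x) l)) \<in> measurable N (count_space UNIV)"
proof -
  note [measurable] = measurable_psum[of l g, OF assms]
  show ?thesis unfolding num_pos_def length_map by measurable
qed

lemma measurable_num_nonneg:
  assumes "\<And>i. i \<in> set l \<Longrightarrow> (\<lambda>x. g i x) \<in> borel_measurable N"
  shows "(\<lambda>x. num_nonneg (map (\<lambda>i. g i x) l)) \<in> measurable N (count_space UNIV)"
proof -
  note [measurable] = measurable_psum[of l g, OF assms]
  show ?thesis unfolding num_nonneg_def length_map by measurable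
qed

context levy_process
begin

definition inc :: "real \<Rightarrow> nat \<Rightarrow> 'a \<Rightarrow> real" where
  "inc h i \<omega> = X (real (Suc i) * h) \<omega> - X (real i * h) \<omega>"

lemma inc_measurable: "0 \<le> h \<Longrightarrow> inc h i \<in> borel_measurable M"
  unfolding inc_def by (intro borel_measurable_diff random_variable_X) auto

lemma sum_inc: "(\<Sum>i<j. inc h i \<omega>) = X (real j * h) \<omega> - X 0 \<omega>"
  unfolding inc_def using sum_lessThan_telescope[of "\<lambda>i. X (real i * h) \<omega>" j]
  by (simp only: of_nat_0 mult_zero_left)

lemma inc_indep:
  assumes "0 \<le> h"
  shows "indep_vars (\<lambda>_. borel) (inc h) UNIV"
  unfolding indep_vars_def2
proof
  show "\<forall>i\<in>UNIV. random_variable borel (inc h i)" using inc_measurable[OF assms] by auto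
  show "indep_sets (\<lambda>i. {inc h i -` A \<inter> space M |A. A \<in> sets borel}) UNIV"
  proof (rule indep_sets_finite_index_sets[THEN iffD2], intro allI impI)
    fix J :: "nat set" assume "finite J"
    then obtain n where n: "J \<subseteq> {..<n}" by (meson finite_nat_iff_bounded)
    have "indep_vars (\<lambda>_. borel) (\<lambda>i \<omega>. X (real (Suc i) * h) \<omega> - X (real i * h) \<omega>) {..<n}"
      using assms by (intro independent_increments[of "\<lambda>i. real i * h" n]) (auto intro: mult_right_mono)
    then have "indep_sets (\<lambda>i. {inc h i -` A \<inter> space M |A. A \<in> sets borel}) {..<n}"
      unfolding inc_def[abs_def] indep_vars_def2 by auto
    then show "indep_sets (\<lambda>i. {inc h i -` A \<inter> space M |A. A \<in> sets borel}) J"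
      using n by (rule indep_sets_mono_index[rotated])
  qed
qed

definition \<mu> :: "real \<Rightarrow> real measure" where
  "\<mu> h = distr M borel (\<lambda>\<omega>. X h \<omega> - X 0 \<omega>)"

lemma sets_\<mu> [simp, measurable_cong]: "sets (\<mu> h) = sets borel"
  and space_\<mu> [simp]: "space (\<mu> h) = UNIV"
  by (simp_all add: \<mu>_def)

lemma prob_space_\<mu>: "0 \<le> h \<Longrightarrow> prob_space (\<mu> h)"
  unfolding \<mu>_def by (intro prob_space_distr borel_measurable_diff random_variable_X) auto

lemma inc_distr:
  assumes "0 \<le> h"
  shows "distr M borel (inc h i) = \<mu> h"
proof -
  have "inc h i = (\<lambda>\<omega>. X (real i * h + h) \<omega> - X (real i * h) \<omega>)"
    by (simp add: inc_def fun_eq_iff algebra_simps)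
  then show ?thesis
    unfolding \<mu>_def using stationary_increments[of "real i * h" h] assms by simp
qed

lemma inc_seq_measurable:
  "0 \<le> h \<Longrightarrow> (\<lambda>\<omega> i. inc h i \<omega>) \<in> measurable M (PiM UNIV (\<lambda>_. borel))"
  by (rule measurable_PiM_single') (auto intro: inc_measurable)

lemma inc_seq_distr:
  assumes "0 \<le> h"
  shows "distr M (PiM UNIV (\<lambda>_. borel)) (\<lambda>\<omega> i. inc h i \<omega>) = PiM UNIV (\<lambda>_. \<mu> h)"
  using inc_indep[OF assms] inc_measurable[OF assms]
  by (subst (asm) indep_vars_iff_distr_eq_PiM) (auto simp: inc_distr[OF assms] restrict_UNIV)

text \<open>Independent steps with a common law form a product measure, which is invariant under injective
  reindexing.\<close>

lemma inc_seq_reindex: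
  assumes h: "0 \<le> h" and \<pi>: "inj (\<pi> :: nat \<Rightarrow> nat)"
  shows "distr M (PiM UNIV (\<lambda>_. borel)) (\<lambda>\<omega> i. inc h (\<pi> i) \<omega>)
       = distr M (PiM UNIV (\<lambda>_. borel)) (\<lambda>\<omega> i. inc h i \<omega>)"
proof -
  have s: "sets (PiM UNIV (\<lambda>_::nat. \<mu> h)) = sets (PiM UNIV (\<lambda>_. borel))"
    by (intro sets_PiM_cong) auto
  have m: "(\<lambda>x i. x (\<pi> i)) \<in> measurable (PiM UNIV (\<lambda>_. borel)) (PiM UNIV (\<lambda>_::nat. borel :: real measure))"
    by (rule measurable_PiM_single') auto
  have "PiM UNIV (\<lambda>_. \<mu> h) = distr (PiM UNIV (\<lambda>_. \<mu> h)) (PiM UNIV (\<lambda>_. \<mu> h)) (\<lambda>x i. x (\<pi> i))"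
    using distr_PiM_reindex[of UNIV "\<lambda>_. \<mu> h" \<pi> UNIV] prob_space_\<mu>[OF h] \<pi> by (simp add: restrict_UNIV)
  also have "\<dots> = distr (PiM UNIV (\<lambda>_. \<mu> h)) (PiM UNIV (\<lambda>_. borel)) (\<lambda>x i. x (\<pi> i))"
    by (rule distr_cong) (auto simp: s)
  also have "\<dots> = distr (distr M (PiM UNIV (\<lambda>_. borel)) (\<lambda>\<omega> i. inc h i \<omega>)) (PiM UNIV (\<lambda>_. borel)) (\<lambda>x i. x (\<pi> i))"
    by (simp add: inc_seq_distr[OF h])
  also have "\<dots> = distr M (PiM UNIV (\<lambda>_. borel)) (\<lambda>\<omega> i. inc h (\<pi> i) \<omega>)"
    by (subst distr_distr[OF m inc_seq_measurable[OF h]]) (simp add: comp_def)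
  finally show ?thesis by (simp add: inc_seq_distr[OF h])
qed

text \<open>The event depends on the steps before \<open>k\<close> only through their sum. This is the reason why conditioning
  on it leaves these steps exchangeable.\<close>

definition last_below :: "real \<Rightarrow> nat \<Rightarrow> (nat \<Rightarrow> real) \<Rightarrow> bool" where
  "last_below y k x \<longleftrightarrow> (\<Sum>i<k. x i) \<le> y \<and> (\<forall>j>k. y < (\<Sum>i<j. x i))"

lemma last_below_measurable [measurable]:
  "Measurable.pred (PiM UNIV (\<lambda>_::nat. borel)) (last_below y k)"
  unfolding last_below_def[abs_def] by measurable

text \<open>Extend the permutation by the identity. It preserves the law of the steps, and the event as well.\<close>

lemma exchangeable_before_last:
  fixes F :: "real list \<Rightarrow> ennreal"
  assumes h: "0 \<le> h" and l: "l \<in> permutations_of_set {..<k}"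
    and F: "(\<lambda>x. F (map x [0..<k])) \<in> borel_measurable (PiM UNIV (\<lambda>_::nat. borel))"
  shows "(\<integral>\<^sup>+\<omega>. indicator {\<omega>. last_below y k (\<lambda>i. inc h i \<omega>)} \<omega> * F (map (\<lambda>i. inc h i \<omega>) l) \<partial>M)
       = (\<integral>\<^sup>+\<omega>. indicator {\<omega>. last_below y k (\<lambda>i. inc h i \<omega>)} \<omega> * F (map (\<lambda>i. inc h i \<omega>) [0..<k]) \<partial>M)"
proof -
  define \<pi> where "\<pi> i = (if i < k then l ! i else i)" for i
  define H where "H x = indicator {x. last_below y k x} x * F (map x [0..<k])" for x
  have len: "length l = k" and dist: "distinct l" and set: "set l = {..<k}"
    using l length_finite_permutations_of_set[OF l] by (auto simp: permutations_of_set_def)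
  have nth: "i < k \<Longrightarrow> l ! i < k" for i using set len nth_mem by blast
  have inj: "inj \<pi>"
  proof (rule injI)
    fix i j assume "\<pi> i = \<pi> j"
    then show "i = j" using dist nth[of i] nth[of j] len
      by (auto simp: \<pi>_def nth_eq_iff_index_eq split: if_splits)
  qed
  have bij: "bij_betw \<pi> {..<j} {..<j}" if "k \<le> j" for j
  proof -
    have sub: "\<pi> ` {..<j} \<subseteq> {..<j}" using that by (auto simp: \<pi>_def dest: nth)
    have "inj_on \<pi> {..<j}" using inj by (rule inj_on_subset) simp
    then show ?thesis unfolding bij_betw_def using endo_inj_surj[OF _ sub] by auto
  qed
  have sums: "(\<Sum>i<j. x (\<pi> i)) = (\<Sum>i<j. x i)" if "k \<le> j" for j and x :: "nat \<Rightarrow> real"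
    by (rule sum.reindex_bij_betw[OF bij[OF that]])
  have Hp: "H (\<lambda>i. x (\<pi> i)) = indicator {x. last_below y k x} x * F (map x l)" for x
  proof -
    have "map (\<lambda>i. x (\<pi> i)) [0..<k] = map x l"
      by (rule nth_equalityI) (auto simp: len \<pi>_def)
    moreover have "last_below y k (\<lambda>i. x (\<pi> i)) = last_below y k x"
      unfolding last_below_def using sums[of _ x] by auto
    ultimately show ?thesis by (simp add: H_def indicator_def)
  qed
  have Hm: "H \<in> borel_measurable (PiM UNIV (\<lambda>_::nat. borel))"
    unfolding H_def using F by measurable
  have m: "(\<lambda>\<omega> i. inc h (\<pi> i) \<omega>) \<in> measurable M (PiM UNIV (\<lambda>_. borel))"
    by (rule measurable_PiM_single') (auto intro: inc_measurable[OF h])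
  have "(\<integral>\<^sup>+\<omega>. H (\<lambda>i. inc h (\<pi> i) \<omega>) \<partial>M) = (\<integral>\<^sup>+x. H x \<partial>distr M (PiM UNIV (\<lambda>_. borel)) (\<lambda>\<omega> i. inc h (\<pi> i) \<omega>))"
    by (rule nn_integral_distr[symmetric, OF m]) (use Hm in simp)
  also have "\<dots> = (\<integral>\<^sup>+x. H x \<partial>distr M (PiM UNIV (\<lambda>_. borel)) (\<lambda>\<omega> i. inc h i \<omega>))"
    by (simp add: inc_seq_reindex[OF h inj])
  also have "\<dots> = (\<integral>\<^sup>+\<omega>. H (\<lambda>i. inc h i \<omega>) \<partial>M)"
    by (rule nn_integral_distr[OF inc_seq_measurable[OF h]]) (use Hm in simp)
  finally have eq: "(\<integral>\<^sup>+\<omega>. H (\<lambda>i. inc h (\<pi> i) \<omega>) \<partial>M) = (\<integral>\<^sup>+\<omega>. H (\<lambda>i. inc h i \<omega>) \<partial>M)" .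
  have "H (\<lambda>i. inc h (\<pi> i) \<omega>) = indicator {\<omega>. last_below y k (\<lambda>i. inc h i \<omega>)} \<omega>
      * F (map (\<lambda>i. inc h i \<omega>) l)" for \<omega>
    using Hp[of "\<lambda>i. inc h i \<omega>"] by (simp add: indicator_def)
  moreover have "H (\<lambda>i. inc h i \<omega>) = indicator {\<omega>. last_below y k (\<lambda>i. inc h i \<omega>)} \<omega>
      * F (map (\<lambda>i. inc h i \<omega>) [0..<k])" for \<omega>
    by (simp add: H_def indicator_def)
  ultimately show ?thesis using eq by (simp only:)
qed

text \<open>On each event \<open>\<kappa> \<omega> = k\<close> both integrals may be averaged over all orderings of the first \<open>k\<close> steps, so an
  inequality for the sums over orderings suffices.\<close>

lemma average_before_last:
  fixes F G :: "real list \<Rightarrow> ennreal"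
  assumes h: "0 \<le> h"
    and F: "\<And>l. (\<lambda>x. F (map x l)) \<in> borel_measurable (PiM UNIV (\<lambda>_::nat. borel))"
    and G: "\<And>l. (\<lambda>x. G (map x l)) \<in> borel_measurable (PiM UNIV (\<lambda>_::nat. borel))"
    and le: "\<And>(x :: nat \<Rightarrow> real) k. (\<Sum>l\<in>permutations_of_set {..<k}. F (map x l)) \<le> (\<Sum>l\<in>permutations_of_set {..<k}. G (map x l))"
    and \<kappa>: "\<And>\<omega> k. \<omega> \<in> space M \<Longrightarrow> \<kappa> \<omega> = k \<longleftrightarrow> last_below y k (\<lambda>i. inc h i \<omega>)"
  shows "(\<integral>\<^sup>+\<omega>. F (map (\<lambda>i. inc h i \<omega>) [0..<\<kappa> \<omega>]) \<partial>M) \<le> (\<integral>\<^sup>+\<omega>. G (map (\<lambda>i. inc h i \<omega>) [0..<\<kappa> \<omega>]) \<partial>M)"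
proof -
  let ?E = "\<lambda>k. {\<omega>. last_below y k (\<lambda>i. inc h i \<omega>)}"
  let ?P = "\<lambda>k. permutations_of_set {..<k::nat}"
  have comp: "(\<lambda>\<omega>. H (\<lambda>i. inc h i \<omega>)) \<in> measurable M N"
    if "H \<in> measurable (PiM UNIV (\<lambda>_::nat. borel)) N" for H and N :: "'c measure"
    using measurable_compose[OF inc_seq_measurable[OF h] that] .
  have E[measurable]: "Measurable.pred M (\<lambda>\<omega>. last_below y k (\<lambda>i. inc h i \<omega>))" for k
    by (rule comp) simp
  have ind[measurable]: "(\<lambda>\<omega>. indicator (?E k) \<omega> :: ennreal) \<in> borel_measurable M" for k
    unfolding indicator_def by measurable
  have Hm: "(\<lambda>\<omega>. H (map (\<lambda>i. inc h i \<omega>) l)) \<in> borel_measurable M"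
    if "\<And>l. (\<lambda>x. H (map x l)) \<in> borel_measurable (PiM UNIV (\<lambda>_::nat. borel))"
    for H :: "real list \<Rightarrow> ennreal" and l
    using comp[OF that[of l]] .
  have split: "(\<integral>\<^sup>+\<omega>. H (map (\<lambda>i. inc h i \<omega>) [0..<\<kappa> \<omega>]) \<partial>M)
      = (\<Sum>k. \<integral>\<^sup>+\<omega>. indicator (?E k) \<omega> * H (map (\<lambda>i. inc h i \<omega>) [0..<k]) \<partial>M)"
    if "\<And>l. (\<lambda>x. H (map x l)) \<in> borel_measurable (PiM UNIV (\<lambda>_::nat. borel))"
    for H :: "real list \<Rightarrow> ennreal"
  proof -
    have "(\<integral>\<^sup>+\<omega>. H (map (\<lambda>i. inc h i \<omega>) [0..<\<kappa> \<omega>]) \<partial>M)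
        = (\<integral>\<^sup>+\<omega>. (\<Sum>k. indicator (?E k) \<omega> * H (map (\<lambda>i. inc h i \<omega>) [0..<k])) \<partial>M)"
    proof (rule nn_integral_cong)
      fix \<omega> assume w: "\<omega> \<in> space M"
      have "(\<lambda>k. indicator (?E k) \<omega> * H (map (\<lambda>i. inc h i \<omega>) [0..<k]))
          = (\<lambda>k. if k = \<kappa> \<omega> then H (map (\<lambda>i. inc h i \<omega>) [0..<\<kappa> \<omega>]) else 0)"
        by (rule ext) (auto simp: \<kappa>[OF w, symmetric] indicator_def)
      then show "H (map (\<lambda>i. inc h i \<omega>) [0..<\<kappa> \<omega>]) = (\<Sum>k. indicator (?E k) \<omega> * H (map (\<lambda>i. inc h i \<omega>) [0..<k]))"
        using suminf_finite[of "{\<kappa> \<omega>}" "\<lambda>k. if k = \<kappa> \<omega> then H (map (\<lambda>i. inc h i \<omega>) [0..<\<kappa> \<omega>]) else 0"] by simp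
    qed
    also have "\<dots> = (\<Sum>k. \<integral>\<^sup>+\<omega>. indicator (?E k) \<omega> * H (map (\<lambda>i. inc h i \<omega>) [0..<k]) \<partial>M)"
      using Hm[OF that] by (intro nn_integral_suminf) measurable
    finally show ?thesis .
  qed
  have avg: "of_nat (card (?P k)) * (\<integral>\<^sup>+\<omega>. indicator (?E k) \<omega> * H (map (\<lambda>i. inc h i \<omega>) [0..<k]) \<partial>M)
      = (\<integral>\<^sup>+\<omega>. indicator (?E k) \<omega> * (\<Sum>l\<in>?P k. H (map (\<lambda>i. inc h i \<omega>) l)) \<partial>M)"
    if "\<And>l. (\<lambda>x. H (map x l)) \<in> borel_measurable (PiM UNIV (\<lambda>_::nat. borel))"
    for H :: "real list \<Rightarrow> ennreal" and k
  proof -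
    note [measurable] = Hm[OF that]
    have "of_nat (card (?P k)) * (\<integral>\<^sup>+\<omega>. indicator (?E k) \<omega> * H (map (\<lambda>i. inc h i \<omega>) [0..<k]) \<partial>M)
        = (\<Sum>l\<in>?P k. \<integral>\<^sup>+\<omega>. indicator (?E k) \<omega> * H (map (\<lambda>i. inc h i \<omega>) l) \<partial>M)"
      by (simp add: exchangeable_before_last[OF h _ that])
    also have "\<dots> = (\<integral>\<^sup>+\<omega>. (\<Sum>l\<in>?P k. indicator (?E k) \<omega> * H (map (\<lambda>i. inc h i \<omega>) l)) \<partial>M)"
      by (intro nn_integral_sum[symmetric]) measurable
    finally show ?thesis by (simp add: sum_distrib_left)
  qed
  have "(\<integral>\<^sup>+\<omega>. indicator (?E k) \<omega> * F (map (\<lambda>i. inc h i \<omega>) [0..<k]) \<partial>M)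
      \<le> (\<integral>\<^sup>+\<omega>. indicator (?E k) \<omega> * G (map (\<lambda>i. inc h i \<omega>) [0..<k]) \<partial>M)" for k
  proof -
    have "of_nat (card (?P k)) * (\<integral>\<^sup>+\<omega>. indicator (?E k) \<omega> * F (map (\<lambda>i. inc h i \<omega>) [0..<k]) \<partial>M)
      \<le> of_nat (card (?P k)) * (\<integral>\<^sup>+\<omega>. indicator (?E k) \<omega> * G (map (\<lambda>i. inc h i \<omega>) [0..<k]) \<partial>M)"
      unfolding avg[OF F] avg[OF G] by (intro nn_integral_mono mult_left_mono le) auto
    moreover have "card (?P k) \<noteq> 0" by simp
    ultimately show ?thesis by (subst (asm) ennreal_mult_le_mult_iff) auto
  qed
  then show ?thesis unfolding split[OF F] split[OF G] by (intro suminf_le) auto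
qed

end

section \<open>Laws of the statistics of the sampled process\<close>

locale transient_levy = levy_process M X for M :: "'a measure" and X +
  assumes path: "\<And>\<omega>. transient_path (\<lambda>t. X t \<omega>)"
begin

lemma X_0: "X 0 \<omega> = 0"
proof -
  interpret transient_path "\<lambda>t. X t \<omega>" by (rule path)
  show ?thesis by (rule zero)
qed

definition last_time :: "'a \<Rightarrow> real" where
  "last_time \<omega> = transient_path.\<sigma> (\<lambda>t. X t \<omega>)"

definition \<kappa> :: "nat \<Rightarrow> nat \<Rightarrow> 'a \<Rightarrow> nat" where
  "\<kappa> k n \<omega> = transient_path.last_idx (\<lambda>t. X t \<omega>) n (mesh k)"

definition steps :: "nat \<Rightarrow> nat \<Rightarrow> 'a \<Rightarrow> real list" where
  "steps k n \<omega> = map (\<lambda>i. inc (mesh n) i \<omega>) [0..<\<kappa> k n \<omega>]"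

definition affine :: "real \<Rightarrow> real \<Rightarrow> real list \<Rightarrow> real list" where
  "affine s d = map (\<lambda>v. s * v + d)"

lemma \<kappa>_eq_iff: "\<kappa> k n \<omega> = m \<longleftrightarrow> last_below (mesh k) m (\<lambda>i. inc (mesh n) i \<omega>)"
proof -
  interpret transient_path "\<lambda>t. X t \<omega>" by (rule path)
  show ?thesis
    unfolding \<kappa>_def last_below_def sum_inc X_0
    by (subst last_idx_eq_iff) (auto simp: mesh_le_1)
qed

lemma \<kappa>_measurable [measurable]: "\<kappa> k n \<in> measurable M (count_space UNIV)"
proof -
  have [measurable]: "(\<lambda>\<omega> i. inc (mesh n) i \<omega>) \<in> measurable M (PiM UNIV (\<lambda>_. borel))"
    by (rule inc_seq_measurable) simp
  have "Measurable.pred M (\<lambda>\<omega>. last_below (mesh k) m (\<lambda>i. inc (mesh n) i \<omega>))" for m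
    by measurable
  then have "{\<omega>\<in>space M. \<kappa> k n \<omega> = m} \<in> sets M" for m
    unfolding \<kappa>_eq_iff pred_def .
  then show ?thesis
    by (auto simp: measurable_count_space_eq2_countable vimage_def Int_def conj_commute)
qed

lemma length_steps [simp]: "length (steps k n \<omega>) = \<kappa> k n \<omega>" by (simp add: steps_def)

lemma length_affine [simp]: "length (affine s d xs) = length xs" by (simp add: affine_def)

lemma psum_affine: "j \<le> length xs \<Longrightarrow> psum (affine s d xs) j = s * psum xs j + d * real j"
proof -
  assume j: "j \<le> length xs"
  have "sum_list (map (\<lambda>v. s * v + d) ys) = s * sum_list ys + d * real (length ys)" for ys
    by (induction ys) (auto simp: algebra_simps)
  then show ?thesis using j by (simp add: affine_def take_map)
qed

lemma psum_steps:
  assumes "j \<le> \<kappa> k n \<omega>"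
  shows "psum (steps k n \<omega>) j = X (grid n j) \<omega>"
proof -
  have "take j [0..<\<kappa> k n \<omega>] = [0..<j]" using assms by (simp add: take_upt)
  then have "psum (steps k n \<omega>) j = (\<Sum>i<j. inc (mesh n) i \<omega>)"
    by (simp add: steps_def take_map atLeast0LessThan interv_sum_list_conv_sum_set_nat)
  then show ?thesis by (simp add: sum_inc X_0)
qed

lemma psum_affine_steps:
  assumes "j \<le> \<kappa> k n \<omega>"
  shows "psum (affine s d (steps k n \<omega>)) j = s * X (grid n j) \<omega> + d * real j"
  using assms by (simp add: psum_affine psum_steps)

lemma psum_tilt:
  assumes "j \<le> length xs"
  shows "psum (tilt xs) j = psum xs j - real j * (sum_list xs / real (length xs))"
proof -
  have "sum_list (map (\<lambda>v. v - c) ys) = sum_list ys - real (length ys) * c" for ys and c :: real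
    by (induction ys) (auto simp: algebra_simps)
  then show ?thesis using assms by (simp add: tilt_def take_map)
qed

lemma law_first_argmax:
  fixes \<Phi> :: "nat \<Rightarrow> ennreal"
  shows "(\<integral>\<^sup>+\<omega>. \<Phi> (first_argmax (affine s d (steps k n \<omega>))) \<partial>M)
       = (\<integral>\<^sup>+\<omega>. \<Phi> (num_pos (affine s d (steps k n \<omega>))) \<partial>M)"
proof -
  have m: "(\<lambda>x. \<Phi> (first_argmax (affine s d (map x l)))) \<in> borel_measurable (PiM UNIV (\<lambda>_::nat. borel))"
    "(\<lambda>x. \<Phi> (num_pos (affine s d (map x l)))) \<in> borel_measurable (PiM UNIV (\<lambda>_::nat. borel))" for l
    unfolding affine_def map_map comp_def
    by (rule measurable_compose[OF measurable_first_argmax], simp, simp)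
      (rule measurable_compose[OF measurable_num_pos], simp, simp)
  have eq: "(\<Sum>l\<in>permutations_of_set {..<k}. \<Phi> (num_pos (affine s d (map x l))))
      = (\<Sum>l\<in>permutations_of_set {..<k}. \<Phi> (first_argmax (affine s d (map x l))))" for x :: "nat \<Rightarrow> real" and k
    using sparre_andersen[of \<Phi> "\<lambda>i. s * x i + d" k] by (simp add: affine_def comp_def)
  show ?thesis
    unfolding steps_def
    by (rule antisym; rule average_before_last[where y="mesh k" and h="mesh n"])
      (use m eq \<kappa>_eq_iff in \<open>simp_all\<close>)
qed

lemma law_first_argmax_rev:
  fixes \<Phi> :: "nat \<Rightarrow> ennreal"
  shows "(\<integral>\<^sup>+\<omega>. \<Phi> (first_argmax (rev (affine s d (steps k n \<omega>)))) \<partial>M)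
       = (\<integral>\<^sup>+\<omega>. \<Phi> (num_pos (affine s d (steps k n \<omega>))) \<partial>M)"
proof -
  have m: "(\<lambda>x. \<Phi> (first_argmax (rev (affine s d (map x l))))) \<in> borel_measurable (PiM UNIV (\<lambda>_::nat. borel))"
    "(\<lambda>x. \<Phi> (num_pos (affine s d (map x l)))) \<in> borel_measurable (PiM UNIV (\<lambda>_::nat. borel))" for l
    unfolding affine_def map_map comp_def rev_map
    by (rule measurable_compose[OF measurable_first_argmax], simp, simp)
      (rule measurable_compose[OF measurable_num_pos], simp, simp)
  have eq: "(\<Sum>l\<in>permutations_of_set {..<k}. \<Phi> (num_pos (affine s d (map x l))))
      = (\<Sum>l\<in>permutations_of_set {..<k}. \<Phi> (first_argmax (rev (affine s d (map x l)))))" for x :: "nat \<Rightarrow> real" and k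
    using sparre_andersen[of \<Phi> "\<lambda>i. s * x i + d" k]
      sum_perms_rev[of "\<lambda>l. \<Phi> (first_argmax (affine s d (map x l)))" k]
    by (simp add: affine_def comp_def rev_map)
  show ?thesis
    unfolding steps_def
    by (rule antisym; rule average_before_last[where y="mesh k" and h="mesh n"])
      (use m eq \<kappa>_eq_iff in \<open>simp_all\<close>)
qed

text \<open>Since the sampled path ends close to \<open>0\<close>, the tilted steps describe almost the same path; but they form
  an exact bridge, for which the times above and below \<open>0\<close> can be compared.\<close>

lemma law_tilt:
  fixes \<Phi> :: "nat \<Rightarrow> ennreal"
  assumes mono: "\<And>i j. i \<le> j \<Longrightarrow> \<Phi> i \<le> \<Phi> j"
  shows "(\<integral>\<^sup>+\<omega>. \<Phi> (num_pos (tilt (affine s d (steps k n \<omega>)))) \<partial>M)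
       \<le> (\<integral>\<^sup>+\<omega>. \<Phi> (num_nonneg (map uminus (tilt (affine s d (steps k n \<omega>))))) \<partial>M)"
proof -
  have m: "(\<lambda>x. \<Phi> (num_pos (tilt (affine s d (map x l))))) \<in> borel_measurable (PiM UNIV (\<lambda>_::nat. borel))"
    "(\<lambda>x. \<Phi> (num_nonneg (map uminus (tilt (affine s d (map x l)))))) \<in> borel_measurable (PiM UNIV (\<lambda>_::nat. borel))" for l
    unfolding affine_def map_map comp_def tilt_def length_map
    by (rule measurable_compose[OF measurable_num_pos], measurable)
      (rule measurable_compose[OF measurable_num_nonneg], measurable)
  have le: "(\<Sum>l\<in>permutations_of_set {..<k}. \<Phi> (num_pos (tilt (affine s d (map x l)))))
      \<le> (\<Sum>l\<in>permutations_of_set {..<k}. \<Phi> (num_nonneg (map uminus (tilt (affine s d (map x l))))))" for x :: "nat \<Rightarrow> real" and k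
    using cyclic_sum[of \<Phi> "\<lambda>i. s * x i + d" k, OF mono] by (simp add: affine_def comp_def)
  show ?thesis
    unfolding steps_def
    by (rule average_before_last[where y="mesh k" and h="mesh n"])
      (use m le \<kappa>_eq_iff in \<open>simp_all\<close>)
qed

lemma statistic_measurable:
  assumes "\<And>l. (\<lambda>x. F (map x l)) \<in> measurable (PiM UNIV (\<lambda>_::nat. borel)) N"
  shows "(\<lambda>\<omega>. F (steps k n \<omega>)) \<in> measurable M N"
  unfolding steps_def
proof (rule measurable_compose_countable[OF _ \<kappa>_measurable])
  fix m
  show "(\<lambda>\<omega>. F (map (\<lambda>i. inc (mesh n) i \<omega>) [0..<m])) \<in> measurable M N"
    by (rule measurable_compose[OF inc_seq_measurable assms]) simp
qed

lemma first_argmax_steps_measurable [measurable]: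
  "(\<lambda>\<omega>. first_argmax (affine s d (steps k n \<omega>))) \<in> measurable M (count_space UNIV)"
  by (rule statistic_measurable[of "\<lambda>xs. first_argmax (affine s d xs)"])
    (simp add: affine_def comp_def, rule measurable_first_argmax, simp)

lemma first_argmax_rev_steps_measurable [measurable]:
  "(\<lambda>\<omega>. first_argmax (rev (affine s d (steps k n \<omega>)))) \<in> measurable M (count_space UNIV)"
  by (rule statistic_measurable[of "\<lambda>xs. first_argmax (rev (affine s d xs))"])
    (simp add: affine_def comp_def rev_map, rule measurable_first_argmax, simp)

lemma num_pos_steps_measurable [measurable]:
  "(\<lambda>\<omega>. num_pos (affine s d (steps k n \<omega>))) \<in> measurable M (count_space UNIV)"
  by (rule statistic_measurable[of "\<lambda>xs. num_pos (affine s d xs)"])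
    (simp add: affine_def comp_def, rule measurable_num_pos, simp)

lemma num_pos_tilt_measurable [measurable]:
  "(\<lambda>\<omega>. num_pos (tilt (affine s d (steps k n \<omega>)))) \<in> measurable M (count_space UNIV)"
proof (rule statistic_measurable[of "\<lambda>xs. num_pos (tilt (affine s d xs))"])
  show "(\<lambda>x. num_pos (tilt (affine s d (map x l)))) \<in> measurable (PiM UNIV (\<lambda>_::nat. borel)) (count_space UNIV)" for l
    unfolding affine_def map_map comp_def tilt_def length_map by (rule measurable_num_pos) measurable
qed

lemma num_nonneg_tilt_measurable [measurable]:
  "(\<lambda>\<omega>. num_nonneg (map uminus (tilt (affine s d (steps k n \<omega>))))) \<in> measurable M (count_space UNIV)"
proof (rule statistic_measurable[of "\<lambda>xs. num_nonneg (map uminus (tilt (affine s d xs)))"])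
  show "(\<lambda>x. num_nonneg (map uminus (tilt (affine s d (map x l))))) \<in> measurable (PiM UNIV (\<lambda>_::nat. borel)) (count_space UNIV)" for l
    unfolding affine_def map_map comp_def tilt_def length_map by (rule measurable_num_nonneg) measurable
qed

end

section \<open>Random walks with positive mean tend to infinity\<close>

locale iid_reals = prob_space \<mu> for \<mu> :: "real measure" +
  assumes sets_mu [measurable_cong]: "sets \<mu> = sets borel"
    and mean_integrable: "integrable \<mu> (\<lambda>x. x)"
begin

abbreviation P :: "(nat \<Rightarrow> real) measure" where "P \<equiv> PiM UNIV (\<lambda>_. \<mu>)"

sublocale S: product_prob_space "\<lambda>_. \<mu>" "UNIV :: nat set"
  by unfold_locales

sublocale Q: sequence_space \<mu>
  by unfold_locales

sublocale PP: pair_prob_space \<mu> P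
  by unfold_locales

definition drift_sum :: "real \<Rightarrow> nat \<Rightarrow> (nat \<Rightarrow> real) \<Rightarrow> real" where
  "drift_sum c k x = (\<Sum>i<k. c - x i)"

text \<open>The maximum of \<open>0\<close> and the first \<open>n\<close> partial sums, in the recursive form that compares it with the
  maximum for the shifted sequence.\<close>

fun max_sum :: "real \<Rightarrow> nat \<Rightarrow> (nat \<Rightarrow> real) \<Rightarrow> real" where
  "max_sum c 0 x = 0"
| "max_sum c (Suc n) x = max 0 (c - x 0 + max_sum c n (\<lambda>i. x (Suc i)))"

definition unbounded_sum :: "real \<Rightarrow> (nat \<Rightarrow> real) set" where
  "unbounded_sum c = {x. \<forall>C::nat. \<exists>k. real C < drift_sum c k x}"

lemma drift_sum_Suc: "drift_sum c (Suc k) x = c - x 0 + drift_sum c k (\<lambda>i. x (Suc i))"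
  unfolding drift_sum_def by (rule sum.lessThan_Suc_shift)

lemma drift_le_max: "k \<le> n \<Longrightarrow> drift_sum c k x \<le> max_sum c n x"
proof (induction n arbitrary: k x)
  case (Suc n)
  then show ?case
    by (cases k) (auto simp: drift_sum_Suc le_max_iff_disj drift_sum_def[of _ 0])
qed (simp add: drift_sum_def)

lemma max_sum_nonneg: "0 \<le> max_sum c n x"
  by (cases n) auto

lemma max_sum_mono: "max_sum c n x \<le> max_sum c (Suc n) x"
proof (induction n arbitrary: x)
  case (Suc n)
  show ?case using Suc.IH[of "\<lambda>i. x (Suc i)"] unfolding max_sum.simps(2)[of c "Suc n"] max_sum.simps(2)[of c n] by auto
qed simp

lemma max_sum_le: "max_sum c n x \<le> (\<Sum>i<n. \<bar>c - x i\<bar>)"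
proof (induction n arbitrary: x)
  case (Suc n)
  have "max_sum c (Suc n) x \<le> \<bar>c - x 0\<bar> + max_sum c n (\<lambda>i. x (Suc i))"
    using max_sum_nonneg[of c n] by auto
  also have "\<dots> \<le> \<bar>c - x 0\<bar> + (\<Sum>i<n. \<bar>c - x (Suc i)\<bar>)" using Suc by simp
  also have "\<dots> = (\<Sum>i<Suc n. \<bar>c - x i\<bar>)" by (rule sum.lessThan_Suc_shift[symmetric])
  finally show ?case .
qed simp

lemma coord: "(\<lambda>x. x i) \<in> borel_measurable P"
  using measurable_component_singleton[of i UNIV "\<lambda>_. \<mu>"] by (simp add: sets_mu cong: measurable_cong_sets)

lemma shift: "(\<lambda>x i. x (Suc i)) \<in> measurable P P"
  by (rule measurable_PiM_single') (auto intro: measurable_component_singleton simp: space_PiM)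

lemma max_sum_measurable [measurable]: "max_sum c n \<in> borel_measurable P"
proof (induction n)
  case (Suc n)
  note [measurable] = Suc coord
  have "(\<lambda>x. max_sum c n (\<lambda>i. x (Suc i))) \<in> borel_measurable P"
    by (rule measurable_compose[OF shift Suc])
  then have "(\<lambda>x. max 0 (c - x 0 + max_sum c n (\<lambda>i. x (Suc i)))) \<in> borel_measurable P"
    by measurable
  then show ?case by (simp only: max_sum.simps(2)[symmetric] eta_contract_eq)
next
  case 0
  have "max_sum c 0 = (\<lambda>_. 0)" by (rule ext) simp
  then show ?case by simp
qed

lemma unbounded_sets [measurable]: "unbounded_sum c \<in> sets P"
proof -
  note [measurable] = coord
  have "{x\<in>space P. \<forall>C::nat. \<exists>k. real C < drift_sum c k x} \<in> sets P"
    unfolding drift_sum_def by measurable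
  moreover have "space P = UNIV" by (auto simp: space_PiM sets_eq_imp_space_eq[OF sets_mu])
  ultimately show ?thesis by (simp add: unbounded_sum_def)
qed

text \<open>Prefixing one step changes all partial sums by the same amount.\<close>

lemma unbounded_case_nat: "case_nat s x \<in> unbounded_sum c \<longleftrightarrow> x \<in> unbounded_sum c"
proof
  assume L: "case_nat s x \<in> unbounded_sum c"
  show "x \<in> unbounded_sum c"
    unfolding unbounded_sum_def
  proof (safe)
    fix C :: nat
    obtain D :: nat where D: "real C + \<bar>c - s\<bar> < real D" using reals_Archimedean2 by blast
    obtain k where k: "real D < drift_sum c k (case_nat s x)" using L by (auto simp: unbounded_sum_def)
    then obtain k' where "k = Suc k'" by (cases k) (auto simp: drift_sum_def)
    then have "real D < c - s + drift_sum c k' x" using k by (simp add: drift_sum_Suc)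
    then show "\<exists>k. real C < drift_sum c k x" using D by (intro exI[of _ k']) linarith
  qed
next
  assume R: "x \<in> unbounded_sum c"
  show "case_nat s x \<in> unbounded_sum c"
    unfolding unbounded_sum_def
  proof (safe)
    fix C :: nat
    obtain D :: nat where D: "real C + \<bar>c - s\<bar> < real D" using reals_Archimedean2 by blast
    obtain k where k: "real D < drift_sum c k x" using R by (auto simp: unbounded_sum_def)
    have "drift_sum c (Suc k) (case_nat s x) = c - s + drift_sum c k x" by (simp add: drift_sum_Suc)
    then show "\<exists>k. real C < drift_sum c k (case_nat s x)" using D k by (intro exI[of _ "Suc k"]) linarith
  qed
qed

lemma coord_integrable: "integrable P (\<lambda>x. x i)"
proof -
  have "distr P \<mu> (\<lambda>x. x i) = \<mu>" by (rule distr_PiM_component) (auto intro: prob_space_axioms)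
  then show ?thesis
    using integrable_distr_eq[of "\<lambda>x. x i" P \<mu> "\<lambda>x. x"] mean_integrable by simp
qed

lemma max_sum_integrable: "integrable P (max_sum c n)"
proof (rule Bochner_Integration.integrable_bound)
  show "integrable P (\<lambda>x. \<Sum>i<n. \<bar>c - x i\<bar>)" using coord_integrable by auto
  show "AE x in P. norm (max_sum c n x) \<le> norm (\<Sum>i<n. \<bar>c - x i\<bar>)"
    using max_sum_le[of c n] max_sum_nonneg[of c n] by (auto intro!: AE_I2 order_trans[OF max_sum_le] abs_ge_self)
qed (rule max_sum_measurable)

text \<open>The maximal ergodic inequality in the style of Garsia. Let \<open>B\<close> be the event of unbounded sums and
  \<open>M n\<close> the maximum of the first sums. Prefixing a step \<open>s\<close> changes \<open>M n\<close> into
  \<open>M (n + 1) = M n + max (- M n) (c - s)\<close>, and it preserves both the law of the sequence and \<open>B\<close>. As \<open>M\<close>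
  is increasing, \<open>max (- M n) (c - s)\<close> has a nonnegative integral over \<open>B\<close>. There \<open>M n\<close> tends to
  infinity, so in the limit \<open>c - s\<close> has a nonnegative integral over \<open>B\<close>; but \<open>s\<close> is independent of
  \<open>B\<close>, and \<open>c\<close> is smaller than the mean.\<close>

theorem prob_unbounded_sum:
  assumes "c < expectation (\<lambda>x. x)"
  shows "S.prob (unbounded_sum c) = 0"
proof -
  let ?B = "unbounded_sum c" and ?D = "\<mu> \<Otimes>\<^sub>M P"
  have cn[measurable]: "(\<lambda>(s, x). case_nat s x) \<in> measurable ?D P"
    unfolding split_beta' by measurable
  have iter: "distr ?D P (\<lambda>(s, x). case_nat s x) = P" by (rule Q.PiM_iter)
  have fst: "distr ?D \<mu> fst = \<mu>" by (rule S.distr_pair_fst)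
  have snd: "distr ?D P snd = P"
  proof (rule measure_eqI)
    fix A assume "A \<in> sets (distr ?D P snd)"
    then have A: "A \<in> sets P" by simp
    have "emeasure (distr ?D P snd) A = emeasure ?D (snd -` A \<inter> space ?D)"
      using A by (intro emeasure_distr) auto
    also have "snd -` A \<inter> space ?D = space \<mu> \<times> A"
      using sets.sets_into_space[OF A] by (auto simp: space_pair_measure)
    also have "emeasure ?D (space \<mu> \<times> A) = emeasure P A"
      using A by (simp add: S.emeasure_pair_measure_Times emeasure_space_1)
    finally show "emeasure (distr ?D P snd) A = emeasure P A" .
  qed simp
  define q where "q n = (\<lambda>x. indicator ?B x * max_sum c n x)" for n
  have q[measurable]: "q n \<in> borel_measurable P" for n
    unfolding q_def by (intro borel_measurable_times borel_measurable_indicator unbounded_sets max_sum_measurable)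
  have qI: "integrable P (q n)" for n
  proof (rule Bochner_Integration.integrable_bound[OF max_sum_integrable[of c n]])
    show "AE x in P. norm (q n x) \<le> norm (max_sum c n x)"
      by (auto simp: q_def indicator_def)
  qed (rule q)
  define h where "h n z = indicator ?B (snd z) * max (- max_sum c n (snd z)) (c - fst z)"
    for n and z :: "real \<times> (nat \<Rightarrow> real)"
  have h_eq: "h n z = q (Suc n) (case z of (s, x) \<Rightarrow> case_nat s x) - q n (snd z)" for n z
    by (cases z) (auto simp: h_def q_def unbounded_case_nat indicator_def)
  have I1: "integrable ?D (\<lambda>z. q (Suc n) (case z of (s, x) \<Rightarrow> case_nat s x))" for n
    using integrable_distr[OF cn, of "q (Suc n)"] qI[of "Suc n"] unfolding iter by simp
  have I2: "integrable ?D (\<lambda>z. q n (snd z))" for n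
    using integrable_distr[of snd ?D P "q n"] qI[of n] unfolding snd by simp
  have nonneg: "0 \<le> (\<integral>z. h n z \<partial>?D)" for n
  proof -
    have "(\<integral>z. h n z \<partial>?D) = (\<integral>z. q (Suc n) (case z of (s, x) \<Rightarrow> case_nat s x) \<partial>?D) - (\<integral>z. q n (snd z) \<partial>?D)"
      unfolding h_eq by (rule Bochner_Integration.integral_diff[OF I1 I2])
    also have "(\<integral>z. q (Suc n) (case z of (s, x) \<Rightarrow> case_nat s x) \<partial>?D) = (\<integral>x. q (Suc n) x \<partial>P)"
      using integral_distr[OF cn q, of "Suc n"] unfolding iter by (rule sym)
    also have "(\<integral>z. q n (snd z) \<partial>?D) = (\<integral>x. q n x \<partial>P)"
      using integral_distr[OF measurable_snd q, of \<mu> n] unfolding snd by (rule sym)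
    finally have "(\<integral>z. h n z \<partial>?D) = (\<integral>x. q (Suc n) x \<partial>P) - (\<integral>x. q n x \<partial>P)" .
    moreover have "(\<integral>x. q n x \<partial>P) \<le> (\<integral>x. q (Suc n) x \<partial>P)"
      unfolding q_def using max_sum_mono
      by (intro integral_mono qI[unfolded q_def] mult_left_mono) (auto simp: indicator_def)
    ultimately show ?thesis by linarith
  qed
  have If: "integrable ?D (\<lambda>z. c - fst z)"
  proof -
    have "integrable (distr ?D \<mu> fst) (\<lambda>s. s)" unfolding fst by (rule mean_integrable)
    from integrable_distr[OF measurable_fst this] show ?thesis
      by (rule Bochner_Integration.integrable_diff[OF PP.integrable_const])
  qed
  have "(\<lambda>n. \<integral>z. h n z \<partial>?D) \<longlonglongrightarrow> (\<integral>z. indicator ?B (snd z) * (c - fst z) \<partial>?D)"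
  proof (rule integral_dominated_convergence[where w="\<lambda>z. \<bar>c - fst z\<bar>"])
    have [measurable]: "(\<lambda>z. indicator ?B (snd z) :: real) \<in> borel_measurable ?D"
      by (rule measurable_compose[OF measurable_snd borel_measurable_indicator[OF unbounded_sets]])
    have [measurable]: "(\<lambda>z. max_sum c n (snd z)) \<in> borel_measurable ?D" for n
      by (rule measurable_compose[OF measurable_snd max_sum_measurable])
    have "(\<lambda>z. fst z) \<in> measurable ?D \<mu>" by simp
    then have [measurable]: "(\<lambda>z. fst z) \<in> borel_measurable ?D"
      by (simp add: sets_mu cong: measurable_cong_sets)
    show "h n \<in> borel_measurable ?D" for n unfolding h_def[abs_def]
      by (intro borel_measurable_times borel_measurable_max borel_measurable_uminus borel_measurable_diff borel_measurable_const) measurable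
    show "(\<lambda>z. indicator ?B (snd z) * (c - fst z)) \<in> borel_measurable ?D"
      by (intro borel_measurable_times borel_measurable_diff borel_measurable_const) measurable
    show "integrable ?D (\<lambda>z. \<bar>c - fst z\<bar>)" using If by (rule integrable_abs)
    show "AE z in ?D. norm (h n z) \<le> \<bar>c - fst z\<bar>" for n
    proof (rule AE_I2)
      fix z :: "real \<times> (nat \<Rightarrow> real)"
      have "\<bar>max (- m) d\<bar> \<le> \<bar>d\<bar>" if "0 \<le> m" for m d :: real
        using that by (cases "- m \<le> d") (auto simp: max_def)
      from this[OF max_sum_nonneg] show "norm (h n z) \<le> \<bar>c - fst z\<bar>"
        by (simp add: h_def indicator_def)
    qed
    show "AE z in ?D. (\<lambda>n. h n z) \<longlonglongrightarrow> indicator ?B (snd z) * (c - fst z)"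
    proof (intro AE_I2 tendsto_eventually)
      fix z :: "real \<times> (nat \<Rightarrow> real)"
      show "\<forall>\<^sub>F n in sequentially. h n z = indicator ?B (snd z) * (c - fst z)"
      proof (cases "snd z \<in> ?B")
        case True
        obtain C :: nat where C: "\<bar>c - fst z\<bar> < real C" using reals_Archimedean2 by blast
        obtain k where k: "real C < drift_sum c k (snd z)" using True by (auto simp: unbounded_sum_def)
        from eventually_ge_at_top[of k] show ?thesis
        proof eventually_elim
          case (elim n)
          have "\<bar>c - fst z\<bar> \<le> max_sum c n (snd z)" using drift_le_max[OF elim, of c "snd z"] k C by linarith
          then show ?case by (simp add: h_def max_def)
        qed
      qed (simp add: h_def)
    qed
  qed
  then have "0 \<le> (\<integral>z. indicator ?B (snd z) * (c - fst z) \<partial>?D)"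
    by (rule LIMSEQ_le_const) (use nonneg in auto)
  also have "\<dots> = (\<integral>s. \<integral>x. indicator ?B x * (c - s) \<partial>P \<partial>\<mu>)"
  proof -
    have "integrable ?D (\<lambda>z. indicator ?B (snd z) * (c - fst z))"
      by (rule Bochner_Integration.integrable_bound[OF If]) (auto simp: indicator_def)
    from PP.integral_fst'[OF this] show ?thesis by simp
  qed
  also have "\<dots> = (\<integral>s. S.prob ?B * (c - s) \<partial>\<mu>)"
    by simp
  also have "\<dots> = S.prob ?B * (c - expectation (\<lambda>x. x))"
    using mean_integrable by (simp add: prob_space)
  finally have "0 \<le> S.prob ?B * (c - expectation (\<lambda>x. x))" .
  then show ?thesis using assms measure_nonneg[of P ?B] by (auto simp: zero_le_mult_iff)
qed

text \<open>For \<open>c\<close> between \<open>0\<close> and the mean, the sums of \<open>c - x i\<close> are bounded above, so those of \<open>x i\<close> grow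
  at least linearly.\<close>

corollary AE_sum_at_top:
  assumes "0 < expectation (\<lambda>x. x)"
  shows "AE x in P. filterlim (\<lambda>k. \<Sum>i<k. x i) at_top sequentially"
proof -
  define c where "c = expectation (\<lambda>x. x) / 2"
  have c: "0 < c" "c < expectation (\<lambda>x. x)" using assms by (auto simp: c_def)
  have "AE x in P. x \<notin> unbounded_sum c"
    using prob_unbounded_sum[OF c(2)] by (subst S.prob_eq_0[symmetric]) auto
  then show ?thesis
  proof eventually_elim
    case (elim x)
    then obtain C :: nat where C: "\<And>k. drift_sum c k x \<le> real C" by (auto simp: unbounded_sum_def not_less)
    have "filterlim (\<lambda>k. - real C + c * real k) at_top sequentially"
      using c(1) by real_asymp
    then show ?case
    proof (rule filterlim_at_top_mono)
      have "drift_sum c k x = c * real k - (\<Sum>i<k. x i)" for k by (simp add: drift_sum_def sum_subtractf)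
      then show "\<forall>\<^sub>F k in sequentially. - real C + c * real k \<le> (\<Sum>i<k. x i)"
        using C by (intro always_eventually allI) (metis add.commute diff_le_eq le_diff_eq minus_le_iff uminus_add_conv_diff)
    qed
  qed
qed

end

context levy_process
begin

lemma AE_at_top:
  assumes m: "0 < integral\<^sup>L M (X 1)"
  shows "AE \<omega> in M. filterlim (\<lambda>k. X (real k) \<omega>) at_top sequentially"
proof -
  have X[measurable]: "X 1 \<in> borel_measurable M" "X 0 \<in> borel_measurable M"
    by (rule random_variable_X, simp)+
  have AE: "AE \<omega> in M. X 1 \<omega> - X 0 \<omega> = X 1 \<omega>" using start_zero by eventually_elim simp
  have intX: "integrable M (X 1)" using m not_integrable_integral_eq by fastforce
  have "integrable M (\<lambda>\<omega>. X 1 \<omega> - X 0 \<omega>)"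
    using intX AE by (subst integrable_cong_AE[where g="X 1"]) auto
  have iid: "iid_reals (\<mu> 1)"
  proof (intro iid_reals.intro iid_reals_axioms.intro)
    show "prob_space (\<mu> 1)" by (rule prob_space_\<mu>) simp
    show "integrable (\<mu> 1) (\<lambda>x. x)"
      unfolding \<mu>_def using \<open>integrable M (\<lambda>\<omega>. X 1 \<omega> - X 0 \<omega>)\<close> by (subst integrable_distr_eq) auto
  qed simp
  have "(\<integral>x. x \<partial>\<mu> 1) = (\<integral>\<omega>. X 1 \<omega> - X 0 \<omega> \<partial>M)"
    unfolding \<mu>_def by (subst integral_distr) auto
  also have "\<dots> = integral\<^sup>L M (X 1)" using AE by (intro integral_cong_AE) auto
  finally have "0 < (\<integral>x. x \<partial>\<mu> 1)" using m by simp
  from iid_reals.AE_sum_at_top[OF iid this]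
  have "AE x in distr M (PiM UNIV (\<lambda>_. borel)) (\<lambda>\<omega> i. inc 1 i \<omega>). filterlim (\<lambda>k. \<Sum>i<k. x i) at_top sequentially"
    by (subst inc_seq_distr) simp_all
  then have "AE \<omega> in M. filterlim (\<lambda>k. \<Sum>i<k. inc 1 i \<omega>) at_top sequentially"
    by (rule AE_distrD[rotated]) (rule inc_seq_measurable, simp)
  with start_zero show ?thesis
    by eventually_elim (simp add: sum_inc)
qed

end

context levy_process
begin

text \<open>The simple Markov property at the grid time \<open>j * h\<close>, for events that are given by the path on the grid
  up to then. The later increment may have an arbitrary length \<open>s\<close>.\<close>

lemma markov_grid:
  assumes h: "0 \<le> h" and s: "0 \<le> s" and C: "\<And>i. C i \<in> sets borel" and B: "B \<in> sets borel"
    and X0: "\<And>\<omega>. X 0 \<omega> = 0"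
  shows "prob {\<omega>\<in>space M. (\<forall>i\<le>j. X (real i * h) \<omega> \<in> C i) \<and> X (real j * h + s) \<omega> - X (real j * h) \<omega> \<in> B}
       = prob {\<omega>\<in>space M. \<forall>i\<le>j. X (real i * h) \<omega> \<in> C i} * prob {\<omega>\<in>space M. X s \<omega> \<in> B}"
proof -
  note [measurable] = random_variable_X
  define t where "t i = (if i \<le> j then real i * h else real j * h + s)" for i
  define D where "D i \<omega> = X (t (Suc i)) \<omega> - X (t i) \<omega>" for i \<omega>
  have t0: "0 \<le> t 0" by (simp add: t_def)
  have "t i \<le> t (Suc i)" if "i < Suc j" for i
  proof (cases "Suc i \<le> j")
    case True
    then show ?thesis using h by (simp add: t_def mult_right_mono)
  next
    case False
    then have "i = j" using that by simp
    then show ?thesis using s by (simp add: t_def)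
  qed
  from independent_increments[of t "Suc j", OF t0 this]
  have ind: "indep_vars (\<lambda>_. borel) D {..<Suc j}" by (simp add: D_def[abs_def])
  have Dsum: "(\<Sum>l<i. D l \<omega>) = X (real i * h) \<omega>" if "i \<le> j" for i \<omega>
  proof -
    have "(\<Sum>l<i. D l \<omega>) = X (t i) \<omega> - X (t 0) \<omega>"
      unfolding D_def by (rule sum_lessThan_telescope)
    then show ?thesis using that by (simp add: t_def X0)
  qed
  have Dj: "D j \<omega> = X (real j * h + s) \<omega> - X (real j * h) \<omega>" for \<omega>
    by (simp add: D_def t_def)
  define Y1 :: "(nat \<Rightarrow> real) \<Rightarrow> real"
    where "Y1 x = (if \<forall>i\<in>{..j}. (\<Sum>l<i. x l) \<in> C i then 1 else 0)" for x
  define Y2 where "Y2 x = x j" for x :: "nat \<Rightarrow> real"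
  have iv: "indep_var (PiM {..<j} (\<lambda>_. borel)) (\<lambda>\<omega>. restrict (\<lambda>i. D i \<omega>) {..<j})
        (PiM {j} (\<lambda>_. borel)) (\<lambda>\<omega>. restrict (\<lambda>i. D i \<omega>) {j})"
    by (rule indep_var_restrict[OF ind]) auto
  have Y1m: "Y1 \<in> borel_measurable (PiM {..<j} (\<lambda>_. borel))"
  proof -
    have "(\<lambda>x. \<Sum>l<i. x l :: real) \<in> borel_measurable (PiM {..<j} (\<lambda>_. borel))" if "i \<le> j" for i
      by (rule borel_measurable_sum[where S="{..<i}" and f="\<lambda>l x. x l"]) (use that in auto)
    then have "Measurable.pred (PiM {..<j} (\<lambda>_. borel)) (\<lambda>x. (\<Sum>l<i. x l) \<in> C i)" if "i \<le> j" for i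
      using that C[of i] by (intro pred_sets2[of _ borel]) auto
    then have "Measurable.pred (PiM {..<j} (\<lambda>_. borel)) (\<lambda>x. \<forall>i\<in>{..j}. (\<Sum>l<i. x l) \<in> C i)"
      by (intro pred_intros_finite) auto
    then show ?thesis unfolding Y1_def[abs_def] by (intro measurable_If) auto
  qed
  have Y2m: "Y2 \<in> measurable (PiM {j} (\<lambda>_. borel)) borel"
    unfolding Y2_def[abs_def] by (rule measurable_component_singleton) simp
  from indep_var_compose[OF iv Y1m Y2m]
  have iv2: "indep_var borel (\<lambda>\<omega>. Y1 (restrict (\<lambda>i. D i \<omega>) {..<j})) borel (\<lambda>\<omega>. Y2 (restrict (\<lambda>i. D i \<omega>) {j}))"
    by (simp add: comp_def)
  have y1: "Y1 (restrict (\<lambda>i. D i \<omega>) {..<j}) = (if \<forall>i\<le>j. X (real i * h) \<omega> \<in> C i then 1 else 0)" for \<omega>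
  proof -
    have "(\<Sum>l<i. restrict (\<lambda>i. D i \<omega>) {..<j} l) = X (real i * h) \<omega>" if "i \<le> j" for i
    proof -
      have "(\<Sum>l<i. restrict (\<lambda>i. D i \<omega>) {..<j} l) = (\<Sum>l<i. D l \<omega>)"
        using that by (intro sum.cong) auto
      then show ?thesis using Dsum[OF that] by simp
    qed
    then show ?thesis by (simp add: Y1_def)
  qed
  have y2: "Y2 (restrict (\<lambda>i. D i \<omega>) {j}) = X (real j * h + s) \<omega> - X (real j * h) \<omega>" for \<omega>
    by (simp add: Y2_def Dj)
  have "prob {\<omega>\<in>space M. (\<forall>i\<le>j. X (real i * h) \<omega> \<in> C i) \<and> X (real j * h + s) \<omega> - X (real j * h) \<omega> \<in> B}
      = prob {\<omega>\<in>space M. \<forall>i\<le>j. X (real i * h) \<omega> \<in> C i} *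
        prob {\<omega>\<in>space M. X (real j * h + s) \<omega> - X (real j * h) \<omega> \<in> B}"
  proof -
    have ite: "((if Q then 1 else 0 :: real) = 1) = Q" for Q by simp
    have "(\<lambda>\<omega>. (if \<forall>i\<le>j. X (real i * h) \<omega> \<in> C i then 1 else 0 :: real, X (real j * h + s) \<omega> - X (real j * h) \<omega>)) -` ({1} \<times> B) \<inter> space M
        = {\<omega>\<in>space M. (\<forall>i\<le>j. X (real i * h) \<omega> \<in> C i) \<and> X (real j * h + s) \<omega> - X (real j * h) \<omega> \<in> B}"
      "(\<lambda>\<omega>. if \<forall>i\<le>j. X (real i * h) \<omega> \<in> C i then 1 else 0 :: real) -` {1} \<inter> space M
        = {\<omega>\<in>space M. \<forall>i\<le>j. X (real i * h) \<omega> \<in> C i}"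
      "(\<lambda>\<omega>. X (real j * h + s) \<omega> - X (real j * h) \<omega>) -` B \<inter> space M
        = {\<omega>\<in>space M. X (real j * h + s) \<omega> - X (real j * h) \<omega> \<in> B}"
      by (auto simp only: vimage_eq Int_iff mem_Sigma_iff singleton_iff ite mem_Collect_eq)
    then show ?thesis
      using indep_varD[OF iv2, of "{1}" B] B unfolding y1 y2 by simp
  qed
  also have "prob {\<omega>\<in>space M. X (real j * h + s) \<omega> - X (real j * h) \<omega> \<in> B}
      = measure (distr M borel (\<lambda>\<omega>. X (real j * h + s) \<omega> - X (real j * h) \<omega>)) B"
    using B h s by (subst measure_distr) (auto simp: vimage_def Int_def conj_commute intro!: borel_measurable_diff random_variable_X)
  also have "\<dots> = measure (distr M borel (\<lambda>\<omega>. X s \<omega> - X 0 \<omega>)) B"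
    using stationary_increments[of "real j * h" s] h s by simp
  also have "\<dots> = prob {\<omega>\<in>space M. X s \<omega> \<in> B}"
    using B s by (subst measure_distr) (auto simp: X0 vimage_def Int_def conj_commute intro!: random_variable_X)
  finally show ?thesis .
qed

end

lemma (in levy_process) grid_event_sets:
  assumes h: "0 \<le> h" and C: "\<And>i. C i \<in> sets borel"
  shows "{\<omega>\<in>space M. \<forall>i\<le>j. X (real i * h) \<omega> \<in> C i} \<in> sets M"
proof -
  have "Measurable.pred M (\<lambda>\<omega>. X (real i * h) \<omega> \<in> C i)" for i
    using h C[of i] random_variable_X[of "real i * h"] by (intro pred_sets2[of _ borel]) auto
  then have "Measurable.pred M (\<lambda>\<omega>. \<forall>i\<in>{..j}. X (real i * h) \<omega> \<in> C i)"
    by (intro pred_intros_finite) auto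
  then have "{\<omega>\<in>space M. \<forall>i\<in>{..j}. X (real i * h) \<omega> \<in> C i} \<in> sets M" by (rule predE)
  then show ?thesis by (simp only: Ball_def atMost_iff)
qed

section \<open>The process eventually stays above a level\<close>

locale rc_levy = levy_process M X for M :: "'a measure" and X +
  assumes rc: "\<And>\<omega>. right_cont (\<lambda>t. X t \<omega>)"
    and X_zero: "\<And>\<omega>. X 0 \<omega> = 0"
    and bdd_paths: "\<And>\<omega> t. bdd_above ((\<lambda>s. X s \<omega>) ` {0..t})"
begin

text \<open>The paths are bounded on \<open>{0..1}\<close>. The restriction to rational times, which include all differences of
  grid times, makes the event of being bounded by \<open>a\<close> measurable.\<close>

lemma stochastically_bounded:
  "\<exists>a. \<forall>s\<in>\<rat>. 0 \<le> s \<longrightarrow> s \<le> 1 \<longrightarrow> 1/2 \<le> prob {\<omega>\<in>space M. X s \<omega> \<le> a}"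
proof -
  note [measurable] = random_variable_X
  define D where "D a = {\<omega>\<in>space M. \<forall>q. 0 \<le> q \<and> q \<le> 1 \<longrightarrow> X (real_of_rat q) \<omega> \<le> real a}" for a :: nat
  have D[measurable]: "D a \<in> sets M" for a
  proof -
    have "Measurable.pred M (\<lambda>\<omega>. 0 \<le> q \<and> q \<le> 1 \<longrightarrow> X (real_of_rat q) \<omega> \<le> real a)" for q
    proof (cases "0 \<le> q")
      case True
      then have "X (real_of_rat q) \<in> borel_measurable M" by (intro random_variable_X) simp
      then show ?thesis by measurable
    qed simp
    then show ?thesis unfolding D_def pred_def[symmetric] by (intro pred_intros_countable)
  qed
  have "incseq D" by (force simp: incseq_def D_def)
  moreover have "(\<Union>a. D a) = space M"
  proof safe
    fix \<omega> assume w: "\<omega> \<in> space M"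
    obtain b where b: "\<And>s. s \<in> {0..1} \<Longrightarrow> X s \<omega> \<le> b" using bdd_paths[of \<omega> 1] unfolding bdd_above_def by (metis imageI)
    obtain a :: nat where "b \<le> real a" using real_arch_simple by blast
    have "X (real_of_rat q) \<omega> \<le> real a" if "0 \<le> q" "q \<le> 1" for q
      using b[of "real_of_rat q"] that \<open>b \<le> real a\<close> by simp
    then have "\<omega> \<in> D a" using w by (simp add: D_def)
    then show "\<omega> \<in> (\<Union>a. D a)" by blast
  qed (auto simp: D_def)
  ultimately have "(\<lambda>a. prob (D a)) \<longlonglongrightarrow> prob (space M)"
    using finite_Lim_measure_incseq[of D] D by (simp add: image_subset_iff)
  then have "(\<lambda>a. prob (D a)) \<longlonglongrightarrow> 1" by (simp add: prob_space)
  then have "\<forall>\<^sub>F a in sequentially. 1/2 < prob (D a)" by (rule order_tendstoD(1)) simp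
  then obtain a where a: "1/2 < prob (D a)" by (auto simp: eventually_sequentially)
  show ?thesis
  proof (intro exI[of _ "real a"] ballI impI)
    fix s :: real assume s: "s \<in> \<rat>" "0 \<le> s" "s \<le> 1"
    then obtain q where q: "s = real_of_rat q" by (blast elim: Rats_cases)
    have [measurable]: "X s \<in> borel_measurable M" using s by (intro random_variable_X) auto
    have "D a \<subseteq> {\<omega>\<in>space M. X s \<omega> \<le> real a}" using s q by (auto simp: D_def)
    then have "prob (D a) \<le> prob {\<omega>\<in>space M. X s \<omega> \<le> real a}"
      by (rule finite_measure_mono) measurable
    then show "1/2 \<le> prob {\<omega>\<in>space M. X s \<omega> \<le> real a}" using a by simp
  qed
qed

text \<open>An inequality of Ottaviani's type. Stop at the first grid time after \<open>K\<close> with a value below \<open>2\<close>. With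
  probability at least one half the process increases by at most \<open>a\<close> until the next integer time, and
  independently of the past. So low values at grid times force low values at integer times.\<close>

lemma ottaviani_grid:
  assumes a: "\<And>s. s \<in> \<rat> \<Longrightarrow> 0 \<le> s \<Longrightarrow> s \<le> 1 \<Longrightarrow> 1/2 \<le> prob {\<omega>\<in>space M. X s \<omega> \<le> a}"
  shows "prob {\<omega>\<in>space M. \<exists>j\<ge>K * Suc n. X (grid n j) \<omega> < 2}
       \<le> 2 * prob {\<omega>\<in>space M. \<exists>k\<ge>K. X (real k) \<omega> \<le> 2 + a}"
proof -
  have Xm[measurable]: "X (grid n j) \<in> borel_measurable M" "X (real k) \<in> borel_measurable M" for j k
    by (intro random_variable_X; simp)+
  let ?F = "{\<omega>\<in>space M. \<exists>k\<ge>K. X (real k) \<omega> \<le> 2 + a}"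
  \<comment> \<open>the paths in all C j i have their first value below 2 from index K * Suc n on at j\<close>
  define C where "C j i = (if i < K * Suc n then UNIV else if i < j then {2..} else {..<2::real})" for j i :: nat
  define A where "A j = {\<omega>\<in>space M. \<forall>i\<le>j. X (grid n i) \<omega> \<in> C j i}" for j
  \<comment> \<open>the first integer time that is not before the grid time j\<close>
  define next_int where "next_int j = (if j mod Suc n = 0 then j div Suc n else Suc (j div Suc n))" for j :: nat
  define m where "m j = next_int j * Suc n - j" for j
  have mj: "j \<le> next_int j * Suc n" "next_int j * Suc n \<le> j + n" for j
  proof -
    have "j \<le> (if r = 0 then q else Suc q) * Suc n \<and> (if r = 0 then q else Suc q) * Suc n \<le> j + n"
      if "j = q * Suc n + r" "r \<le> n" for q r
      using that by auto
    moreover have "j = j div Suc n * Suc n + j mod Suc n" by (rule div_mult_mod_eq[symmetric])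
    moreover have "j mod Suc n \<le> n" using mod_less_divisor[of "Suc n" j] by linarith
    ultimately show "j \<le> next_int j * Suc n" "next_int j * Suc n \<le> j + n"
      unfolding next_int_def by blast+
  qed
  have K_le: "K \<le> next_int j" if "K * Suc n \<le> j" for j
  proof -
    have "K * Suc n \<le> next_int j * Suc n" using that mj(1)[of j] by linarith
    then show ?thesis by (simp only: mult_le_cancel2 zero_less_Suc simp_thms)
  qed
  define E where "E j = {\<omega>\<in>space M. (\<forall>i\<le>j. X (grid n i) \<omega> \<in> C j i) \<and>
      X (grid n j + grid n (m j)) \<omega> - X (grid n j) \<omega> \<in> {..a}}" for j
  have Cb: "C j i \<in> sets borel" for j i by (simp add: C_def)
  have Am[measurable]: "A j \<in> sets M" for j
    unfolding A_def by (rule grid_event_sets) (auto simp: Cb)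
  have Em[measurable]: "E j \<in> sets M" for j
  proof -
    have [measurable]: "X (grid n j + grid n (m j)) \<in> borel_measurable M"
      by (rule random_variable_X) simp
    have "E j = A j \<inter> {\<omega>\<in>space M. X (grid n j + grid n (m j)) \<omega> - X (grid n j) \<omega> \<in> {..a}}"
      by (auto simp: E_def A_def)
    then show ?thesis by simp
  qed
  have half: "prob (A j) \<le> 2 * prob (E j)" for j
  proof -
    have "prob (E j) = prob (A j) * prob {\<omega>\<in>space M. X (grid n (m j)) \<omega> \<in> {..a}}"
      unfolding E_def A_def by (rule markov_grid) (auto simp: Cb X_zero)
    moreover have "1/2 \<le> prob {\<omega>\<in>space M. X (grid n (m j)) \<omega> \<le> a}"
    proof (rule a)
      show "grid n (m j) \<in> \<rat>" by (simp add: mesh_def)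
      have "m j \<le> n" using mj[of j] by (simp add: m_def)
      then show "grid n (m j) \<le> 1" by (simp add: mesh_def)
    qed simp
    ultimately show ?thesis
      using mult_left_mono[of "1/2" "prob {\<omega>\<in>space M. X (grid n (m j)) \<omega> \<le> a}" "prob (A j)"] by simp
  qed
  let ?j = "\<lambda>i. K * Suc n + i"
  have A_first: "X (grid n (?j i)) \<omega> < 2" if "\<omega> \<in> A (?j i)" for \<omega> i
  proof -
    have "X (grid n (?j i)) \<omega> \<in> C (?j i) (?j i)" using that unfolding A_def by blast
    then show ?thesis by (simp add: C_def)
  qed
  have A_before: "2 \<le> X (grid n (?j i')) \<omega>" if "\<omega> \<in> A (?j i)" "i' < i" for \<omega> i i'
  proof -
    have "?j i' \<le> ?j i" using that(2) by simp
    then have "X (grid n (?j i')) \<omega> \<in> C (?j i) (?j i')" using that(1) unfolding A_def by blast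
    then show ?thesis using that by (simp add: C_def)
  qed
  have disj: "disjoint_family (\<lambda>i. A (?j i))"
    unfolding disjoint_family_on_def
  proof (intro ballI impI)
    fix i i' :: nat assume "i \<noteq> i'"
    then consider "i < i'" | "i' < i" by linarith
    then show "A (?j i) \<inter> A (?j i') = {}"
      using A_first A_before by cases fastforce+
  qed
  have EA: "E j \<subseteq> A j" for j by (auto simp: E_def A_def)
  have disjE: "disjoint_family (\<lambda>i. E (?j i))"
    using disj EA unfolding disjoint_family_on_def by blast
  have "{\<omega>\<in>space M. \<exists>j\<ge>K * Suc n. X (grid n j) \<omega> < 2} \<subseteq> (\<Union>i. A (?j i))"
  proof safe
    fix \<omega> j assume w: "\<omega> \<in> space M" and j: "K * Suc n \<le> j" "X (grid n j) \<omega> < 2"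
    let ?P = "\<lambda>i. X (grid n (?j i)) \<omega> < 2"
    have "?P (j - K * Suc n)" using j by simp
    then have L: "?P (LEAST i. ?P i)" by (rule LeastI)
    define l where "l = (LEAST i. ?P i)"
    have "\<omega> \<in> A (?j l)"
      unfolding A_def
    proof (intro CollectI conjI allI impI w)
      fix i assume i: "i \<le> ?j l"
      consider "i < K * Suc n" | "K * Suc n \<le> i" "i < ?j l" | "i = ?j l"
        using i by linarith
      then show "X (grid n i) \<omega> \<in> C (?j l) i"
      proof cases
        case 1
        then show ?thesis unfolding C_def by (simp only: if_True UNIV_I)
      next
        case 2
        define i' where "i' = i - K * Suc n"
        have i': "i = ?j i'" "i' < l" using 2 unfolding i'_def by linarith+
        then have "\<not> ?P i'" unfolding l_def using not_less_Least[of i' ?P] by blast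
        moreover have "C (?j l) i = {2..}" 
          using 2 unfolding C_def by (simp only: if_True if_not_P[OF leD])
        ultimately show ?thesis using i'(1) by (simp only: atLeast_iff not_less)
      next
        case 3
        have "C (?j l) (?j l) = {..<2}" unfolding C_def by simp
        then show ?thesis using L unfolding 3 l_def by (simp only: lessThan_iff)
      qed
    qed
    then show "\<omega> \<in> (\<Union>i. A (?j i))" by blast
  qed
  then have "emeasure M {\<omega>\<in>space M. \<exists>j\<ge>K * Suc n. X (grid n j) \<omega> < 2} \<le> emeasure M (\<Union>i. A (?j i))"
    by (rule emeasure_mono) auto
  also have "\<dots> = (\<Sum>i. emeasure M (A (?j i)))"
    by (rule suminf_emeasure[symmetric]) (use disj in auto)
  also have "\<dots> \<le> (\<Sum>i. 2 * emeasure M (E (?j i)))"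
  proof (intro suminf_le)
    fix i
    have "ennreal (prob (A (?j i))) \<le> ennreal (2 * prob (E (?j i)))" using half by (rule ennreal_leI)
    then show "emeasure M (A (?j i)) \<le> 2 * emeasure M (E (?j i))"
      by (simp add: emeasure_eq_measure ennreal_mult)
  qed auto
  also have "\<dots> = 2 * (\<Sum>i. emeasure M (E (?j i)))" by simp
  also have "(\<Sum>i. emeasure M (E (?j i))) = emeasure M (\<Union>i. E (?j i))"
    by (rule suminf_emeasure) (use disjE in auto)
  also have "\<dots> \<le> emeasure M ?F"
  proof (rule emeasure_mono)
    show "(\<Union>i. E (?j i)) \<subseteq> ?F"
    proof safe
      fix \<omega> i assume E: "\<omega> \<in> E (?j i)"
      then show "\<omega> \<in> space M" by (simp add: E_def)
      have "X (grid n (?j i)) \<omega> < 2" using A_first E EA by blast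
      moreover have "X (grid n (?j i) + grid n (m (?j i))) \<omega> - X (grid n (?j i)) \<omega> \<le> a"
        using E unfolding E_def by blast
      moreover have "grid n (?j i) + grid n (m (?j i)) = real (next_int (?j i))"
      proof -
        have "?j i + m (?j i) = next_int (?j i) * Suc n" using mj(1)[of "?j i"] unfolding m_def by linarith
        then have "real (?j i) + real (m (?j i)) = real (next_int (?j i)) * real (Suc n)"
          by (metis of_nat_add of_nat_mult)
        then have "(real (?j i) + real (m (?j i))) * mesh n = real (next_int (?j i))"
          by (simp add: mesh_def)
        then show ?thesis by (simp only: distrib_right)
      qed
      ultimately have "X (real (next_int (?j i))) \<omega> \<le> 2 + a" by simp
      then show "\<exists>k\<ge>K. X (real k) \<omega> \<le> 2 + a" using K_le[of "?j i"] by auto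
    qed
  qed measurable
  finally have "emeasure M {\<omega>\<in>space M. \<exists>j\<ge>K * Suc n. X (grid n j) \<omega> < 2} \<le> 2 * emeasure M ?F"
    by (simp add: mult_left_mono)
  then have "ennreal (prob {\<omega>\<in>space M. \<exists>j\<ge>K * Suc n. X (grid n j) \<omega> < 2}) \<le> ennreal (2 * prob ?F)"
    by (simp add: emeasure_eq_measure ennreal_mult)
  then show ?thesis by (simp add: ennreal_le_iff)
qed

text \<open>Along the integers the process tends to infinity, so by the preceding inequality the probability of
  a value below \<open>2\<close> after time \<open>K\<close> vanishes as \<open>K\<close> grows, uniformly over the grids. Right-continuity
  passes from grid times to all times.\<close>

theorem eventually_above_1:
  assumes m: "0 < integral\<^sup>L M (X 1)"
  shows "AE \<omega> in M. \<exists>K. \<forall>t\<ge>K. 1 < X t \<omega>"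
proof -
  have Xm[measurable]: "X (grid n j) \<in> borel_measurable M" "X (real k) \<in> borel_measurable M" for j k n
    by (intro random_variable_X; simp)+
  obtain a where a: "\<And>s. s \<in> \<rat> \<Longrightarrow> 0 \<le> s \<Longrightarrow> s \<le> 1 \<Longrightarrow> 1/2 \<le> prob {\<omega>\<in>space M. X s \<omega> \<le> a}"
    using stochastically_bounded by blast
  define F where "F K = {\<omega>\<in>space M. \<exists>k\<ge>K. X (real k) \<omega> \<le> 2 + a}" for K :: nat
  define E where "E K n = {\<omega>\<in>space M. \<exists>j\<ge>K * Suc n. X (grid n j) \<omega> < 2}" for K n
  define L where "L K = (\<Union>m. \<Inter>n\<in>{m..}. E K n)" for K
  have F[measurable]: "F K \<in> sets M" for K unfolding F_def by measurable
  have E[measurable]: "E K n \<in> sets M" for K n unfolding E_def by measurable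
  have L[measurable]: "L K \<in> sets M" for K unfolding L_def by measurable
  have LF: "prob (L K) \<le> 2 * prob (F K)" for K
  proof -
    have "incseq (\<lambda>m. \<Inter>n\<in>{m..}. E K n)" by (auto simp: incseq_def)
    then have "(\<lambda>m. prob (\<Inter>n\<in>{m..}. E K n)) \<longlonglongrightarrow> prob (L K)"
      unfolding L_def by (intro finite_Lim_measure_incseq) auto
    moreover have "prob (\<Inter>n\<in>{m..}. E K n) \<le> 2 * prob (F K)" for m
    proof -
      have "prob (\<Inter>n\<in>{m..}. E K n) \<le> prob (E K m)" by (intro finite_measure_mono) auto
      also have "\<dots> \<le> 2 * prob (F K)" unfolding E_def F_def by (rule ottaviani_grid[OF a])
      finally show ?thesis .
    qed
    ultimately show ?thesis by (intro LIMSEQ_le_const2) auto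
  qed
  have "decseq F" by (auto simp: decseq_def F_def) (meson order_trans)
  then have "(\<lambda>K. prob (F K)) \<longlonglongrightarrow> prob (\<Inter>K. F K)"
    by (intro finite_Lim_measure_decseq) auto
  moreover have "prob (\<Inter>K. F K) = 0"
  proof -
    have "AE \<omega> in M. \<omega> \<notin> (\<Inter>K. F K)"
      using AE_at_top[OF m]
    proof eventually_elim
      case (elim \<omega>)
      then have "\<forall>\<^sub>F k in sequentially. 2 + a < X (real k) \<omega>"
        by (simp add: filterlim_at_top_dense)
      then obtain K where "\<And>k. k \<ge> K \<Longrightarrow> 2 + a < X (real k) \<omega>" by (auto simp: eventually_sequentially)
      then have "\<omega> \<notin> F K" by (fastforce simp: F_def)
      then show ?case by blast
    qed
    then show ?thesis by (subst prob_eq_0) auto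
  qed
  ultimately have F0: "(\<lambda>K. 2 * prob (F K)) \<longlonglongrightarrow> 0"
    using tendsto_mult_right_zero by fastforce
  have "prob (\<Inter>K. L K) \<le> 0"
  proof (rule LIMSEQ_le_const[OF F0])
    have "prob (\<Inter>K. L K) \<le> 2 * prob (F K)" for K
    proof -
      have "prob (\<Inter>K. L K) \<le> prob (L K)" by (intro finite_measure_mono) auto
      then show ?thesis using LF[of K] by simp
    qed
    then show "\<exists>N. \<forall>n\<ge>N. prob (\<Inter>K. L K) \<le> 2 * prob (F n)" by blast
  qed
  then have "prob (\<Inter>K. L K) = 0" using measure_nonneg[of M "\<Inter>K. L K"] by linarith
  then have "AE \<omega> in M. \<omega> \<notin> (\<Inter>K. L K)" by (subst (asm) prob_eq_0) auto
  with AE_space show ?thesis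
  proof eventually_elim
    case (elim \<omega>)
    then obtain K where K: "\<omega> \<notin> L K" by blast
    have "1 < X t \<omega>" if t: "t \<ge> real K" for t
    proof (rule ccontr)
      assume "\<not> 1 < X t \<omega>"
      then have t2: "X t \<omega> < 2" by simp
      have t0: "0 \<le> t" using t by (meson of_nat_0_le_iff order_trans)
      have "(\<lambda>n. X (grid n (next_idx n t)) \<omega>) \<longlonglongrightarrow> X t \<omega>"
        by (rule right_cont_grid[OF rc t0])
      from order_tendstoD(2)[OF this t2]
      obtain m where m: "\<And>n. n \<ge> m \<Longrightarrow> X (grid n (next_idx n t)) \<omega> < 2"
        by (auto simp: eventually_sequentially)
      have "\<omega> \<in> E K n" if "n \<ge> m" for n
      proof -
        have "real K < grid n (next_idx n t)" using next_idx_bounds(1)[OF t0, of n] t by linarith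
        then have "real K * real (Suc n) < real (next_idx n t)" by (simp add: mesh_def field_simps)
        then have "K * Suc n \<le> next_idx n t" by (metis of_nat_less_iff of_nat_mult less_imp_le)
        then show ?thesis unfolding E_def using m[OF that] elim(1) by blast
      qed
      then have "\<omega> \<in> (\<Inter>n\<in>{m..}. E K n)" by (intro INT_I) (simp only: atLeast_iff)
      then have "\<omega> \<in> L K" unfolding L_def by blast
      with K show False by simp
    qed
    then show ?case by blast
  qed
qed

end

section \<open>Time spent at a single level\<close>

context transient_path
begin

definition passage :: "real \<Rightarrow> real" where
  "passage x = Inf {t. 0 \<le> t \<and> x < f t}"

definition passage_idx :: "real \<Rightarrow> nat \<Rightarrow> nat" where
  "passage_idx x n = (LEAST j. x < f (grid n j))"

context
  fixes x :: real assumes x: "0 \<le> x" "x \<le> 1"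
begin

lemma passage_nonempty: "{t. 0 \<le> t \<and> x < f t} \<noteq> {}"
proof -
  obtain K where "\<forall>t\<ge>K. 1 < f t" using transient by blast
  then have "1 < f (max 0 K)" by simp
  then have "max 0 K \<in> {t. 0 \<le> t \<and> x < f t}" using x by simp
  then show ?thesis by blast
qed

lemma passage_bdd: "bdd_below {t. 0 \<le> t \<and> x < f t}"
  by (rule bdd_belowI[of _ 0]) simp

lemma passage_nonneg: "0 \<le> passage x"
  unfolding passage_def by (rule cInf_greatest[OF passage_nonempty]) simp

lemma before_passage: "0 \<le> t \<Longrightarrow> t < passage x \<Longrightarrow> f t \<le> x"
  using cInf_lower[OF _ passage_bdd, of t] unfolding passage_def by fastforce

lemma after_passage:
  assumes "passage x < b"
  obtains t where "passage x \<le> t" "t < b" "x < f t"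
proof -
  obtain t where "t \<in> {t. 0 \<le> t \<and> x < f t}" "t < b"
    using cInf_lessD[OF passage_nonempty] assms unfolding passage_def by blast
  moreover then have "passage x \<le> t" unfolding passage_def by (intro cInf_lower passage_bdd)
  ultimately show ?thesis using that by blast
qed

text \<open>A path without upward jumps hits the level when it first passes it.\<close>

lemma at_passage: "f (passage x) = x"
proof (rule antisym)
  show "f (passage x) \<le> x"
  proof (cases "passage x = 0")
    case False
    then have pos: "0 < passage x" using passage_nonneg by simp
    have "\<forall>\<^sub>F r in at_left (passage x). f r \<le> x"
      unfolding eventually_at_left_field using pos before_passage by (intro exI[of _ 0]) auto
    then show ?thesis
      by (intro left_le[OF pos] eventually_frequently) (auto simp: trivial_limit_at_left_real)
  qed (use x zero in simp)
  show "x \<le> f (passage x)"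
  proof (rule ccontr)
    assume "\<not> x \<le> f (passage x)"
    then obtain b where b: "passage x < b" "\<And>s. passage x \<le> s \<Longrightarrow> s < b \<Longrightarrow> f s < x"
      using right_cont_nbhd[OF right_cont passage_nonneg, of x] by auto
    obtain t where "passage x \<le> t" "t < b" "x < f t" by (rule after_passage[OF b(1)])
    then show False using b(2)[of t] by simp
  qed
qed

lemma passage_idx: "x < f (grid n (passage_idx x n))" "j < passage_idx x n \<Longrightarrow> f (grid n j) \<le> x"
proof -
  have "x < f (grid n (Suc (last_idx n x)))"
    by (rule last_idx_after[OF x(2)]) simp
  then show "x < f (grid n (passage_idx x n))"
    unfolding passage_idx_def by (rule LeastI)
  show "j < passage_idx x n \<Longrightarrow> f (grid n j) \<le> x"
    unfolding passage_idx_def using not_less_Least by fastforce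
qed

lemma passage_idx_filterlim:
  "filterlim (\<lambda>n. grid n (passage_idx x n)) (at_right (passage x)) sequentially"
proof -
  have gt: "passage x < grid n (passage_idx x n)" for n
  proof -
    have "passage x \<le> grid n (passage_idx x n)"
      unfolding passage_def using passage_idx(1) by (intro cInf_lower passage_bdd) simp
    moreover have "grid n (passage_idx x n) \<noteq> passage x"
      using passage_idx(1)[of n] at_passage by fastforce
    ultimately show ?thesis by simp
  qed
  have "(\<lambda>n. grid n (passage_idx x n)) \<longlonglongrightarrow> passage x"
  proof (rule order_tendstoI)
    fix b assume "passage x < b"
    then obtain t where t: "passage x \<le> t" "t < b" "x < f t" by (rule after_passage)
    have t0: "0 \<le> t" using t passage_nonneg by linarith
    have "\<forall>\<^sub>F n in sequentially. x < f (grid n (next_idx n t))"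
      by (rule order_tendstoD(1)[OF right_cont_grid[OF right_cont t0] t(3)])
    moreover have "\<forall>\<^sub>F n in sequentially. mesh n < b - t" using t by (intro eventually_mesh_less) simp
    ultimately show "\<forall>\<^sub>F n in sequentially. grid n (passage_idx x n) < b"
    proof eventually_elim
      case (elim n)
      have "passage_idx x n \<le> next_idx n t"
        unfolding passage_idx_def by (rule Least_le) (rule elim(1))
      then have "grid n (passage_idx x n) \<le> grid n (next_idx n t)"
        by (intro mult_right_mono) auto
      then show ?case using next_idx_bounds(2)[OF t0, of n] elim(2) by linarith
    qed
  next
    fix a assume "a < passage x"
    then show "\<forall>\<^sub>F n in sequentially. a < grid n (passage_idx x n)"
      using gt by (intro always_eventually allI) (rule less_trans)
  qed
  then show ?thesis
    using gt by (auto simp: filterlim_at intro!: always_eventually less_imp_neq[symmetric])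
qed

lemma shifted_grid_limit:
  assumes "0 \<le> s"
  shows "(\<lambda>n. f (grid n (passage_idx x n) + s)) \<longlonglongrightarrow> f (passage x + s)"
proof -
  have "filterlim (\<lambda>n. grid n (passage_idx x n) + s) (at_right (passage x + s)) sequentially"
    using passage_idx_filterlim
    by (auto simp: filterlim_at elim: eventually_mono intro: tendsto_add)
  moreover have "(f \<longlongrightarrow> f (passage x + s)) (at_right (passage x + s))"
    using right_cont passage_nonneg assms unfolding right_cont_def by simp
  ultimately show ?thesis by (rule filterlim_compose[rotated])
qed

end

lemma passage_mono: "0 \<le> x \<Longrightarrow> x \<le> y \<Longrightarrow> y \<le> 1 \<Longrightarrow> passage x \<le> passage y"
  unfolding passage_def[of x] passage_def[of y]
  by (rule cInf_superset_mono[OF passage_nonempty passage_bdd]) auto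

end

context transient_levy
begin

sublocale rc_levy M X
proof
  fix \<omega> t
  interpret transient_path "\<lambda>t. X t \<omega>" by (rule path)
  show "right_cont (\<lambda>t. X t \<omega>)" by (rule right_cont)
  show "X 0 \<omega> = 0" by (rule zero)
  show "bdd_above ((\<lambda>s. X s \<omega>) ` {0..t})" by (rule bdd)
qed

text \<open>Right-continuous processes are limits of step processes along the grid.\<close>

lemma joint_measurable:
  "(\<lambda>(s, \<omega>). X (max 0 s) \<omega>) \<in> borel_measurable (borel \<Otimes>\<^sub>M M)"
proof (rule borel_measurable_LIMSEQ_real)
  fix z :: "real \<times> 'a"
  show "(\<lambda>n. (case z of (s, \<omega>) \<Rightarrow> X (grid n (next_idx n (max 0 s))) \<omega>)) \<longlonglongrightarrow> (case z of (s, \<omega>) \<Rightarrow> X (max 0 s) \<omega>)"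
    using right_cont_grid[OF rc, of "max 0 (fst z)"] by (simp add: split_beta')
next
  fix n
  have g: "(\<lambda>z :: real \<times> 'a. next_idx n (max 0 (fst z))) \<in> measurable (borel \<Otimes>\<^sub>M M) (count_space UNIV)"
    unfolding next_idx_def by measurable
  have "(\<lambda>z. X (grid n (next_idx n (max 0 (fst z)))) (snd z)) \<in> borel_measurable (borel \<Otimes>\<^sub>M M)"
  proof (rule measurable_compose_countable[OF _ g])
    fix j
    show "(\<lambda>z. X (grid n j) (snd z)) \<in> borel_measurable (borel \<Otimes>\<^sub>M M)"
      by (rule measurable_compose[OF measurable_snd random_variable_X]) simp
  qed
  then show "(\<lambda>(s, \<omega>). X (grid n (next_idx n (max 0 s))) \<omega>) \<in> borel_measurable (borel \<Otimes>\<^sub>M M)"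
    by (simp add: split_beta')
qed

lemma joint_compose:
  assumes "T \<in> borel_measurable N" "W \<in> measurable N M" "\<And>z. z \<in> space N \<Longrightarrow> 0 \<le> T z"
  shows "(\<lambda>z. X (T z) (W z)) \<in> borel_measurable N"
proof -
  have "(\<lambda>z. (T z, W z)) \<in> measurable N (borel \<Otimes>\<^sub>M M)" using assms(1,2) by measurable
  from measurable_compose[OF this joint_measurable]
  have "(\<lambda>z. X (max 0 (T z)) (W z)) \<in> borel_measurable N" by simp
  then show ?thesis
    by (rule measurable_cong[THEN iffD1, rotated]) (use assms(3) in auto)
qed

definition \<tau> :: "real \<Rightarrow> 'a \<Rightarrow> real" where
  "\<tau> x \<omega> = transient_path.passage (\<lambda>t. X t \<omega>) x"

definition \<tau>_idx :: "real \<Rightarrow> nat \<Rightarrow> 'a \<Rightarrow> nat" where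
  "\<tau>_idx x n \<omega> = transient_path.passage_idx (\<lambda>t. X t \<omega>) x n"

lemma \<tau>_idx_measurable [measurable]: "\<tau>_idx x n \<in> measurable M (count_space UNIV)"
proof -
  have [measurable]: "X (grid n j) \<in> borel_measurable M" for j
    by (rule random_variable_X) simp
  have "(\<lambda>\<omega>. LEAST j. x < X (grid n j) \<omega>) \<in> measurable M (count_space UNIV)" by measurable
  moreover have "\<tau>_idx x n = (\<lambda>\<omega>. LEAST j. x < X (grid n j) \<omega>)"
    by (rule ext) (simp add: \<tau>_idx_def transient_path.passage_idx_def[OF path])
  ultimately show ?thesis by simp
qed

context
  fixes x :: real assumes x: "0 \<le> x" "x \<le> 1"
begin

lemma \<tau>_facts:
  shows "0 \<le> \<tau> x \<omega>" "X (\<tau> x \<omega>) \<omega> = x"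
    "(\<lambda>n. grid n (\<tau>_idx x n \<omega>)) \<longlonglongrightarrow> \<tau> x \<omega>"
    "0 \<le> s \<Longrightarrow> (\<lambda>n. X (grid n (\<tau>_idx x n \<omega>) + s) \<omega>) \<longlonglongrightarrow> X (\<tau> x \<omega> + s) \<omega>"
    "x < X (grid n (\<tau>_idx x n \<omega>)) \<omega>" "j < \<tau>_idx x n \<omega> \<Longrightarrow> X (grid n j) \<omega> \<le> x"
proof -
  interpret transient_path "\<lambda>t. X t \<omega>" by (rule path)
  show "0 \<le> \<tau> x \<omega>" unfolding \<tau>_def by (rule passage_nonneg[OF x])
  show "X (\<tau> x \<omega>) \<omega> = x" unfolding \<tau>_def by (rule at_passage[OF x])
  show "(\<lambda>n. grid n (\<tau>_idx x n \<omega>)) \<longlonglongrightarrow> \<tau> x \<omega>"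
    unfolding \<tau>_def \<tau>_idx_def using passage_idx_filterlim[OF x] by (simp add: filterlim_at)
  show "0 \<le> s \<Longrightarrow> (\<lambda>n. X (grid n (\<tau>_idx x n \<omega>) + s) \<omega>) \<longlonglongrightarrow> X (\<tau> x \<omega> + s) \<omega>"
    unfolding \<tau>_def \<tau>_idx_def by (rule shifted_grid_limit[OF x])
  show "x < X (grid n (\<tau>_idx x n \<omega>)) \<omega>" "j < \<tau>_idx x n \<omega> \<Longrightarrow> X (grid n j) \<omega> \<le> x"
    unfolding \<tau>_idx_def using passage_idx[OF x] by auto
qed

lemma \<tau>_measurable [measurable]: "\<tau> x \<in> borel_measurable M"
proof (rule borel_measurable_LIMSEQ_real)
  show "(\<lambda>n. grid n (\<tau>_idx x n \<omega>)) \<longlonglongrightarrow> \<tau> x \<omega>" for \<omega> by (rule \<tau>_facts)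
  show "(\<lambda>\<omega>. grid n (\<tau>_idx x n \<omega>)) \<in> borel_measurable M" for n by measurable
qed

lemma after_\<tau>_measurable: "0 \<le> s \<Longrightarrow> (\<lambda>\<omega>. X (\<tau> x \<omega> + s) \<omega>) \<in> borel_measurable M"
  using \<tau>_facts(1) by (intro joint_compose) auto

text \<open>Decompose according to the value of the passage index and use the simple Markov property.\<close>

lemma strong_markov_grid:
  assumes s: "0 \<le> s"
  shows "emeasure M {\<omega>\<in>space M. X (grid n (\<tau>_idx x n \<omega>) + s) \<omega> - X (grid n (\<tau>_idx x n \<omega>)) \<omega> \<noteq> 0}
       = emeasure M {\<omega>\<in>space M. X s \<omega> \<noteq> 0}"
proof -
  define C where "C j i = (if i < j then {..x} else {x<..})" for i j :: nat
  have Cb: "C j i \<in> sets borel" for i j by (simp add: C_def)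
  define A where "A j = {\<omega>\<in>space M. \<forall>i\<le>j. X (grid n i) \<omega> \<in> C j i}" for j
  have A_eq: "A j = {\<omega>\<in>space M. \<tau>_idx x n \<omega> = j}" for j
  proof (intro set_eqI iffI)
    fix \<omega> assume "\<omega> \<in> A j"
    then have w: "\<omega> \<in> space M" and *: "\<And>i. i \<le> j \<Longrightarrow> X (grid n i) \<omega> \<in> C j i" by (auto simp: A_def)
    have "\<not> \<tau>_idx x n \<omega> < j" using *[of "\<tau>_idx x n \<omega>"] \<tau>_facts(5)[of n \<omega>] by (auto simp: C_def)
    moreover have "\<not> j < \<tau>_idx x n \<omega>" using *[of j] \<tau>_facts(6)[of j n \<omega>] by (auto simp: C_def)
    ultimately show "\<omega> \<in> {\<omega>\<in>space M. \<tau>_idx x n \<omega> = j}" using w by simp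
  next
    fix \<omega> assume w: "\<omega> \<in> {\<omega>\<in>space M. \<tau>_idx x n \<omega> = j}"
    have "X (grid n i) \<omega> \<in> C j i" if "i \<le> j" for i
      using \<tau>_facts(5)[of n \<omega>] \<tau>_facts(6)[of i n \<omega>] w that by (cases "i = j") (auto simp: C_def)
    then show "\<omega> \<in> A j" using w by (simp add: A_def)
  qed
  have Am[measurable]: "A j \<in> sets M" for j unfolding A_def by (rule grid_event_sets) (auto simp: Cb)
  define E where "E j = {\<omega>\<in>space M. (\<forall>i\<le>j. X (grid n i) \<omega> \<in> C j i) \<and> X (grid n j + s) \<omega> - X (grid n j) \<omega> \<in> - {0}}" for j
  have Em[measurable]: "E j \<in> sets M" for j
  proof -
    have [measurable]: "X (grid n j + s) \<in> borel_measurable M" "X (grid n j) \<in> borel_measurable M"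
      by (rule random_variable_X, use s in simp)+
    have "E j = A j \<inter> {\<omega>\<in>space M. X (grid n j + s) \<omega> - X (grid n j) \<omega> \<noteq> 0}"
      by (auto simp: E_def A_def)
    then show ?thesis by simp
  qed
  have E_eq: "E j = {\<omega>\<in>space M. \<tau>_idx x n \<omega> = j \<and> X (grid n j + s) \<omega> - X (grid n j) \<omega> \<noteq> 0}" for j
  proof -
    have "E j = A j \<inter> {\<omega>\<in>space M. X (grid n j + s) \<omega> - X (grid n j) \<omega> \<noteq> 0}"
      by (auto simp: E_def A_def)
    then show ?thesis unfolding A_eq by blast
  qed
  have prod: "emeasure M (E j) = emeasure M (A j) * emeasure M {\<omega>\<in>space M. X s \<omega> \<noteq> 0}" for j
  proof -
    have "prob (E j) = prob (A j) * prob {\<omega>\<in>space M. X s \<omega> \<in> - {0}}"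
      unfolding E_def A_def by (rule markov_grid) (auto simp: s Cb X_zero)
    then show ?thesis by (simp add: emeasure_eq_measure ennreal_mult)
  qed
  have "{\<omega>\<in>space M. X (grid n (\<tau>_idx x n \<omega>) + s) \<omega> - X (grid n (\<tau>_idx x n \<omega>)) \<omega> \<noteq> 0} = (\<Union>j. E j)"
    unfolding E_eq by blast
  then have "emeasure M {\<omega>\<in>space M. X (grid n (\<tau>_idx x n \<omega>) + s) \<omega> - X (grid n (\<tau>_idx x n \<omega>)) \<omega> \<noteq> 0}
      = emeasure M (\<Union>j. E j)" by (simp only:)
  also have "\<dots> = (\<Sum>j. emeasure M (E j))"
  proof (rule suminf_emeasure[symmetric])
    show "range E \<subseteq> sets M" using Em by blast
    show "disjoint_family E" unfolding disjoint_family_on_def E_eq by blast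
  qed
  also have "\<dots> = (\<Sum>j. emeasure M (A j)) * emeasure M {\<omega>\<in>space M. X s \<omega> \<noteq> 0}"
    unfolding prod by simp
  also have "(\<Sum>j. emeasure M (A j)) = emeasure M (\<Union>j. A j)"
  proof (rule suminf_emeasure)
    show "range A \<subseteq> sets M" using Am by blast
    show "disjoint_family A" unfolding disjoint_family_on_def A_eq by blast
  qed
  also have "(\<Union>j. A j) = space M" unfolding A_eq by blast
  finally show ?thesis by (simp add: emeasure_space_1)
qed

text \<open>The increment after the grid passage time converges to the increment after the passage time. Being
  different from \<open>0\<close> is an open condition, so its probability can only drop in the limit.\<close>

lemma strong_markov_level:
  assumes s: "0 \<le> s"
  shows "emeasure M {\<omega>\<in>space M. X s \<omega> = 0} \<le> emeasure M {\<omega>\<in>space M. X (\<tau> x \<omega> + s) \<omega> = x}"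
proof -
  have Xs[measurable]: "X s \<in> borel_measurable M" using s by (rule random_variable_X)
  have Y[measurable]: "(\<lambda>\<omega>. X (\<tau> x \<omega> + s) \<omega>) \<in> borel_measurable M" by (rule after_\<tau>_measurable[OF s])
  define Yn where "Yn n \<omega> = X (grid n (\<tau>_idx x n \<omega>) + s) \<omega> - X (grid n (\<tau>_idx x n \<omega>)) \<omega>" for n \<omega>
  have Ynm[measurable]: "Yn n \<in> borel_measurable M" for n
    unfolding Yn_def[abs_def] using s by (intro borel_measurable_diff joint_compose) (auto intro: add_nonneg_nonneg)
  have lim: "(\<lambda>n. Yn n \<omega>) \<longlonglongrightarrow> X (\<tau> x \<omega> + s) \<omega> - x" for \<omega>
    unfolding Yn_def using tendsto_diff[OF \<tau>_facts(4)[OF s] \<tau>_facts(4)[OF order_refl]] by (simp add: \<tau>_facts(2))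
  let ?U = "{\<omega>\<in>space M. X (\<tau> x \<omega> + s) \<omega> \<noteq> x}" and ?Un = "\<lambda>n. {\<omega>\<in>space M. Yn n \<omega> \<noteq> 0}"
  have "emeasure M ?U = (\<integral>\<^sup>+\<omega>. indicator ?U \<omega> \<partial>M)" by simp
  also have "\<dots> \<le> (\<integral>\<^sup>+\<omega>. liminf (\<lambda>n. indicator (?Un n) \<omega>) \<partial>M)"
  proof (rule nn_integral_mono)
    fix \<omega> assume w: "\<omega> \<in> space M"
    show "indicator ?U \<omega> \<le> liminf (\<lambda>n. indicator (?Un n) \<omega> :: ennreal)"
    proof (cases "\<omega> \<in> ?U")
      case True
      then have "\<forall>\<^sub>F n in sequentially. Yn n \<omega> \<noteq> 0"
        by (intro tendsto_imp_eventually_ne[OF lim]) simp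
      then have "\<forall>\<^sub>F n in sequentially. indicator ?U \<omega> \<le> (indicator (?Un n) \<omega> :: ennreal)"
        by eventually_elim (use w in \<open>simp add: indicator_def\<close>)
      then show ?thesis by (rule Liminf_bounded)
    qed simp
  qed
  also have "\<dots> \<le> liminf (\<lambda>n. \<integral>\<^sup>+\<omega>. indicator (?Un n) \<omega> \<partial>M)"
    by (rule nn_integral_liminf) measurable
  also have "\<dots> = liminf (\<lambda>n. emeasure M (?Un n))" by simp
  also have "\<dots> = emeasure M {\<omega>\<in>space M. X s \<omega> \<noteq> 0}"
    unfolding Yn_def strong_markov_grid[OF s] by (simp add: Liminf_const)
  finally have le: "emeasure M ?U \<le> emeasure M {\<omega>\<in>space M. X s \<omega> \<noteq> 0}" .
  have "prob {\<omega>\<in>space M. X (\<tau> x \<omega> + s) \<omega> = x} = 1 - prob ?U"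
  proof -
    have "space M - ?U = {\<omega>\<in>space M. X (\<tau> x \<omega> + s) \<omega> = x}" by blast
    then show ?thesis using prob_compl[of ?U] by simp
  qed
  moreover have "prob {\<omega>\<in>space M. X s \<omega> = 0} = 1 - prob {\<omega>\<in>space M. X s \<omega> \<noteq> 0}"
  proof -
    have "space M - {\<omega>\<in>space M. X s \<omega> \<noteq> 0} = {\<omega>\<in>space M. X s \<omega> = 0}" by blast
    then show ?thesis using prob_compl[of "{\<omega>\<in>space M. X s \<omega> \<noteq> 0}"] by simp
  qed
  ultimately show ?thesis using le by (simp add: emeasure_eq_measure ennreal_le_iff)
qed

end

definition occupied :: "real \<Rightarrow> real \<Rightarrow> ennreal" where
  "occupied T x = (\<integral>\<^sup>+\<omega>. emeasure lborel {t. 0 \<le> t \<and> t \<le> T \<and> X t \<omega> = x} \<partial>M)"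

lemma level_sets: "{t. 0 \<le> t \<and> t \<le> T \<and> X t \<omega> = x} \<in> sets borel"
  using right_cont_sets[OF rc, of "{x}" T \<omega>] by simp

lemma ind_joint_measurable:
  assumes "\<And>\<omega>. \<omega> \<in> space M \<Longrightarrow> 0 \<le> S \<omega>" "S \<in> borel_measurable M"
  shows "(\<lambda>(s, \<omega>). indicator {s. 0 \<le> s \<and> s \<le> T \<and> X (S \<omega> + s) \<omega> = x} s :: ennreal) \<in> borel_measurable (lborel \<Otimes>\<^sub>M M)"
proof -
  note [measurable] = assms(2)
  have [measurable]: "(\<lambda>z. X (S (snd z) + max 0 (fst z)) (snd z)) \<in> borel_measurable (lborel \<Otimes>\<^sub>M M)"
  proof (rule joint_compose)
    show "(\<lambda>z. S (snd z) + max 0 (fst z)) \<in> borel_measurable (lborel \<Otimes>\<^sub>M M)" by measurable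
    show "0 \<le> S (snd z) + max 0 (fst z)" if "z \<in> space (lborel \<Otimes>\<^sub>M M)" for z
      using that assms(1)[of "snd z"] by (auto simp: space_pair_measure)
  qed simp
  have "(\<lambda>(s, \<omega>). indicator {s. 0 \<le> s \<and> s \<le> T \<and> X (S \<omega> + s) \<omega> = x} s :: ennreal)
      = (\<lambda>z. if 0 \<le> fst z \<and> fst z \<le> T \<and> X (S (snd z) + max 0 (fst z)) (snd z) = x then 1 else 0)"
    by (auto simp: fun_eq_iff indicator_def max_def)
  also have "\<dots> \<in> borel_measurable (lborel \<Otimes>\<^sub>M M)" by measurable
  finally show ?thesis .
qed

lemma occupation_fubini:
  assumes S: "\<And>\<omega>. \<omega> \<in> space M \<Longrightarrow> 0 \<le> S \<omega>" "S \<in> borel_measurable M"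
    and sets: "\<And>\<omega>. {s. 0 \<le> s \<and> s \<le> T \<and> X (S \<omega> + s) \<omega> = x} \<in> sets borel"
  shows "(\<integral>\<^sup>+\<omega>. emeasure lborel {s. 0 \<le> s \<and> s \<le> T \<and> X (S \<omega> + s) \<omega> = x} \<partial>M)
       = (\<integral>\<^sup>+s. indicator {0..T} s * emeasure M {\<omega>\<in>space M. X (S \<omega> + s) \<omega> = x} \<partial>lborel)"
    "(\<lambda>\<omega>. emeasure lborel {s. 0 \<le> s \<and> s \<le> T \<and> X (S \<omega> + s) \<omega> = x}) \<in> borel_measurable M"
proof -
  interpret pair_sigma_finite lborel M by unfold_locales
  let ?f = "\<lambda>s \<omega>. indicator {s. 0 \<le> s \<and> s \<le> T \<and> X (S \<omega> + s) \<omega> = x} s :: ennreal"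
  note m = ind_joint_measurable[OF S, of T x]
  have eq: "emeasure lborel {s. 0 \<le> s \<and> s \<le> T \<and> X (S \<omega> + s) \<omega> = x} = (\<integral>\<^sup>+s. ?f s \<omega> \<partial>lborel)" for \<omega>
    using sets by simp
  have Sm: "(\<lambda>\<omega>. X (S \<omega> + s) \<omega>) \<in> borel_measurable M" if "0 \<le> s" for s
    using S that by (intro joint_compose) (auto intro: add_nonneg_nonneg)
  have "(\<integral>\<^sup>+\<omega>. \<integral>\<^sup>+s. ?f s \<omega> \<partial>lborel \<partial>M) = (\<integral>\<^sup>+s. \<integral>\<^sup>+\<omega>. ?f s \<omega> \<partial>M \<partial>lborel)"
    using Fubini[OF m] by simp
  also have "\<dots> = (\<integral>\<^sup>+s. indicator {0..T} s * emeasure M {\<omega>\<in>space M. X (S \<omega> + s) \<omega> = x} \<partial>lborel)"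
  proof (rule nn_integral_cong)
    fix s :: real
    show "(\<integral>\<^sup>+\<omega>. ?f s \<omega> \<partial>M) = indicator {0..T} s * emeasure M {\<omega>\<in>space M. X (S \<omega> + s) \<omega> = x}"
    proof (cases "s \<in> {0..T}")
      case True
      then have s: "0 \<le> s" by simp
      have [measurable]: "(\<lambda>\<omega>. X (S \<omega> + s) \<omega>) \<in> borel_measurable M" by (rule Sm[OF s])
      have "(\<integral>\<^sup>+\<omega>. ?f s \<omega> \<partial>M) = (\<integral>\<^sup>+\<omega>. indicator {\<omega>\<in>space M. X (S \<omega> + s) \<omega> = x} \<omega> \<partial>M)"
        using True by (intro nn_integral_cong) (auto simp: indicator_def)
      also have "\<dots> = emeasure M {\<omega>\<in>space M. X (S \<omega> + s) \<omega> = x}" by (rule nn_integral_indicator) measurable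
      finally show ?thesis using True by simp
    next
      case False
      then have "?f s \<omega> = 0" for \<omega> by (auto simp: indicator_def)
      then show ?thesis using False by simp
    qed
  qed
  finally show "(\<integral>\<^sup>+\<omega>. emeasure lborel {s. 0 \<le> s \<and> s \<le> T \<and> X (S \<omega> + s) \<omega> = x} \<partial>M)
       = (\<integral>\<^sup>+s. indicator {0..T} s * emeasure M {\<omega>\<in>space M. X (S \<omega> + s) \<omega> = x} \<partial>lborel)"
    unfolding eq .
  show "(\<lambda>\<omega>. emeasure lborel {s. 0 \<le> s \<and> s \<le> T \<and> X (S \<omega> + s) \<omega> = x}) \<in> borel_measurable M"
  proof -
    have "(\<lambda>(\<omega>, s). ?f s \<omega>) \<in> borel_measurable (M \<Otimes>\<^sub>M lborel)"
      using measurable_pair_swap[OF m] unfolding prod.case .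
    then show ?thesis
      unfolding eq by (rule lborel.borel_measurable_nn_integral)
  qed
qed

lemma shifted_level_sets:
  assumes "0 \<le> a"
  shows "{s. 0 \<le> s \<and> s \<le> T \<and> X (a + s) \<omega> = x} \<in> sets borel"
    and "a + T \<le> T' \<Longrightarrow> emeasure lborel {s. 0 \<le> s \<and> s \<le> T \<and> X (a + s) \<omega> = x}
      \<le> emeasure lborel {t. 0 \<le> t \<and> t \<le> T' \<and> X t \<omega> = x}"
proof -
  let ?B = "{t. 0 \<le> t \<and> t \<le> a + T \<and> X t \<omega> = x} \<inter> {a..}"
  have B: "?B \<in> sets borel" using level_sets by (intro sets.Int) auto
  have eq: "{s. 0 \<le> s \<and> s \<le> T \<and> X (a + s) \<omega> = x} = (\<lambda>s. a + s) -` ?B"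
    using assms by auto
  have m: "(\<lambda>s. a + s) \<in> borel_measurable borel" and m': "(\<lambda>s. a + s) \<in> borel_measurable lborel"
    by measurable
  show "{s. 0 \<le> s \<and> s \<le> T \<and> X (a + s) \<omega> = x} \<in> sets borel"
    unfolding eq using measurable_sets[OF m B] unfolding space_borel Int_UNIV_right .
  assume T': "a + T \<le> T'"
  have "emeasure lborel ((\<lambda>s. a + s) -` ?B) = emeasure (distr lborel borel (\<lambda>s. a + s)) ?B"
    using emeasure_distr[OF m' B] unfolding space_lborel space_borel Int_UNIV_right by (rule sym)
  also have "\<dots> = emeasure lborel ?B"
    unfolding lborel_distr_plus ..
  also have "\<dots> \<le> emeasure lborel {t. 0 \<le> t \<and> t \<le> T' \<and> X t \<omega> = x}"
    using T' level_sets by (intro emeasure_mono) auto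
  finally show "emeasure lborel {s. 0 \<le> s \<and> s \<le> T \<and> X (a + s) \<omega> = x}
      \<le> emeasure lborel {t. 0 \<le> t \<and> t \<le> T' \<and> X t \<omega> = x}"
    unfolding eq .
qed

lemma level_measurable:
  "(\<lambda>\<omega>. emeasure lborel {t. 0 \<le> t \<and> t \<le> T \<and> X t \<omega> = x}) \<in> borel_measurable M"
proof -
  have "(\<lambda>\<omega>. emeasure lborel {t. 0 \<le> t \<and> t \<le> T \<and> X (0 + t) \<omega> = x}) \<in> borel_measurable M"
  proof (rule occupation_fubini(2))
    show "{t. 0 \<le> t \<and> t \<le> T \<and> X (0 + t) \<omega> = x} \<in> sets borel" for \<omega>
      unfolding add_0 by (rule level_sets)
  qed (rule order_refl, rule borel_measurable_const)
  then show ?thesis unfolding add_0 .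
qed

text \<open>After hitting \<open>x\<close> the process spends at least as much time at \<open>x\<close> as it spent at \<open>0\<close> from the
  beginning. The last term accounts for a late passage; it is uniform in \<open>x\<close> because levels up to \<open>1\<close>
  are passed no later than \<open>1\<close>.\<close>

lemma level_comparison:
  assumes x: "0 \<le> x" "x \<le> 1" and T: "0 \<le> T" "0 \<le> T'"
  shows "occupied T 0 \<le> occupied (T' + T) x + ennreal T * emeasure M {\<omega>\<in>space M. T' < \<tau> 1 \<omega>}"
proof -
  have [measurable]: "\<tau> 1 \<in> borel_measurable M" by (rule \<tau>_measurable) auto
  have "occupied T 0 = (\<integral>\<^sup>+s. indicator {0..T} s * emeasure M {\<omega>\<in>space M. X s \<omega> = 0} \<partial>lborel)"
  proof -
    have "(\<integral>\<^sup>+\<omega>. emeasure lborel {s. 0 \<le> s \<and> s \<le> T \<and> X (0 + s) \<omega> = 0} \<partial>M)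
        = (\<integral>\<^sup>+s. indicator {0..T} s * emeasure M {\<omega>\<in>space M. X (0 + s) \<omega> = 0} \<partial>lborel)"
    proof (rule occupation_fubini(1))
      show "{s. 0 \<le> s \<and> s \<le> T \<and> X (0 + s) \<omega> = 0} \<in> sets borel" for \<omega>
        unfolding add_0 by (rule level_sets)
    qed (rule order_refl, rule borel_measurable_const)
    then show ?thesis unfolding add_0 occupied_def .
  qed
  also have "\<dots> \<le> (\<integral>\<^sup>+s. indicator {0..T} s * emeasure M {\<omega>\<in>space M. X (\<tau> x \<omega> + s) \<omega> = x} \<partial>lborel)"
    using strong_markov_level[OF x] by (intro nn_integral_mono) (auto simp: indicator_def)
  also have "\<dots> = (\<integral>\<^sup>+\<omega>. emeasure lborel {s. 0 \<le> s \<and> s \<le> T \<and> X (\<tau> x \<omega> + s) \<omega> = x} \<partial>M)"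
    by (rule occupation_fubini(1)[symmetric, OF \<tau>_facts(1)[OF x] \<tau>_measurable[OF x]
          shifted_level_sets(1)[OF \<tau>_facts(1)[OF x]]])
  also have "\<dots> \<le> (\<integral>\<^sup>+\<omega>. emeasure lborel {t. 0 \<le> t \<and> t \<le> T' + T \<and> X t \<omega> = x}
      + ennreal T * indicator {\<omega>\<in>space M. T' < \<tau> 1 \<omega>} \<omega> \<partial>M)"
  proof (rule nn_integral_mono)
    fix \<omega> assume w: "\<omega> \<in> space M"
    interpret transient_path "\<lambda>t. X t \<omega>" by (rule path)
    have le: "\<tau> x \<omega> \<le> \<tau> 1 \<omega>" unfolding \<tau>_def using x by (intro passage_mono) auto
    show "emeasure lborel {s. 0 \<le> s \<and> s \<le> T \<and> X (\<tau> x \<omega> + s) \<omega> = x}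
        \<le> emeasure lborel {t. 0 \<le> t \<and> t \<le> T' + T \<and> X t \<omega> = x}
          + ennreal T * indicator {\<omega>\<in>space M. T' < \<tau> 1 \<omega>} \<omega>"
    proof (cases "T' < \<tau> 1 \<omega>")
      case True
      have "emeasure lborel {s. 0 \<le> s \<and> s \<le> T \<and> X (\<tau> x \<omega> + s) \<omega> = x} \<le> emeasure lborel {0..T}"
        by (rule emeasure_mono) auto
      also have "\<dots> = ennreal T" using T by simp
      finally have "emeasure lborel {s. 0 \<le> s \<and> s \<le> T \<and> X (\<tau> x \<omega> + s) \<omega> = x} \<le> ennreal T" .
      then show ?thesis using True w by (simp add: add_increasing)
    next
      case False
      then have "emeasure lborel {s. 0 \<le> s \<and> s \<le> T \<and> X (\<tau> x \<omega> + s) \<omega> = x}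
          \<le> emeasure lborel {t. 0 \<le> t \<and> t \<le> T' + T \<and> X t \<omega> = x}"
        using le \<tau>_facts(1)[OF x] by (intro shifted_level_sets(2)) auto
      then show ?thesis by (simp add: add_increasing2)
    qed
  qed
  also have "\<dots> = occupied (T' + T) x + ennreal T * emeasure M {\<omega>\<in>space M. T' < \<tau> 1 \<omega>}"
  proof -
    have A: "{\<omega>\<in>space M. T' < \<tau> 1 \<omega>} \<in> sets M" by measurable
    have "(\<integral>\<^sup>+\<omega>. ennreal T * indicator {\<omega>\<in>space M. T' < \<tau> 1 \<omega>} \<omega> \<partial>M)
        = ennreal T * emeasure M {\<omega>\<in>space M. T' < \<tau> 1 \<omega>}"
      by (rule nn_integral_cmult_indicator[OF A])
    moreover have "(\<lambda>\<omega>. ennreal T * indicator {\<omega>\<in>space M. T' < \<tau> 1 \<omega>} \<omega>) \<in> borel_measurable M"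
      using A by simp
    ultimately show ?thesis
      unfolding occupied_def by (subst nn_integral_add[OF level_measurable]) auto
  qed
  finally show ?thesis .
qed

lemma occupied_sum_le:
  assumes "finite F" "0 \<le> T"
  shows "(\<Sum>x\<in>F. occupied T x) \<le> ennreal T"
proof -
  have "(\<Sum>x\<in>F. occupied T x) = (\<integral>\<^sup>+\<omega>. (\<Sum>x\<in>F. emeasure lborel {t. 0 \<le> t \<and> t \<le> T \<and> X t \<omega> = x}) \<partial>M)"
    unfolding occupied_def by (rule nn_integral_sum[symmetric]) (rule level_measurable)
  also have "\<dots> \<le> (\<integral>\<^sup>+\<omega>. ennreal T \<partial>M)"
  proof (rule nn_integral_mono)
    fix \<omega>
    have "(\<Sum>x\<in>F. emeasure lborel {t. 0 \<le> t \<and> t \<le> T \<and> X t \<omega> = x})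
        = emeasure lborel (\<Union>x\<in>F. {t. 0 \<le> t \<and> t \<le> T \<and> X t \<omega> = x})"
      using level_sets assms(1) by (intro sum_emeasure) (auto simp: disjoint_family_on_def)
    also have "\<dots> \<le> emeasure lborel {0..T}" by (rule emeasure_mono) auto
    finally show "(\<Sum>x\<in>F. emeasure lborel {t. 0 \<le> t \<and> t \<le> T \<and> X t \<omega> = x}) \<le> ennreal T"
      using assms(2) by simp
  qed
  also have "\<dots> = ennreal T" by (simp add: emeasure_space_1)
  finally show ?thesis .
qed

text \<open>If \<open>0\<close> were occupied for a positive expected time, then by the comparison all levels in \<open>{0..1}\<close> would
  be occupied for at least half of that time during a common finite period. Finitely many of them
  already exceed the length of the period.\<close>

theorem zero_level_null:
  assumes T: "0 \<le> T"
  shows "occupied T 0 = 0"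
proof (rule ccontr)
  have [measurable]: "\<tau> 1 \<in> borel_measurable M" by (rule \<tau>_measurable) auto
  assume "occupied T 0 \<noteq> 0"
  moreover have "occupied T 0 \<le> ennreal T" using occupied_sum_le[of "{0}" T] T by simp
  ultimately obtain c where c: "occupied T 0 = ennreal c" "0 < c"
    by (cases "occupied T 0") (auto simp: top_unique)
  have "(\<lambda>n. prob {\<omega>\<in>space M. real n < \<tau> 1 \<omega>}) \<longlonglongrightarrow> prob (\<Inter>n. {\<omega>\<in>space M. real n < \<tau> 1 \<omega>})"
    by (rule finite_Lim_measure_decseq) (auto simp: decseq_def)
  moreover have "(\<Inter>n. {\<omega>\<in>space M. real n < \<tau> 1 \<omega>}) = {}"
  proof -
    have "\<exists>n. \<tau> 1 \<omega> \<le> real n" for \<omega> by (rule real_arch_simple)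
    then show ?thesis by (blast dest: leD)
  qed
  ultimately have "(\<lambda>n. T * prob {\<omega>\<in>space M. real n < \<tau> 1 \<omega>}) \<longlonglongrightarrow> 0"
    using tendsto_mult_right_zero by fastforce
  then have "\<forall>\<^sub>F n in sequentially. T * prob {\<omega>\<in>space M. real n < \<tau> 1 \<omega>} < c / 2"
    by (rule order_tendstoD(2)) (use c in simp)
  then obtain n where n: "T * prob {\<omega>\<in>space M. real n < \<tau> 1 \<omega>} < c / 2"
    by (auto simp: eventually_sequentially)
  have half: "ennreal (c / 2) \<le> occupied (real n + T) x" if "0 \<le> x" "x \<le> 1" for x
  proof (rule ccontr)
    assume "\<not> ennreal (c / 2) \<le> occupied (real n + T) x"
    then have lt: "occupied (real n + T) x < ennreal (c / 2)" by simp
    have "ennreal c \<le> occupied (real n + T) x + ennreal T * emeasure M {\<omega>\<in>space M. real n < \<tau> 1 \<omega>}"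
      using level_comparison[OF that T, of "real n"] c by simp
    also have "ennreal T * emeasure M {\<omega>\<in>space M. real n < \<tau> 1 \<omega>} = ennreal (T * prob {\<omega>\<in>space M. real n < \<tau> 1 \<omega>})"
      using T by (simp add: emeasure_eq_measure ennreal_mult)
    also have "occupied (real n + T) x + ennreal (T * prob {\<omega>\<in>space M. real n < \<tau> 1 \<omega>}) < ennreal (c / 2) + ennreal (c / 2)"
      using lt n c by (intro add_strict_mono ennreal_lessI) auto
    also have "\<dots> = ennreal c" using c by (simp flip: ennreal_plus)
    finally show False by simp
  qed
  \<comment> \<open>more levels than the period can accommodate\<close>
  obtain N :: nat where N: "(real n + T) / (c / 2) < real N" using reals_Archimedean2 by blast
  define F where "F = (\<lambda>i. 1 / real (Suc i)) ` {..<N}"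
  have "inj_on (\<lambda>i. 1 / real (Suc i)) {..<N}" by (auto simp: inj_on_def)
  then have "card F = N" unfolding F_def by (simp add: card_image)
  have "ennreal (real N * (c / 2)) = (\<Sum>x\<in>F. ennreal (c / 2))"
    unfolding sum_constant \<open>card F = N\<close> ennreal_of_nat_eq_real_of_nat
    by (rule ennreal_mult) (use c in auto)
  also have "\<dots> \<le> (\<Sum>x\<in>F. occupied (real n + T) x)"
    by (rule sum_mono, rule half) (auto simp: F_def)
  also have "\<dots> \<le> ennreal (real n + T)"
    by (rule occupied_sum_le) (use T in \<open>auto simp: F_def\<close>)
  finally have "real N * (c / 2) \<le> real n + T" 
    by (rule ennreal_le_iff[THEN iffD1, rotated]) (use T in simp)
  then show False using N c by (simp add: field_simps)
qed

corollary AE_zero_level_null: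
  "AE \<omega> in M. \<forall>T. emeasure lborel {t. 0 \<le> t \<and> t \<le> T \<and> X t \<omega> = 0} = 0"
proof -
  have "AE \<omega> in M. emeasure lborel {t. 0 \<le> t \<and> t \<le> real n \<and> X t \<omega> = 0} = 0" for n
  proof -
    have "(\<integral>\<^sup>+\<omega>. emeasure lborel {t. 0 \<le> t \<and> t \<le> real n \<and> X t \<omega> = 0} \<partial>M) = 0"
      using zero_level_null[of "real n"] unfolding occupied_def by simp
    then show ?thesis by (simp only: nn_integral_0_iff_AE[OF level_measurable])
  qed
  then have "AE \<omega> in M. \<forall>n::nat. emeasure lborel {t. 0 \<le> t \<and> t \<le> real n \<and> X t \<omega> = 0} = 0"
    by (simp add: AE_all_countable)
  then show ?thesis
  proof eventually_elim
    case (elim \<omega>)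
    show ?case
    proof
      fix T :: real
      obtain n :: nat where "T \<le> real n" using real_arch_simple by blast
      then have "emeasure lborel {t. 0 \<le> t \<and> t \<le> T \<and> X t \<omega> = 0}
          \<le> emeasure lborel {t. 0 \<le> t \<and> t \<le> real n \<and> X t \<omega> = 0}"
        using level_sets by (intro emeasure_mono) auto
      then show "emeasure lborel {t. 0 \<le> t \<and> t \<le> T \<and> X t \<omega> = 0} = 0" using elim by simp
    qed
  qed
qed

end

context transient_levy
begin

section \<open>Passage to the limit\<close>

definition peak :: "real \<Rightarrow> 'a \<Rightarrow> real" where
  "peak s \<omega> = record_time (\<lambda>t. s * X t \<omega>) (last_time \<omega>)"

definition time_in :: "real \<Rightarrow> real set \<Rightarrow> 'a \<Rightarrow> real" where
  "time_in s A \<omega> = occ (\<lambda>t. s * X t \<omega>) (last_time \<omega>) A"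

lemma end_time_ev3:
  assumes "last_time \<omega> < b"
  shows "ev3 (\<lambda>i k n. last_time \<omega> < grid n (\<kappa> k n \<omega>) \<and> grid n (\<kappa> k n \<omega>) < b)"
proof -
  interpret transient_path "\<lambda>t. X t \<omega>" by (rule path)
  show ?thesis using ev3_end assms unfolding last_time_def \<kappa>_def by blast
qed

lemma argmax_after_ev3:
  assumes s: "s = 1 \<or> s = -1" and a: "a < peak s \<omega>"
  shows "ev3 (\<lambda>i k n. \<forall>J. maximiser (\<lambda>j. s * X (grid n j) \<omega> + mesh i * grid n j) (\<kappa> k n \<omega>) J
      \<longrightarrow> a < grid n J)"
proof -
  interpret transient_path "\<lambda>t. X t \<omega>" by (rule path)
  show ?thesis
    using signed_argmax_after[OF s] a
    unfolding peak_def last_time_def \<kappa>_def signed_def[abs_def] by blast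
qed

lemma argmax_before_ev3:
  assumes s: "s = 1 \<or> s = -1" and a: "peak s \<omega> < a"
  shows "ev3 (\<lambda>i k n. \<forall>J. maximiser (\<lambda>j. s * X (grid n j) \<omega> - mesh i * grid n j) (\<kappa> k n \<omega>) J
      \<longrightarrow> grid n J \<le> a)"
proof -
  interpret transient_path "\<lambda>t. X t \<omega>" by (rule path)
  show ?thesis
    using signed_argmax_before[OF s] a
    unfolding peak_def last_time_def \<kappa>_def signed_def[abs_def] by blast
qed

definition small :: "'a \<Rightarrow> (nat \<Rightarrow> nat \<Rightarrow> nat \<Rightarrow> nat \<Rightarrow> real) \<Rightarrow> bool" where
  "small \<omega> \<delta> \<longleftrightarrow> (\<forall>\<eta>>0. ev3 (\<lambda>i k n. \<forall>j\<in>{1..\<kappa> k n \<omega>}. \<bar>\<delta> i k n j\<bar> \<le> \<eta>))"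

lemma small_drift: "small \<omega> (\<lambda>i k n j. mesh i * grid n j)" "small \<omega> (\<lambda>i k n j. - mesh i * grid n j)"
proof -
  interpret transient_path "\<lambda>t. X t \<omega>" by (rule path)
  show "small \<omega> (\<lambda>i k n j. mesh i * grid n j)"
    using drift_small unfolding small_def \<kappa>_def by blast
  then show "small \<omega> (\<lambda>i k n j. - mesh i * grid n j)"
    unfolding small_def by (simp add: abs_mult)
qed

lemma small_tilt:
  "small \<omega> (\<lambda>i k n j. real j * (s * X (grid n (\<kappa> k n \<omega>)) \<omega> / real (\<kappa> k n \<omega>)))"
proof -
  interpret transient_path "\<lambda>t. X t \<omega>" by (rule path)
  have "right_cont (\<lambda>t. s * X t \<omega>)"
    using right_cont unfolding right_cont_def by (intro allI impI tendsto_mult_left) blast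
  moreover have "s * X \<sigma> \<omega> = 0" using at_\<sigma> by simp
  ultimately show ?thesis
    using tilt_small[of "\<lambda>t. s * X t \<omega>"] unfolding small_def \<kappa>_def by blast
qed

lemma small_uminus: "small \<omega> \<delta> \<Longrightarrow> small \<omega> (\<lambda>i k n j. - \<delta> i k n j)"
  by (simp add: small_def)

lemma right_cont_signed: "right_cont (\<lambda>t. s * X t \<omega>)"
  using rc[of \<omega>] unfolding right_cont_def by (intro allI impI tendsto_mult_left) blast

lemma count_upper_law:
  assumes \<delta>: "small \<omega> \<delta>" and a: "time_in s {0..} \<omega> < a"
  shows "ev3 (\<lambda>i k n. mesh n * real (card {j\<in>{1..\<kappa> k n \<omega>}. 0 \<le> s * X (grid n j) \<omega> + \<delta> i k n j}) < a)"
proof -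
  interpret transient_path "\<lambda>t. X t \<omega>" by (rule path)
  show ?thesis
    using count_upper_ev3[OF right_cont_signed[of s \<omega>], of a \<delta>] \<delta> a
    unfolding small_def \<kappa>_def time_in_def last_time_def by blast
qed

lemma count_lower_law:
  assumes \<delta>: "small \<omega> \<delta>" and a: "a < time_in s {0<..} \<omega>"
  shows "ev3 (\<lambda>i k n. a < mesh n * real (card {j\<in>{1..\<kappa> k n \<omega>}. 0 < s * X (grid n j) \<omega> + \<delta> i k n j}))"
proof -
  interpret transient_path "\<lambda>t. X t \<omega>" by (rule path)
  show ?thesis
    using count_lower_ev3[OF right_cont_signed[of s \<omega>], of a \<delta>] \<delta> a
    unfolding small_def \<kappa>_def time_in_def last_time_def by blast
qed

text \<open>The last time is the limit of the ends of the sampled paths.\<close>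

lemma last_time_measurable [measurable]: "last_time \<in> borel_measurable M"
proof -
  have [measurable]: "X (grid n j) \<in> borel_measurable M" for j n
    by (rule random_variable_X) simp
  have "{\<omega>\<in>space M. last_time \<omega> < a} \<in> sets M" for a
  proof -
    have "{\<omega>\<in>space M. last_time \<omega> < a} = {\<omega>\<in>space M. \<exists>m::nat. \<forall>\<^sub>F k in sequentially. \<forall>\<^sub>F n in sequentially. grid n (\<kappa> k n \<omega>) < a - mesh m}"
    proof (intro Collect_cong conj_cong refl iffI)
      fix \<omega> assume "last_time \<omega> < a"
      then obtain m where m: "mesh m < a - last_time \<omega>"
        using eventually_mesh_less[of "a - last_time \<omega>"] by (auto simp: eventually_sequentially)
      then have "last_time \<omega> < a - mesh m" by simp
      from end_time_ev3[OF this] have "\<forall>\<^sub>F k in sequentially. \<forall>\<^sub>F n in sequentially.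
          last_time \<omega> < grid n (\<kappa> k n \<omega>) \<and> grid n (\<kappa> k n \<omega>) < a - mesh m"
        by (simp only: eventually_const sequentially_bot not_False_eq_True)
      then show "\<exists>m::nat. \<forall>\<^sub>F k in sequentially. \<forall>\<^sub>F n in sequentially. grid n (\<kappa> k n \<omega>) < a - mesh m"
        by (intro exI[of _ m]) (elim eventually_mono conjunct2)
    next
      fix \<omega> assume "\<exists>m::nat. \<forall>\<^sub>F k in sequentially. \<forall>\<^sub>F n in sequentially. grid n (\<kappa> k n \<omega>) < a - mesh m"
      then obtain m where "\<forall>\<^sub>F k in sequentially. \<forall>\<^sub>F n in sequentially. grid n (\<kappa> k n \<omega>) < a - mesh m" by blast
      then have e1: "ev3 (\<lambda>i k n. grid n (\<kappa> k n \<omega>) < a - mesh m)" by (rule always_eventually[OF allI])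
      have e2: "ev3 (\<lambda>i k n. last_time \<omega> < grid n (\<kappa> k n \<omega>) \<and> grid n (\<kappa> k n \<omega>) < last_time \<omega> + 1)"
        by (rule end_time_ev3) simp
      from ev3_ex[OF ev3_conj[OF e1 e2]]
      obtain k n where "grid n (\<kappa> k n \<omega>) < a - mesh m" "last_time \<omega> < grid n (\<kappa> k n \<omega>)"
        by blast
      then show "last_time \<omega> < a" using mesh_pos[of m] by linarith
    qed
    also have "\<dots> \<in> sets M" unfolding eventually_sequentially by measurable
    finally show ?thesis .
  qed
  then show ?thesis by (rule borel_measurable_iff_less[THEN iffD2, rule_format])
qed

lemma time_in_measurable:
  assumes A: "A \<in> sets borel"
  shows "time_in s A \<in> borel_measurable M"
proof -
  have j: "(\<lambda>z. X (max 0 (snd z)) (fst z)) \<in> borel_measurable (M \<Otimes>\<^sub>M lborel)"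
    by (rule joint_compose) auto
  have P: "Measurable.pred (M \<Otimes>\<^sub>M lborel) (\<lambda>z. s * X (max 0 (snd z)) (fst z) \<in> A)"
    using j A by (intro pred_sets2[OF A]) (intro borel_measurable_times borel_measurable_const)
  have "(\<lambda>(\<omega>, t). indicator {t. 0 \<le> t \<and> t \<le> last_time \<omega> \<and> s * X t \<omega> \<in> A} t :: ennreal)
      = (\<lambda>z. if 0 \<le> snd z \<and> snd z \<le> last_time (fst z) \<and> s * X (max 0 (snd z)) (fst z) \<in> A then 1 else 0)"
    by (auto simp: fun_eq_iff indicator_def max_def)
  also have "\<dots> \<in> borel_measurable (M \<Otimes>\<^sub>M lborel)"
    using P by measurable
  finally have "(\<lambda>\<omega>. \<integral>\<^sup>+t. indicator {t. 0 \<le> t \<and> t \<le> last_time \<omega> \<and> s * X t \<omega> \<in> A} t \<partial>lborel) \<in> borel_measurable M"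
    by (rule lborel.borel_measurable_nn_integral)
  moreover have "(\<integral>\<^sup>+t. indicator {t. 0 \<le> t \<and> t \<le> last_time \<omega> \<and> s * X t \<omega> \<in> A} t \<partial>lborel) = ennreal (time_in s A \<omega>)" for \<omega>
    unfolding time_in_def occ_emeasure
    using right_cont_sets[OF right_cont_signed A, of "last_time \<omega>" s \<omega>] by simp
  ultimately have "(\<lambda>\<omega>. enn2real (ennreal (time_in s A \<omega>))) \<in> borel_measurable M" by simp
  moreover have "enn2real (ennreal (time_in s A \<omega>)) = time_in s A \<omega>" for \<omega>
    by (simp add: time_in_def occ_def)
  ultimately show ?thesis by simp
qed

lemma AE_time_in_eq:
  assumes s: "s = 1 \<or> s = -1"
  shows "AE \<omega> in M. time_in s {0..} \<omega> = time_in s {0<..} \<omega>"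
  using AE_zero_level_null
proof eventually_elim
  case (elim \<omega>)
  let ?Z = "{t. 0 \<le> t \<and> t \<le> last_time \<omega> \<and> X t \<omega> = 0}"
  have "emeasure lborel {t. 0 \<le> t \<and> t \<le> last_time \<omega> \<and> s * X t \<omega> \<in> {0..}}
      = emeasure lborel ({t. 0 \<le> t \<and> t \<le> last_time \<omega> \<and> s * X t \<omega> \<in> {0<..}} \<union> ?Z)"
    using s by (intro arg_cong[where f="emeasure lborel"]) auto
  also have "\<dots> = emeasure lborel {t. 0 \<le> t \<and> t \<le> last_time \<omega> \<and> s * X t \<omega> \<in> {0<..}}"
    using right_cont_sets[OF right_cont_signed, of "{0<..}" "last_time \<omega>" s \<omega>] level_sets[of "last_time \<omega>" \<omega> 0] elim
    by (intro emeasure_Un_null_set) (auto simp: null_sets_def)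
  finally show ?case
    unfolding time_in_def occ_def measure_def by simp
qed

lemma psum_perturbed:
  assumes "j \<le> \<kappa> k n \<omega>"
  shows "psum (affine s (c * mesh n) (steps k n \<omega>)) j = s * X (grid n j) \<omega> + c * grid n j"
  using psum_affine_steps[OF assms, where s=s and d="c * mesh n"] by (simp add: mult_ac)

lemma num_pos_perturbed:
  "num_pos (affine s (c * mesh n) (steps k n \<omega>))
    = card {j\<in>{1..\<kappa> k n \<omega>}. 0 < s * X (grid n j) \<omega> + c * grid n j}"
  unfolding num_pos_def length_affine length_steps
  by (rule arg_cong[where f=card]) (auto simp: psum_perturbed)

lemma maximiser_cong: "(\<And>j. j \<le> K \<Longrightarrow> g j = g' j) \<Longrightarrow> maximiser g K J = maximiser g' K J"
  unfolding maximiser_def by (intro conj_cong refl) auto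

lemma first_argmax_perturbed:
  "maximiser (\<lambda>j. s * X (grid n j) \<omega> + c * grid n j) (\<kappa> k n \<omega>)
     (first_argmax (affine s (c * mesh n) (steps k n \<omega>)))"
  using first_argmax[of "affine s (c * mesh n) (steps k n \<omega>)"]
  unfolding length_affine length_steps
  by (subst maximiser_cong[of _ _ "psum (affine s (c * mesh n) (steps k n \<omega>))"]) (auto simp: psum_perturbed)

lemma first_argmax_rev_perturbed:
  "\<exists>J. J \<le> \<kappa> k n \<omega> \<and> first_argmax (rev (affine s (c * mesh n) (steps k n \<omega>))) = \<kappa> k n \<omega> - J \<and>
    maximiser (\<lambda>j. (- s) * X (grid n j) \<omega> + (- c) * grid n j) (\<kappa> k n \<omega>) J"
proof -
  let ?xs = "affine s (c * mesh n) (steps k n \<omega>)"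
  let ?J = "first_argmax (rev ?xs)"
  have m: "maximiser (psum (rev ?xs)) (length ?xs) ?J" using first_argmax[of "rev ?xs"] by simp
  then have "?J \<le> \<kappa> k n \<omega>" by (simp add: maximiser_def)
  from maximiser_rev[OF m] have "maximiser (\<lambda>j. - psum ?xs j) (\<kappa> k n \<omega>) (\<kappa> k n \<omega> - ?J)" by simp
  then have "maximiser (\<lambda>j. (- s) * X (grid n j) \<omega> + (- c) * grid n j) (\<kappa> k n \<omega>) (\<kappa> k n \<omega> - ?J)"
    by (subst maximiser_cong[of _ _ "\<lambda>j. - psum ?xs j"]) (auto simp: psum_perturbed)
  then show ?thesis using \<open>?J \<le> \<kappa> k n \<omega>\<close> by (intro exI[of _ "\<kappa> k n \<omega> - ?J"]) auto
qed

lemma num_pos_tilt: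
  "num_pos (tilt (affine s 0 (steps k n \<omega>)))
    = card {j\<in>{1..\<kappa> k n \<omega>}. 0 < s * X (grid n j) \<omega>
        + - (real j * (s * X (grid n (\<kappa> k n \<omega>)) \<omega> / real (\<kappa> k n \<omega>)))}"
  and num_nonneg_tilt:
  "num_nonneg (map uminus (tilt (affine s 0 (steps k n \<omega>))))
    = card {j\<in>{1..\<kappa> k n \<omega>}. 0 \<le> (- s) * X (grid n j) \<omega>
        + real j * (s * X (grid n (\<kappa> k n \<omega>)) \<omega> / real (\<kappa> k n \<omega>))}"
proof -
  have tot: "sum_list (affine s 0 (steps k n \<omega>)) = s * X (grid n (\<kappa> k n \<omega>)) \<omega>"
    using psum_affine_steps[OF order_refl, where s=s and d=0 and k=k and n=n and \<omega>=\<omega>] by simp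
  have ps: "psum (tilt (affine s 0 (steps k n \<omega>))) j = s * X (grid n j) \<omega>
        - real j * (s * X (grid n (\<kappa> k n \<omega>)) \<omega> / real (\<kappa> k n \<omega>))" if "j \<le> \<kappa> k n \<omega>" for j
    using that psum_tilt[where j=j and xs="affine s 0 (steps k n \<omega>)"] psum_affine_steps[OF that, where s=s and d=0] tot by simp
  show "num_pos (tilt (affine s 0 (steps k n \<omega>)))
    = card {j\<in>{1..\<kappa> k n \<omega>}. 0 < s * X (grid n j) \<omega>
        + - (real j * (s * X (grid n (\<kappa> k n \<omega>)) \<omega> / real (\<kappa> k n \<omega>)))}"
    unfolding num_pos_def length_tilt length_affine length_steps
    by (rule arg_cong[where f=card]) (auto simp: ps)
  show "num_nonneg (map uminus (tilt (affine s 0 (steps k n \<omega>))))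
    = card {j\<in>{1..\<kappa> k n \<omega>}. 0 \<le> (- s) * X (grid n j) \<omega>
        + real j * (s * X (grid n (\<kappa> k n \<omega>)) \<omega> / real (\<kappa> k n \<omega>))}"
    unfolding num_nonneg_def length_map length_tilt length_affine length_steps
    by (rule arg_cong[where f=card]) (auto simp: ps take_map sum_list_uminus_real)
qed

text \<open>The statistic \<open>A\<close> of the sampled path has the law of the count of positive values. With an upward
  drift its limits are at least \<open>G\<close>, with a downward drift at most \<open>G\<close>, whereas the count tends to the
  time spent in \<open>{0..}\<close> in either case, as the level \<open>0\<close> carries no time. Hence \<open>G\<close> has the law of that
  time.\<close>
theorem law_of_discrete_limit:
  fixes G :: "'a \<Rightarrow> real" and A :: "real \<Rightarrow> nat \<Rightarrow> nat \<Rightarrow> 'a \<Rightarrow> real"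
  assumes s: "s = 1 \<or> s = -1"
    and A[measurable]: "\<And>d k n. A d k n \<in> borel_measurable M"
    and law: "\<And>\<Phi> d k n. (\<integral>\<^sup>+\<omega>. \<Phi> (A d k n \<omega>) \<partial>M)
      = (\<integral>\<^sup>+\<omega>. (\<Phi> (mesh n * real (num_pos (affine s (d * mesh n) (steps k n \<omega>)))) :: ennreal) \<partial>M)"
    and lower: "\<And>\<omega> a. a < G \<omega> \<Longrightarrow> ev3 (\<lambda>i k n. a < A (mesh i) k n \<omega>)"
    and upper: "\<And>\<omega> a. G \<omega> < a \<Longrightarrow> ev3 (\<lambda>i k n. A (- mesh i) k n \<omega> < a)"
  shows "G \<in> borel_measurable (completion M)"
    and "distr (completion M) borel G = distr M borel (time_in s {0..})"
proof -
  have N[measurable]: "time_in s {0..} \<in> borel_measurable M" "time_in s {0<..} \<in> borel_measurable M"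
    by (rule time_in_measurable, simp)+
  define B where "B d k n \<omega> = mesh n * real (num_pos (affine s (d * mesh n) (steps k n \<omega>)))" for d k n \<omega>
  have B[measurable]: "B d k n \<in> borel_measurable M" for d k n unfolding B_def[abs_def] by measurable
  have AB: "(\<integral>\<^sup>+\<omega>. \<Phi> (A d k n \<omega>) \<partial>M) \<le> (\<integral>\<^sup>+\<omega>. \<Phi> (B d k n \<omega>) \<partial>M)" for \<Phi> :: "real \<Rightarrow> ennreal" and d k n
    unfolding law B_def ..
  have up: "\<exists>U\<in>borel_measurable M. (\<forall>\<omega>\<in>space M. ennreal (\<phi> (G \<omega>)) \<le> U \<omega>) \<and>
      (\<integral>\<^sup>+\<omega>. U \<omega> \<partial>M) \<le> (\<integral>\<^sup>+\<omega>. ennreal (\<phi> (time_in s {0..} \<omega>)) \<partial>M)" if \<phi>: "test_fun \<phi>" for \<phi>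
  proof (rule iterated_limit_comparison[where A = "\<lambda>i. A (mesh i)" and B = "\<lambda>i. B (mesh i)", OF A B N(1) AB[of "\<lambda>x. ennreal (\<phi> x)"] lower _ \<phi>])
    fix \<omega> a assume "time_in s {0..} \<omega> < a"
    from count_upper_law[OF small_drift(1) this]
    show "ev3 (\<lambda>i k n. B (mesh i) k n \<omega> < a)"
    proof (rule ev3_mono)
      fix i k n assume *: "mesh n * real (card {j\<in>{1..\<kappa> k n \<omega>}. 0 \<le> s * X (grid n j) \<omega> + mesh i * grid n j}) < a"
      have "num_pos (affine s (mesh i * mesh n) (steps k n \<omega>)) \<le> card {j\<in>{1..\<kappa> k n \<omega>}. 0 \<le> s * X (grid n j) \<omega> + mesh i * grid n j}"
        unfolding num_pos_perturbed by (rule card_mono) auto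
      then have "B (mesh i) k n \<omega>
          \<le> mesh n * real (card {j\<in>{1..\<kappa> k n \<omega>}. 0 \<le> s * X (grid n j) \<omega> + mesh i * grid n j})"
        unfolding B_def by (intro mult_left_mono) auto
      then show "B (mesh i) k n \<omega> < a" using * by linarith
    qed
  qed
  have down: "\<exists>V\<in>borel_measurable M. (\<forall>\<omega>\<in>space M. ennreal (\<phi> (- G \<omega>)) \<le> V \<omega>) \<and>
      (\<integral>\<^sup>+\<omega>. V \<omega> \<partial>M) \<le> (\<integral>\<^sup>+\<omega>. ennreal (\<phi> (- time_in s {0..} \<omega>)) \<partial>M)" if \<phi>: "test_fun \<phi>" for \<phi>
  proof -
    have "\<exists>V\<in>borel_measurable M. (\<forall>\<omega>\<in>space M. ennreal (\<phi> (- G \<omega>)) \<le> V \<omega>) \<and>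
      (\<integral>\<^sup>+\<omega>. V \<omega> \<partial>M) \<le> (\<integral>\<^sup>+\<omega>. ennreal (\<phi> (- time_in s {0<..} \<omega>)) \<partial>M)"
    proof (rule iterated_limit_comparison[where A = "\<lambda>i k n \<omega>. - A (- mesh i) k n \<omega>" and B = "\<lambda>i k n \<omega>. - B (- mesh i) k n \<omega>",
          OF _ _ _ AB[of "\<lambda>x. ennreal (\<phi> (- x))"] _ _ \<phi>])
      show "(\<lambda>\<omega>. - A (- mesh i) k n \<omega>) \<in> borel_measurable M" "(\<lambda>\<omega>. - B (- mesh i) k n \<omega>) \<in> borel_measurable M" for i k n
        by measurable
      show "(\<lambda>\<omega>. - time_in s {0<..} \<omega>) \<in> borel_measurable M" by measurable
    next
      fix \<omega> a assume "a < - G \<omega>"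
      then have "G \<omega> < - a" by simp
      from upper[OF this] show "ev3 (\<lambda>i k n. a < - A (- mesh i) k n \<omega>)"
        by (rule ev3_mono) simp
    next
      fix \<omega> a assume "- time_in s {0<..} \<omega> < a"
      then have "- a < time_in s {0<..} \<omega>" by simp
      from count_lower_law[OF small_drift(2) this]
      show "ev3 (\<lambda>i k n. - B (- mesh i) k n \<omega> < a)"
        unfolding B_def num_pos_perturbed by (rule ev3_mono) linarith
    qed
    also have "(\<integral>\<^sup>+\<omega>. ennreal (\<phi> (- time_in s {0<..} \<omega>)) \<partial>M) = (\<integral>\<^sup>+\<omega>. ennreal (\<phi> (- time_in s {0..} \<omega>)) \<partial>M)"
      using AE_time_in_eq[OF s] by (intro nn_integral_cong_AE) (elim AE_mp, auto)
    finally show ?thesis .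
  qed
  show "G \<in> borel_measurable (completion M)" "distr (completion M) borel G = distr M borel (time_in s {0..})"
    using squeeze_distr[OF N(1) up down] by blast+
qed

text \<open>The statistic is the first maximiser of the drifting walk, which an upward drift pushes behind and a
  downward drift pushes before the last record.\<close>

theorem peak_law:
  assumes s: "s = 1 \<or> s = -1"
  shows "peak s \<in> borel_measurable (completion M)"
    and "distr (completion M) borel (peak s) = distr M borel (time_in s {0..})"
proof -
  define A where "A d k n \<omega> = mesh n * real (first_argmax (affine s (d * mesh n) (steps k n \<omega>)))" for d k n \<omega>
  have A: "A d k n \<in> borel_measurable M" for d k n unfolding A_def[abs_def] by measurable
  have law: "(\<integral>\<^sup>+\<omega>. \<Phi> (A d k n \<omega>) \<partial>M)
      = (\<integral>\<^sup>+\<omega>. \<Phi> (mesh n * real (num_pos (affine s (d * mesh n) (steps k n \<omega>)))) \<partial>M)" for \<Phi> :: "real \<Rightarrow> ennreal" and d k n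
    unfolding A_def by (rule law_first_argmax[of "\<lambda>J. \<Phi> (mesh n * real J)" s "d * mesh n" k n])
  have A_eq: "\<exists>J. A d k n \<omega> = grid n J \<and>
      maximiser (\<lambda>j. s * X (grid n j) \<omega> + d * grid n j) (\<kappa> k n \<omega>) J" for d k n \<omega>
    using first_argmax_perturbed[where s=s and n=n and \<omega>=\<omega> and c=d and k=k] mult.commute
    unfolding A_def by blast
  have lower: "ev3 (\<lambda>i k n. a < A (mesh i) k n \<omega>)" if "a < peak s \<omega>" for a \<omega>
    using argmax_after_ev3[OF s that]
  proof (rule ev3_mono)
    fix i k n
    assume m: "\<forall>J. maximiser (\<lambda>j. s * X (grid n j) \<omega> + mesh i * grid n j) (\<kappa> k n \<omega>) J \<longrightarrow> a < grid n J"
    obtain J where "A (mesh i) k n \<omega> = grid n J"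
      "maximiser (\<lambda>j. s * X (grid n j) \<omega> + mesh i * grid n j) (\<kappa> k n \<omega>) J"
      using A_eq[of "mesh i" k n \<omega>] by blast
    then show "a < A (mesh i) k n \<omega>" using m by (simp only:)
  qed
  have upper: "ev3 (\<lambda>i k n. A (- mesh i) k n \<omega> < a)" if a: "peak s \<omega> < a" for a \<omega>
  proof -
    obtain a' where a': "peak s \<omega> < a'" "a' < a" using dense[OF a] by blast
    from argmax_before_ev3[OF s a'(1)] show ?thesis
    proof (rule ev3_mono)
      fix i k n
      assume m: "\<forall>J. maximiser (\<lambda>j. s * X (grid n j) \<omega> - mesh i * grid n j) (\<kappa> k n \<omega>) J \<longrightarrow> grid n J \<le> a'"
      obtain J where "A (- mesh i) k n \<omega> = grid n J"
        "maximiser (\<lambda>j. s * X (grid n j) \<omega> + (- mesh i) * grid n j) (\<kappa> k n \<omega>) J"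
        using A_eq[of "- mesh i" k n \<omega>] by blast
      then have "A (- mesh i) k n \<omega> \<le> a'" using m by simp
      then show "A (- mesh i) k n \<omega> < a" using a'(2) by linarith
    qed
  qed
  show "peak s \<in> borel_measurable (completion M)"
    "distr (completion M) borel (peak s) = distr M borel (time_in s {0..})"
    using law_of_discrete_limit[OF s A law lower upper] by blast+
qed

text \<open>Reversing the order of the steps turns the first maximiser into the distance from the last
  minimiser to the end of the sampled path, and the end tends to \<open>last_time\<close>.\<close>

theorem peak_to_end_law:
  assumes s: "s = 1 \<or> s = -1"
  shows "(\<lambda>\<omega>. last_time \<omega> - peak (- s) \<omega>) \<in> borel_measurable (completion M)"
    and "distr (completion M) borel (\<lambda>\<omega>. last_time \<omega> - peak (- s) \<omega>) = distr M borel (time_in s {0..})"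
proof -
  have s': "- s = 1 \<or> - s = -1" using s by auto
  define A where "A d k n \<omega> = mesh n * real (first_argmax (rev (affine s (d * mesh n) (steps k n \<omega>))))" for d k n \<omega>
  have A: "A d k n \<in> borel_measurable M" for d k n unfolding A_def[abs_def] by measurable
  have law: "(\<integral>\<^sup>+\<omega>. \<Phi> (A d k n \<omega>) \<partial>M)
      = (\<integral>\<^sup>+\<omega>. \<Phi> (mesh n * real (num_pos (affine s (d * mesh n) (steps k n \<omega>)))) \<partial>M)" for \<Phi> :: "real \<Rightarrow> ennreal" and d k n
    unfolding A_def by (rule law_first_argmax_rev[of "\<lambda>J. \<Phi> (mesh n * real J)" s "d * mesh n" k n])
  have A_eq: "\<exists>J. A d k n \<omega> = grid n (\<kappa> k n \<omega>) - grid n J \<and>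
      maximiser (\<lambda>j. (- s) * X (grid n j) \<omega> + (- d) * grid n j) (\<kappa> k n \<omega>) J" for d k n \<omega>
  proof -
    obtain J where "J \<le> \<kappa> k n \<omega>" "first_argmax (rev (affine s (d * mesh n) (steps k n \<omega>))) = \<kappa> k n \<omega> - J"
      "maximiser (\<lambda>j. (- s) * X (grid n j) \<omega> + (- d) * grid n j) (\<kappa> k n \<omega>) J"
      using first_argmax_rev_perturbed[where s=s and c=d and n=n and k=k and \<omega>=\<omega>] by blast
    then show ?thesis by (intro exI[of _ J]) (simp add: A_def of_nat_diff algebra_simps)
  qed
  have lower: "ev3 (\<lambda>i k n. a < A (mesh i) k n \<omega>)" if "a < last_time \<omega> - peak (- s) \<omega>" for a \<omega>
  proof -
    have "peak (- s) \<omega> < last_time \<omega> - a" "last_time \<omega> < last_time \<omega> + 1" using that by simp_all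
    note e1 = argmax_before_ev3[OF s' this(1)] and e2 = end_time_ev3[OF this(2)]
    show ?thesis
    proof (rule ev3_mono[OF ev3_conj[OF e1 e2]], elim conjE)
      fix i k n
      assume m: "\<forall>J. maximiser (\<lambda>j. - s * X (grid n j) \<omega> - mesh i * grid n j) (\<kappa> k n \<omega>) J \<longrightarrow> grid n J \<le> last_time \<omega> - a"
        and l: "last_time \<omega> < grid n (\<kappa> k n \<omega>)"
      obtain J where J: "A (mesh i) k n \<omega> = grid n (\<kappa> k n \<omega>) - grid n J"
        "maximiser (\<lambda>j. (- s) * X (grid n j) \<omega> + (- mesh i) * grid n j) (\<kappa> k n \<omega>) J"
        using A_eq[of "mesh i" k n \<omega>] by blast
      then have "grid n J \<le> last_time \<omega> - a" using m by simp
      then show "a < A (mesh i) k n \<omega>" using J(1) l by linarith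
    qed
  qed
  have upper: "ev3 (\<lambda>i k n. A (- mesh i) k n \<omega> < a)" if a: "last_time \<omega> - peak (- s) \<omega> < a" for a \<omega>
  proof -
    define e where "e = (a - (last_time \<omega> - peak (- s) \<omega>)) / 2"
    have e: "0 < e" using a by (simp add: e_def)
    then have "peak (- s) \<omega> - e < peak (- s) \<omega>" "last_time \<omega> < last_time \<omega> + e" by simp_all
    note e1 = argmax_after_ev3[OF s' this(1)] and e2 = end_time_ev3[OF this(2)]
    show ?thesis
    proof (rule ev3_mono[OF ev3_conj[OF e1 e2]], elim conjE)
      fix i k n
      assume m: "\<forall>J. maximiser (\<lambda>j. - s * X (grid n j) \<omega> + mesh i * grid n j) (\<kappa> k n \<omega>) J \<longrightarrow> peak (- s) \<omega> - e < grid n J"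
        and l: "grid n (\<kappa> k n \<omega>) < last_time \<omega> + e"
      obtain J where J: "A (- mesh i) k n \<omega> = grid n (\<kappa> k n \<omega>) - grid n J"
        "maximiser (\<lambda>j. (- s) * X (grid n j) \<omega> + (- (- mesh i)) * grid n j) (\<kappa> k n \<omega>) J"
        using A_eq[of "- mesh i" k n \<omega>] by blast
      then have "peak (- s) \<omega> - e < grid n J" using m by simp
      then have "A (- mesh i) k n \<omega> < last_time \<omega> + e - (peak (- s) \<omega> - e)" using J(1) l by linarith
      also have "\<dots> = a" by (simp add: e_def field_simps)
      finally show "A (- mesh i) k n \<omega> < a" .
    qed
  qed
  show "(\<lambda>\<omega>. last_time \<omega> - peak (- s) \<omega>) \<in> borel_measurable (completion M)"
    "distr (completion M) borel (\<lambda>\<omega>. last_time \<omega> - peak (- s) \<omega>) = distr M borel (time_in s {0..})"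
    using law_of_discrete_limit[where G="\<lambda>\<omega>. last_time \<omega> - peak (- s) \<omega>", OF s A law lower upper] by blast+
qed

text \<open>The tilted walks have as their limits the path itself, since the tilt vanishes.\<close>

lemma time_in_stochastic_le:
  assumes s: "s = 1 \<or> s = -1" and \<phi>: "test_fun \<phi>"
  shows "(\<integral>\<^sup>+\<omega>. ennreal (\<phi> (time_in s {0..} \<omega>)) \<partial>M) \<le> (\<integral>\<^sup>+\<omega>. ennreal (\<phi> (time_in (- s) {0..} \<omega>)) \<partial>M)"
proof -
  have N[measurable]: "time_in (- s) {0..} \<in> borel_measurable M"
    by (rule time_in_measurable) simp
  define A where "A k n \<omega> = mesh n * real (num_pos (tilt (affine s 0 (steps k n \<omega>))))" for k n \<omega>
  define B where "B k n \<omega> = mesh n * real (num_nonneg (map uminus (tilt (affine s 0 (steps k n \<omega>)))))" for k n \<omega>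
  have Am: "A k n \<in> borel_measurable M" for k n unfolding A_def[abs_def] by measurable
  have Bm: "B k n \<in> borel_measurable M" for k n unfolding B_def[abs_def] by measurable
  have "\<exists>U\<in>borel_measurable M. (\<forall>\<omega>\<in>space M. ennreal (\<phi> (time_in s {0<..} \<omega>)) \<le> U \<omega>) \<and>
      (\<integral>\<^sup>+\<omega>. U \<omega> \<partial>M) \<le> (\<integral>\<^sup>+\<omega>. ennreal (\<phi> (time_in (- s) {0..} \<omega>)) \<partial>M)"
  proof (rule iterated_limit_comparison[where A = "\<lambda>i k n. A k n" and B = "\<lambda>i k n. B k n", OF Am Bm N _ _ _ \<phi>])
    show "(\<integral>\<^sup>+\<omega>. ennreal (\<phi> (A k n \<omega>)) \<partial>M) \<le> (\<integral>\<^sup>+\<omega>. ennreal (\<phi> (B k n \<omega>)) \<partial>M)" for k n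
      unfolding A_def B_def
    proof (rule law_tilt[of "\<lambda>J. ennreal (\<phi> (mesh n * real J))"])
      fix i j :: nat assume "i \<le> j"
      then show "ennreal (\<phi> (mesh n * real i)) \<le> ennreal (\<phi> (mesh n * real j))"
        by (intro ennreal_leI test_funD(6)[OF \<phi>] mult_left_mono) auto
    qed
  next
    fix \<omega> a assume "a < time_in s {0<..} \<omega>"
    from count_lower_law[OF small_uminus[OF small_tilt[of \<omega> s]] this]
    show "ev3 (\<lambda>i k n. a < A k n \<omega>)" unfolding A_def num_pos_tilt .
  next
    fix \<omega> a assume "time_in (- s) {0..} \<omega> < a"
    from count_upper_law[OF small_tilt[of \<omega> s] this]
    show "ev3 (\<lambda>i k n. B k n \<omega> < a)" unfolding B_def num_nonneg_tilt .
  qed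
  then obtain U where U: "\<And>\<omega>. \<omega> \<in> space M \<Longrightarrow> ennreal (\<phi> (time_in s {0<..} \<omega>)) \<le> U \<omega>"
    "(\<integral>\<^sup>+\<omega>. U \<omega> \<partial>M) \<le> (\<integral>\<^sup>+\<omega>. ennreal (\<phi> (time_in (- s) {0..} \<omega>)) \<partial>M)" by blast
  have "(\<integral>\<^sup>+\<omega>. ennreal (\<phi> (time_in s {0..} \<omega>)) \<partial>M) = (\<integral>\<^sup>+\<omega>. ennreal (\<phi> (time_in s {0<..} \<omega>)) \<partial>M)"
    using AE_time_in_eq[OF s] by (intro nn_integral_cong_AE) (elim AE_mp, auto)
  also have "\<dots> \<le> (\<integral>\<^sup>+\<omega>. U \<omega> \<partial>M)" by (rule nn_integral_mono) (rule U(1))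
  also note U(2)
  finally show ?thesis .
qed

text \<open>Exchanging the roles of the path and its negative in the comparison gives equality in law.\<close>

theorem time_in_law: "distr M borel (time_in 1 {0..}) = distr M borel (time_in (-1) {0..})"
proof (rule test_fun_determines_distr)
  show "time_in 1 {0..} \<in> borel_measurable M" "time_in (-1) {0..} \<in> borel_measurable M"
    by (rule time_in_measurable, simp)+
  fix \<phi> assume \<phi>: "test_fun \<phi>"
  show "(\<integral>\<^sup>+\<omega>. ennreal (\<phi> (time_in 1 {0..} \<omega>)) \<partial>M) = (\<integral>\<^sup>+\<omega>. ennreal (\<phi> (time_in (-1) {0..} \<omega>)) \<partial>M)"
    using time_in_stochastic_le[of 1, OF _ \<phi>] time_in_stochastic_le[of "-1", OF _ \<phi>] by (intro antisym) auto
qed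

lemma last_time_eq: "last_nonpos X = last_time"
  by (rule ext) (simp add: last_nonpos_def last_time_def transient_path.\<sigma>_def[OF path])

lemma statistics_eq:
  "G_right X last_time = peak 1" "F_right X last_time = peak (-1)"
  "G_left X last_time = (\<lambda>\<omega>. last_time \<omega> - peak (- (- 1)) \<omega>)"
  "F_left X last_time = (\<lambda>\<omega>. last_time \<omega> - peak (- 1) \<omega>)"
  "N_plus X last_time = time_in 1 {0..}" "N_minus X last_time = time_in (-1) {0..}"
proof -
  show G: "G_right X last_time = peak 1"
    by (rule ext) (simp add: G_right_def peak_def record_time_def running_sup_def)
  have inf: "- X t \<omega> = (SUP s\<in>{0..t}. - X s \<omega>) \<longleftrightarrow> X t \<omega> = running_inf X t \<omega>" for t \<omega>
    unfolding running_inf_def Inf_real_def by (simp add: image_image) (metis minus_equation_iff)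
  show F: "F_right X last_time = peak (-1)"
    by (rule ext) (simp add: F_right_def peak_def record_time_def inf)
  show "G_left X last_time = (\<lambda>\<omega>. last_time \<omega> - peak (- (- 1)) \<omega>)"
    by (rule ext) (simp add: G_left_def G)
  show "F_left X last_time = (\<lambda>\<omega>. last_time \<omega> - peak (- 1) \<omega>)"
    by (rule ext) (simp add: F_left_def F)
  have int: "(LINT t:{0..T}|lborel. indicat_real A t) = measure lborel ({0..T} \<inter> A)"
    if "{0..T} \<inter> A \<in> sets borel" for T A
  proof -
    have "(LINT t:{0..T}|lborel. indicat_real A t) = (LINT t|lborel. indicat_real ({0..T} \<inter> A) t)"
      unfolding set_lebesgue_integral_def by (simp add: indicator_inter_arith)
    also have "\<dots> = measure lborel ({0..T} \<inter> A)" using that by simp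
    finally show ?thesis .
  qed
  have eq: "{0..last_time \<omega>} \<inter> {t. 0 \<le> s * X t \<omega>} = {t. 0 \<le> t \<and> t \<le> last_time \<omega> \<and> s * X t \<omega> \<in> {0..}}" for s \<omega>
    by auto
  have sets: "{t. 0 \<le> t \<and> t \<le> last_time \<omega> \<and> s * X t \<omega> \<in> {0..}} \<in> sets borel" for s \<omega>
    by (rule right_cont_sets[OF right_cont_signed]) simp
  have occ: "(LINT t:{0..last_time \<omega>}|lborel. indicat_real {t. 0 \<le> s * X t \<omega>} t) = time_in s {0..} \<omega>" for s \<omega>
    unfolding time_in_def occ_def eq[symmetric] by (rule int) (simp only: eq sets)
  show "N_plus X last_time = time_in 1 {0..}"
    using occ[of _ 1] by (intro ext) (simp add: N_plus_def)
  show "N_minus X last_time = time_in (-1) {0..}"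
    using occ[of _ "-1"] by (intro ext) (simp add: N_minus_def)
qed

theorem same_distribution_statistics:
  "same_distribution M {F_right X last_time, F_left X last_time, G_right X last_time, G_left X last_time,
     N_minus X last_time, N_plus X last_time}"
proof -
  have T: "time_in s {0..} \<in> borel_measurable M" for s by (rule time_in_measurable) simp
  have Tc: "time_in s {0..} \<in> borel_measurable (completion M)"
    "distr (completion M) borel (time_in s {0..}) = distr M borel (time_in s {0..})" for s
    using measurable_completion[OF T] distr_completion[OF T] by auto
  note r1 = peak_law[of 1] and r2 = peak_law[of "-1"]
    and r3 = peak_to_end_law[of 1] and r4 = peak_to_end_law[of "-1"]
  show ?thesis
    unfolding same_distribution_def statistics_eq
    using r1 r2 r3 r4 Tc by (simp add: time_in_law)
qed

end

section \<open>Regular versions and the final result\<close>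

lemma cadlag_bdd_above:
  assumes c: "cadlag f"
  shows "bdd_above (f ` {0..t})"
proof -
  have "\<exists>V B. open V \<and> u \<in> V \<and> (\<forall>s\<in>V \<inter> {0..t}. f s \<le> B)" if u: "u \<in> {0..t}" for u
  proof -
    have "(f \<longlongrightarrow> f u) (at_right u)" using c u by (auto simp: cadlag_def)
    from order_tendstoD(2)[OF this, of "f u + 1"] obtain r where r: "u < r" "\<And>s. u < s \<Longrightarrow> s < r \<Longrightarrow> f s < f u + 1"
      unfolding eventually_at_right_field by auto
    show ?thesis
    proof (cases "u = 0")
      case True
      have "f s \<le> f u + 1" if "s \<in> {..<r} \<inter> {0..t}" for s
        using r(2)[of s] that True by (cases "s = u") auto
      then show ?thesis using r True by (intro exI[of _ "{..<r}"] exI[of _ "f u + 1"]) auto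
    next
      case False
      then have "0 < u" using u by auto
      then obtain l where "(f \<longlongrightarrow> l) (at_left u)" using c by (auto simp: cadlag_def)
      from order_tendstoD(2)[OF this, of "l + 1"] obtain q where q: "q < u" "\<And>s. q < s \<Longrightarrow> s < u \<Longrightarrow> f s < l + 1"
        unfolding eventually_at_left_field by auto
      have "f s \<le> max (f u) l + 1" if "s \<in> {q<..<r} \<inter> {0..t}" for s
      proof -
        consider "s < u" | "s = u" | "u < s" by linarith
        then show ?thesis using r(2)[of s] q(2)[of s] that by cases auto
      qed
      then show ?thesis using r q by (intro exI[of _ "{q<..<r}"] exI[of _ "max (f u) l + 1"]) auto
    qed
  qed
  then obtain V B where VB: "\<And>u. u \<in> {0..t} \<Longrightarrow> open (V u) \<and> u \<in> V u \<and> (\<forall>s\<in>V u \<inter> {0..t}. f s \<le> B u)"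
    by metis
  have "compact {0..t}" "\<And>u. u \<in> {0..t} \<Longrightarrow> open (V u)" "{0..t} \<subseteq> (\<Union>u\<in>{0..t}. V u)"
    using VB by auto
  then obtain C where C: "C \<subseteq> {0..t}" "finite C" "{0..t} \<subseteq> (\<Union>u\<in>C. V u)"
    using compactE_image[of "{0..t}" "{0..t}" V] by metis
  have bd: "bdd_above (B ` C)" using C(2) by simp
  then obtain b where b: "\<And>u. u \<in> C \<Longrightarrow> B u \<le> b" by (auto simp: bdd_above_def)
  show ?thesis
  proof (rule bdd_aboveI2)
    fix s assume s: "s \<in> {0..t}"
    then obtain u where "u \<in> C" "s \<in> V u" using C(3) by blast
    then have "f s \<le> B u" using VB[of u] C(1) s by blast
    also have "B u \<le> b" using \<open>u \<in> C\<close> by (rule b)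
    finally show "f s \<le> b" .
  qed
qed

lemma spectral_pathI:
  assumes c: "cadlag f" and z: "f 0 = 0" and j: "\<And>t. 0 < t \<Longrightarrow> jump f t \<le> 0"
  shows "spectral_path f"
proof
  show "f 0 = 0" by (rule z)
  show "right_cont f" using c by (auto simp: cadlag_def right_cont_def)
  show "bdd_above (f ` {0..t})" for t by (rule cadlag_bdd_above[OF c])
  fix t b assume t: "0 < t" and b: "b < f t"
  obtain l where l: "(f \<longlongrightarrow> l) (at_left t)" using c t by (auto simp: cadlag_def)
  have "left_lim f t = l" unfolding left_lim_def by (rule tendsto_Lim[OF _ l]) (simp add: trivial_limit_at_left_real)
  then have "b < l" using j[OF t] b by (simp add: jump_def)
  then show "\<forall>\<^sub>F s in at_left t. b < f s" by (rule order_tendstoD(1)[OF l])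
qed

lemma transient_path_id: "transient_path (\<lambda>t. t)"
proof
  show "right_cont (\<lambda>t. t)" by (auto simp: right_cont_def)
  show "bdd_above ((\<lambda>t. t) ` {0..t})" for t :: real by simp
  show "\<forall>\<^sub>F s in at_left t. c < s" if "c < t" for t c :: real
    using that eventually_at_left_field by blast
  show "\<exists>K. \<forall>t\<ge>K. 1 < (t::real)" by (intro exI[of _ 2]) auto
qed simp

lemma (in prob_space) indep_vars_cong_AE:
  assumes Z: "indep_vars (\<lambda>_. borel) Z I" and Z': "\<And>i. i \<in> I \<Longrightarrow> Z' i \<in> borel_measurable M"
    and AE: "\<And>i. i \<in> I \<Longrightarrow> AE \<omega> in M. Z i \<omega> = Z' i \<omega>"
  shows "indep_vars (\<lambda>_. borel) Z' I"
  unfolding indep_vars_def2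
proof (intro conjI ballI Z' indep_setsI)
  have Zm: "Z i \<in> borel_measurable M" if "i \<in> I" for i using Z that by (auto simp: indep_vars_def2)
  show "{Z' i -` A \<inter> space M |A. A \<in> sets borel} \<subseteq> events" if "i \<in> I" for i
    using measurable_sets[OF Z'[OF that]] by auto
  fix A J assume J: "J \<noteq> {}" "J \<subseteq> I" "finite J"
    and A: "\<forall>j\<in>J. A j \<in> {Z' j -` A \<inter> space M |A. A \<in> sets borel}"
  then obtain B where B: "\<And>j. j \<in> J \<Longrightarrow> A j = Z' j -` B j \<inter> space M" "\<And>j. j \<in> J \<Longrightarrow> B j \<in> sets borel"
    by (auto simp: subset_eq) metis
  define A' where "A' j = Z j -` B j \<inter> space M" for j
  have Aev: "A j \<in> events" "A' j \<in> events" if "j \<in> J" for j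
    using measurable_sets[OF Z' B(2)] measurable_sets[OF Zm B(2)] B(1) that J(2) by (auto simp: A'_def)
  have AE': "AE \<omega> in M. \<omega> \<in> A j \<longleftrightarrow> \<omega> \<in> A' j" if "j \<in> J" for j
  proof -
    have "j \<in> I" using that J(2) by blast
    from AE[OF this] show ?thesis
      by eventually_elim (simp add: A'_def B(1)[OF that])
  qed
  have "prob (\<Inter>j\<in>J. A j) = prob (\<Inter>j\<in>J. A' j)"
  proof (rule finite_measure_eq_AE)
    have "AE \<omega> in M. \<forall>j\<in>J. \<omega> \<in> A j \<longleftrightarrow> \<omega> \<in> A' j"
      using AE' J(3) by (simp add: AE_finite_all)
    then show "AE \<omega> in M. \<omega> \<in> (\<Inter>j\<in>J. A j) \<longleftrightarrow> \<omega> \<in> (\<Inter>j\<in>J. A' j)" by eventually_elim auto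
  qed (use Aev J in auto)
  also have "\<dots> = (\<Prod>j\<in>J. prob (A' j))"
  proof (rule indep_setsD[OF _ J(2,1,3)])
    show "indep_sets (\<lambda>i. {Z i -` A \<inter> space M |A. A \<in> sets borel}) I"
      using Z by (simp add: indep_vars_def2)
    show "\<forall>j\<in>J. A' j \<in> {Z j -` A \<inter> space M |A. A \<in> sets borel}"
      using B(2) unfolding A'_def by blast
  qed
  also have "\<dots> = (\<Prod>j\<in>J. prob (A j))"
  proof (intro prod.cong refl finite_measure_eq_AE)
    fix j assume j: "j \<in> J"
    show "AE \<omega> in M. \<omega> \<in> A' j \<longleftrightarrow> \<omega> \<in> A j"
      using AE'[OF j] by eventually_elim blast
  qed (use Aev in blast)+
  finally show "prob (\<Inter>j\<in>J. A j) = (\<Prod>j\<in>J. prob (A j))" .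
qed

text \<open>Off a null set the path is replaced by \<open>t \<mapsto> t\<close>, the simplest path with all the properties in question.\<close>

lemma levy_modification:
  assumes L: "levy_process M X" and Q: "AE \<omega> in M. Q (\<lambda>t. X t \<omega>)" and id: "Q (\<lambda>t. t)"
  shows "\<exists>Y. levy_process M Y \<and> (\<forall>\<omega>. Q (\<lambda>t. Y t \<omega>)) \<and> (AE \<omega> in M. (\<lambda>t. Y t \<omega>) = (\<lambda>t. X t \<omega>))"
proof -
  interpret levy_process M X by (rule L)
  obtain N where N: "{\<omega>\<in>space M. \<not> Q (\<lambda>t. X t \<omega>)} \<subseteq> N" "N \<in> null_sets M"
    using Q unfolding eventually_ae_filter by blast
  define Y where "Y t \<omega> = (if \<omega> \<in> space M - N then X t \<omega> else t)" for t \<omega>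
  have AE: "AE \<omega> in M. (\<lambda>t. Y t \<omega>) = (\<lambda>t. X t \<omega>)"
    using AE_not_in[OF N(2)] AE_space by eventually_elim (simp add: Y_def)
  have AE_t: "AE \<omega> in M. Y t \<omega> = X t \<omega>" for t using AE by eventually_elim meson
  have Ym: "random_variable borel (Y t)" if "t \<ge> 0" for t
  proof -
    have "space M - N \<in> sets M" using N(2) by auto
    then have "{\<omega>\<in>space M. \<omega> \<in> space M - N} \<in> sets M" by (simp add: set_diff_eq)
    then show ?thesis
      unfolding Y_def[abs_def] using random_variable_X[OF that] by (intro measurable_If) auto
  qed
  have "levy_process M Y"
  proof
    show "random_variable borel (Y t)" if "t \<ge> 0" for t by (rule Ym[OF that])
    show "AE \<omega> in M. Y 0 \<omega> = 0" using AE_t[of 0] start_zero by eventually_elim simp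
    show "AE \<omega> in M. cadlag (\<lambda>t. Y t \<omega>)" using AE cadlag_paths by eventually_elim simp
    fix n :: nat and t :: "nat \<Rightarrow> real" assume t: "t 0 \<ge> 0" "\<And>i. i < n \<Longrightarrow> t i \<le> t (Suc i)"
    have nonneg: "0 \<le> t i" if "i \<le> n" for i
      using that by (induction i) (use t in \<open>auto intro: order_trans\<close>)
    show "indep_vars (\<lambda>_. borel) (\<lambda>i \<omega>. Y (t (Suc i)) \<omega> - Y (t i) \<omega>) {..<n}"
    proof (rule indep_vars_cong_AE[OF independent_increments[OF t]])
      fix i assume i: "i \<in> {..<n}"
      show "(\<lambda>\<omega>. Y (t (Suc i)) \<omega> - Y (t i) \<omega>) \<in> borel_measurable M"
        using nonneg[of i] nonneg[of "Suc i"] i by (intro borel_measurable_diff Ym) auto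
      show "AE \<omega> in M. X (t (Suc i)) \<omega> - X (t i) \<omega> = Y (t (Suc i)) \<omega> - Y (t i) \<omega>"
        using AE_t[of "t i"] AE_t[of "t (Suc i)"] by eventually_elim simp
    qed
  next
    fix s h :: real assume sh: "s \<ge> 0" "h \<ge> 0"
    have eq: "distr M borel (\<lambda>\<omega>. Y a \<omega> - Y b \<omega>) = distr M borel (\<lambda>\<omega>. X a \<omega> - X b \<omega>)" if "0 \<le> a" "0 \<le> b" for a b
    proof (rule distr_cong_AE)
      show "AE \<omega> in M. Y a \<omega> - Y b \<omega> = X a \<omega> - X b \<omega>"
        using AE_t[of a] AE_t[of b] by eventually_elim simp
    qed (use that in \<open>auto intro!: borel_measurable_diff Ym random_variable_X\<close>)
    show "distr M borel (\<lambda>\<omega>. Y (s + h) \<omega> - Y s \<omega>) = distr M borel (\<lambda>\<omega>. Y h \<omega> - Y 0 \<omega>)"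
      using stationary_increments[OF sh] sh by (simp add: eq)
  qed
  moreover have "Q (\<lambda>t. Y t \<omega>)" for \<omega>
    using N(1) id by (cases "\<omega> \<in> space M - N") (auto simp: Y_def)
  ultimately show ?thesis using AE by blast
qed

text \<open>Two modifications are needed in succession: transience is proved for a version all of whose paths are
  regular, and it is then itself a path property that holds almost surely.\<close>

lemma AE_transient_path:
  assumes levy: "levy_process M X" and neg: "no_positive_jumps M X" and mean: "integral\<^sup>L M (X 1) > 0"
  shows "AE \<omega> in M. transient_path (\<lambda>t. X t \<omega>)"
proof -
  interpret levy_process M X by (rule levy)
  have "AE \<omega> in M. spectral_path (\<lambda>t. X t \<omega>)"
    using start_zero cadlag_paths neg[unfolded no_positive_jumps_def]
    by eventually_elim (auto intro: spectral_pathI)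
  from levy_modification[OF levy this transient_path.axioms(1)[OF transient_path_id]]
  obtain Y where Y: "levy_process M Y" "\<And>\<omega>. spectral_path (\<lambda>t. Y t \<omega>)"
    "AE \<omega> in M. (\<lambda>t. Y t \<omega>) = (\<lambda>t. X t \<omega>)" by blast
  have rcl: "rc_levy M Y"
  proof (intro rc_levy.intro rc_levy_axioms.intro Y(1))
    fix \<omega> t
    interpret spectral_path "\<lambda>t. Y t \<omega>" by (rule Y(2))
    show "right_cont (\<lambda>t. Y t \<omega>)" by (rule right_cont)
    show "Y 0 \<omega> = 0" by (rule zero)
    show "bdd_above ((\<lambda>s. Y s \<omega>) ` {0..t})" by (rule bdd)
  qed
  have Y1: "Y 1 \<in> borel_measurable M" using levy_process.random_variable_X[OF Y(1)] by simp
  have "AE \<omega> in M. Y 1 \<omega> = X 1 \<omega>" using Y(3) by eventually_elim meson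
  then have "integral\<^sup>L M (Y 1) = integral\<^sup>L M (X 1)"
    using Y1 random_variable_X[of 1] by (intro integral_cong_AE) auto
  then have "AE \<omega> in M. \<exists>K. \<forall>t\<ge>K. 1 < Y t \<omega>"
    using rc_levy.eventually_above_1[OF rcl] mean by simp
  with Y(3) show ?thesis
  proof eventually_elim
    case (elim \<omega>)
    have "transient_path (\<lambda>t. Y t \<omega>)"
      by (intro transient_path.intro transient_path_axioms.intro Y(2) elim(2))
    then show ?case unfolding elim(1) .
  qed
qed

theorem proposition1p1:
  fixes M :: "'a measure" and X :: "real \<Rightarrow> 'a \<Rightarrow> real" and \<sigma> :: "'a \<Rightarrow> real"
  assumes levy: "levy_process M X"
    and spectrally_negative: "no_positive_jumps M X"
    and positive_mean: "integral\<^sup>L M (X 1) > 0"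
    and sigma: "\<sigma> = last_nonpos X"
  shows "(AE \<omega> in M. bdd_above {t. t \<ge> 0 \<and> X t \<omega> \<le> 0}) \<and>
         same_distribution M
           {F_right X \<sigma>, F_left X \<sigma>, G_right X \<sigma>, G_left X \<sigma>, N_minus X \<sigma>, N_plus X \<sigma>}"
proof
  have AE: "AE \<omega> in M. transient_path (\<lambda>t. X t \<omega>)"
    by (rule AE_transient_path[OF levy spectrally_negative positive_mean])
  then show "AE \<omega> in M. bdd_above {t. t \<ge> 0 \<and> X t \<omega> \<le> 0}"
    by eventually_elim (rule transient_path.bdd_nonpos)
  obtain Y where Y: "levy_process M Y" "\<And>\<omega>. transient_path (\<lambda>t. Y t \<omega>)"
    "AE \<omega> in M. (\<lambda>t. Y t \<omega>) = (\<lambda>t. X t \<omega>)"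
    using levy_modification[OF levy AE transient_path_id] by blast
  interpret Y: transient_levy M Y
    by (intro transient_levy.intro transient_levy_axioms.intro Y(1,2))
  define \<rho> where "\<rho> = last_nonpos Y"
  have same: "same_distribution M {F_right Y \<rho>, F_left Y \<rho>, G_right Y \<rho>, G_left Y \<rho>, N_minus Y \<rho>, N_plus Y \<rho>}"
    using Y.same_distribution_statistics unfolding \<rho>_def Y.last_time_eq .
  have eq: "AE \<omega> in M. F_right X \<sigma> \<omega> = F_right Y \<rho> \<omega>" "AE \<omega> in M. F_left X \<sigma> \<omega> = F_left Y \<rho> \<omega>"
    "AE \<omega> in M. G_right X \<sigma> \<omega> = G_right Y \<rho> \<omega>" "AE \<omega> in M. G_left X \<sigma> \<omega> = G_left Y \<rho> \<omega>"
    "AE \<omega> in M. N_minus X \<sigma> \<omega> = N_minus Y \<rho> \<omega>" "AE \<omega> in M. N_plus X \<sigma> \<omega> = N_plus Y \<rho> \<omega>"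
  proof -
    have "X t \<omega> = Y t \<omega>" if "(\<lambda>t. Y t \<omega>) = (\<lambda>t. X t \<omega>)" for \<omega> t
      using fun_cong[OF that, of t] by simp
    note * = this
    have s: "\<sigma> \<omega> = \<rho> \<omega>" if "(\<lambda>t. Y t \<omega>) = (\<lambda>t. X t \<omega>)" for \<omega>
      using *[OF that] by (simp add: sigma \<rho>_def last_nonpos_def)
    have all: "F_right X \<sigma> \<omega> = F_right Y \<rho> \<omega> \<and> F_left X \<sigma> \<omega> = F_left Y \<rho> \<omega> \<and> G_right X \<sigma> \<omega> = G_right Y \<rho> \<omega> \<and>
      G_left X \<sigma> \<omega> = G_left Y \<rho> \<omega> \<and> N_minus X \<sigma> \<omega> = N_minus Y \<rho> \<omega> \<and> N_plus X \<sigma> \<omega> = N_plus Y \<rho> \<omega>"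
      if "(\<lambda>t. Y t \<omega>) = (\<lambda>t. X t \<omega>)" for \<omega>
      using *[OF that] s[OF that]
      by (simp add: F_right_def F_left_def G_right_def G_left_def N_minus_def N_plus_def running_sup_def running_inf_def)
    show "AE \<omega> in M. F_right X \<sigma> \<omega> = F_right Y \<rho> \<omega>" "AE \<omega> in M. F_left X \<sigma> \<omega> = F_left Y \<rho> \<omega>"
      "AE \<omega> in M. G_right X \<sigma> \<omega> = G_right Y \<rho> \<omega>" "AE \<omega> in M. G_left X \<sigma> \<omega> = G_left Y \<rho> \<omega>"
      "AE \<omega> in M. N_minus X \<sigma> \<omega> = N_minus Y \<rho> \<omega>" "AE \<omega> in M. N_plus X \<sigma> \<omega> = N_plus Y \<rho> \<omega>"
      using Y(3) by (eventually_elim, use all in blast)+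
  qed
  let ?X = "{F_right X \<sigma>, F_left X \<sigma>, G_right X \<sigma>, G_left X \<sigma>, N_minus X \<sigma>, N_plus X \<sigma>}"
  let ?D = "distr (completion M) borel (F_right Y \<rho>)"
  have transfer: "S \<in> borel_measurable (completion M) \<and> distr (completion M) borel S = ?D"
    if "AE \<omega> in M. S \<omega> = T \<omega>"
      "T \<in> {F_right Y \<rho>, F_left Y \<rho>, G_right Y \<rho>, G_left Y \<rho>, N_minus Y \<rho>, N_plus Y \<rho>}" for S T
  proof -
    have T: "T \<in> borel_measurable (completion M)" "distr (completion M) borel T = ?D"
      using same that(2) unfolding same_distribution_def by blast+
    show ?thesis
      using AE_eq_borel_completion[OF T(1) that(1)] T(2) by (intro conjI) (assumption, rule trans)
  qed
  have "S \<in> borel_measurable (completion M) \<and> distr (completion M) borel S = ?D"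
    if "S \<in> ?X" for S
  proof -
    note t = transfer[OF eq(1)] transfer[OF eq(2)] transfer[OF eq(3)] transfer[OF eq(4)] transfer[OF eq(5)] transfer[OF eq(6)]
    show ?thesis
      using that by (elim insertE emptyE; hypsubst) (rule t, simp)+
  qed
  then have *: "\<And>S. S \<in> ?X \<Longrightarrow> S \<in> borel_measurable (completion M)"
    "\<And>S. S \<in> ?X \<Longrightarrow> distr (completion M) borel S = ?D" by blast+
  show "same_distribution M {F_right X \<sigma>, F_left X \<sigma>, G_right X \<sigma>, G_left X \<sigma>, N_minus X \<sigma>, N_plus X \<sigma>}"
    unfolding same_distribution_def using * by (intro conjI ballI) (assumption | simp only:)+
qed

end
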